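(* Let $G=H^k$, where $H=A_n$ for some $n\ge 5$, and $k\ge 1$. Then the following are equivalent: (i) $G$ is a Beauville group; (ii) $G$ is a $2$-generator group not isomorphic to $A_5$; (iii) either $n=5$ and $2\le k\le d_2(H)\;(=19)$, or $n>5$ and $k\le d_2(H)$.
   Context: $A_n$ is the alternating group of degree $n$; $H^k$ is the $k$-th cartesian (direct) power of $H$. A group is a $2$-generator group if it can be generated by two elements. For a finite group $H$, $d_2(H)$ is the number of normal subgroups $N$ of the free group $F_2$ of rank $2$ with $F_2/N\cong H$; equivalently, the number of orbits of ${\rm Aut}\,H$ on ordered pairs $(x,y)\in H^2$ with $\langle x,y\rangle=H$. A finite group $G$ is a Beauville group (of unmixed type) if for $i=1,2$ there are elements $a_i,b_i,c_i\in G$ which generate $G$, of orders $l_i,m_i,n_i$ respectively, such that: (1) $a_ib_ic_i=1$ for $i=1,2$; (2) $l_i^{-1}+m_i^{-1}+n_i^{-1}<1$ for $i=1,2$; (3) no non-identity power of $a_1$, $b_1$ or $c_1$ is conjugate in $G$ to a power of $a_2$, $b_2$ or $c_2$. *)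

theory Defs
  imports "HOL-Algebra.Algebra"
begin

text \<open>
  The free group on a set \<open>S\<close>, realised on reduced words.  A letter \<open>(i, True)\<close> stands for the
  generator \<open>i\<close> and \<open>(i, False)\<close> for its inverse; \<open>push_letter\<close> multiplies a reduced word by a
  letter on the left.
\<close>

type_synonym 'a letter = "'a * bool"

definition inv_letter :: "'a letter \<Rightarrow> 'a letter" where
  "inv_letter x = (fst x, \<not> snd x)"

definition reduced :: "'a letter list \<Rightarrow> bool" where
  "reduced w \<longleftrightarrow> successively (\<lambda>x y. y \<noteq> inv_letter x) w"

fun push_letter :: "'a letter \<Rightarrow> 'a letter list \<Rightarrow> 'a letter list" where
  "push_letter x [] = [x]"
| "push_letter x (y # w) = (if y = inv_letter x then w else x # y # w)"

definition free_group :: "'a set \<Rightarrow> 'a letter list monoid" where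
  "free_group S = \<lparr> carrier = {w. reduced w \<and> fst ` set w \<subseteq> S},
                    monoid.mult = foldr push_letter, one = [] \<rparr>"

lemma inv_letter_inv [simp]: "inv_letter (inv_letter x) = x"
  by (simp add: inv_letter_def)

lemma fst_inv_letter [simp]: "fst (inv_letter x) = fst x"
  by (simp add: inv_letter_def)

lemma reduced_push: "reduced w \<Longrightarrow> reduced (push_letter x w)"
  by (cases w) (auto simp: reduced_def successively_Cons)

lemma reduced_tl: "reduced (x # w) \<Longrightarrow> reduced w"
  by (auto simp: reduced_def successively_Cons)

lemma push_reduced: "reduced (x # w) \<Longrightarrow> push_letter x w = x # w"
  by (cases w) (auto simp: reduced_def)

lemma push_push_inv: "reduced w \<Longrightarrow> push_letter x (push_letter (inv_letter x) w) = w"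
  by (cases w) (auto simp: push_reduced)

lemma set_push: "fst ` set (push_letter x w) \<subseteq> insert (fst x) (fst ` set w)"
  by (cases w) auto

lemma reduced_word_mult: "reduced v \<Longrightarrow> reduced (foldr push_letter u v)"
  by (induction u) (auto simp: reduced_push)

lemma set_word_mult: "fst ` set (foldr push_letter u v) \<subseteq> fst ` set u \<union> fst ` set v"
proof (induction u)
  case (Cons x u)
  have "fst ` set (foldr push_letter (x # u) v)
      \<subseteq> insert (fst x) (fst ` set (foldr push_letter u v))"
    using set_push by simp
  also have "\<dots> \<subseteq> insert (fst x) (fst ` set u \<union> fst ` set v)"
    using Cons.IH by (rule insert_mono)
  finally show ?case by simp
qed simp

lemma word_mult_push:
  assumes "reduced w"
  shows "foldr push_letter (push_letter x r) w = push_letter x (foldr push_letter r w)"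
  using push_push_inv[OF reduced_word_mult[OF assms]] by (cases r) auto

lemma word_mult_assoc:
  assumes "reduced w"
  shows "foldr push_letter (foldr push_letter u v) w
       = foldr push_letter u (foldr push_letter v w)"
  by (induction u) (simp_all add: word_mult_push assms)

lemma left_inverse_exists:
  "reduced w \<Longrightarrow> \<exists>v. reduced v \<and> fst ` set v \<subseteq> fst ` set w \<and> foldr push_letter v w = []"
proof (induction w)
  case Nil
  show ?case by (intro exI[of _ "[]"]) (simp add: reduced_def)
next
  case (Cons x w)
  then obtain v where v: "reduced v" "fst ` set v \<subseteq> fst ` set w" "foldr push_letter v w = []"
    using reduced_tl by blast
  let ?u = "foldr push_letter v [inv_letter x]"
  have "reduced ?u" by (rule reduced_word_mult) (simp add: reduced_def)
  moreover have "fst ` set ?u \<subseteq> fst ` set (x # w)"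
    using set_word_mult[of v "[inv_letter x]"] v(2) by simp blast
  moreover have "foldr push_letter ?u (x # w) = []"
    using v(3) by (simp add: word_mult_assoc[OF Cons.prems])
  ultimately show ?case by blast
qed

lemma group_free_group: "group (free_group S)"
proof (rule groupI)
  fix u assume u: "u \<in> carrier (free_group S)"
  then have "reduced u" by (simp add: free_group_def)
  then obtain v where v: "reduced v" "fst ` set v \<subseteq> fst ` set u" "foldr push_letter v u = []"
    using left_inverse_exists[of u] by blast
  moreover have "fst ` set u \<subseteq> S"
    using u by (simp add: free_group_def)
  ultimately have "fst ` set v \<subseteq> S" by blast
  then show "\<exists>v\<in>carrier (free_group S). v \<otimes>\<^bsub>free_group S\<^esub> u = \<one>\<^bsub>free_group S\<^esub>"
    using v by (auto simp: free_group_def)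
next
  fix u v assume "u \<in> carrier (free_group S)" "v \<in> carrier (free_group S)"
  then show "u \<otimes>\<^bsub>free_group S\<^esub> v \<in> carrier (free_group S)"
    using set_word_mult[of u v] by (simp add: free_group_def reduced_word_mult) blast
qed (auto simp: free_group_def word_mult_assoc reduced_def)

text \<open>The universal property of the free group.\<close>

lemma free_group_universal:
  fixes G (structure) and f :: "'i \<Rightarrow> 'a"
  assumes "group G" and f: "f \<in> S \<rightarrow> carrier G"
  shows "\<exists>h\<in>hom (free_group S) G. \<forall>x\<in>S. h [(x, True)] = f x"
proof -
  interpret group G by fact
  define e where "e x = (if snd x then f (fst x) else inv (f (fst x)))" for x :: "'i letter"
  define h where "h w = foldr (\<lambda>x g. e x \<otimes> g) w \<one>" for w
  have e_closed: "e x \<in> carrier G" if "fst x \<in> S" for x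
    using f that by (auto simp: e_def)
  have e_inv: "e (inv_letter x) = inv (e x)" if "fst x \<in> S" for x
    using funcset_mem[OF f that] by (simp add: e_def inv_letter_def)
  have h_closed: "h w \<in> carrier G" if "fst ` set w \<subseteq> S" for w
    using that by (induction w) (auto simp: h_def e_closed)
  have h_push: "h (push_letter x w) = e x \<otimes> h w"
    if "fst x \<in> S" "fst ` set w \<subseteq> S" for x w
  proof (cases w)
    case (Cons y v)
    then have "h v \<in> carrier G" using that h_closed by simp
    then have "e x \<otimes> (inv (e x) \<otimes> h v) = h v"
      using e_closed[OF that(1)] by (simp add: m_assoc[symmetric])
    then show ?thesis using Cons by (auto simp: h_def e_inv[OF that(1)])
  qed (simp add: h_def)
  have h_mult: "h (foldr push_letter u v) = h u \<otimes> h v"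
    if "fst ` set u \<subseteq> S" "fst ` set v \<subseteq> S" for u v
    using that(1)
  proof (induction u)
    case Nil
    then show ?case using h_closed[OF that(2)] by (simp add: h_def)
  next
    case (Cons x u)
    have "fst ` set (foldr push_letter u v) \<subseteq> S"
      using set_word_mult[of u v] Cons.prems that(2) by simp blast
    moreover have "fst x \<in> S" using Cons.prems by auto
    moreover have "h (x # u) = e x \<otimes> h u" by (simp add: h_def)
    ultimately show ?case
      using Cons h_closed[of u] h_closed[OF that(2)] e_closed
      by (auto simp: h_push m_assoc)
  qed
  have "h \<in> hom (free_group S) G"
    by (rule homI) (auto simp: free_group_def h_closed h_mult)
  moreover have "h [(x, True)] = f x" if "x \<in> S" for x
    using funcset_mem[OF f that] by (simp add: h_def e_def)
  ultimately show ?thesis by blast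
qed

text \<open>
  The free group of rank 2 is \<open>free_group (UNIV :: bool set)\<close>.  The cardinality in \<open>d2\<close> is
  meaningful for finite \<open>H\<close>, where the set is finite.
\<close>

definition d2 :: "('a, 'b) monoid_scheme \<Rightarrow> nat" where
  "d2 H = card {N. N \<lhd> free_group (UNIV :: bool set) \<and> free_group (UNIV :: bool set) Mod N \<cong> H}"

definition two_generator_group :: "('a, 'b) monoid_scheme \<Rightarrow> bool" where
  "two_generator_group G \<longleftrightarrow>
     group G \<and> (\<exists>x\<in>carrier G. \<exists>y\<in>carrier G. generate G {x, y} = carrier G)"

definition direct_power :: "('a, 'b) monoid_scheme \<Rightarrow> nat \<Rightarrow> (nat \<Rightarrow> 'a) monoid" where
  "direct_power H k = product_group {1..k} (\<lambda>_. H)"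

definition conjugate_in :: "('a, 'b) monoid_scheme \<Rightarrow> 'a \<Rightarrow> 'a \<Rightarrow> bool" where
  "conjugate_in G x y \<longleftrightarrow> (\<exists>g\<in>carrier G. g \<otimes>\<^bsub>G\<^esub> x \<otimes>\<^bsub>G\<^esub> inv\<^bsub>G\<^esub> g = y)"

definition hyperbolic_generating_triple ::
  "('a, 'b) monoid_scheme \<Rightarrow> 'a \<Rightarrow> 'a \<Rightarrow> 'a \<Rightarrow> bool" where
  "hyperbolic_generating_triple G a b c \<longleftrightarrow>
     {a, b, c} \<subseteq> carrier G \<and> generate G {a, b, c} = carrier G \<and>
     a \<otimes>\<^bsub>G\<^esub> b \<otimes>\<^bsub>G\<^esub> c = \<one>\<^bsub>G\<^esub> \<and>
     1 / real (group.ord G a) + 1 / real (group.ord G b) + 1 / real (group.ord G c) < 1"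

definition beauville_group :: "('a, 'b) monoid_scheme \<Rightarrow> bool" where
  "beauville_group G \<longleftrightarrow>
     group G \<and> finite (carrier G) \<and>
     (\<exists>a\<^sub>1 b\<^sub>1 c\<^sub>1 a\<^sub>2 b\<^sub>2 c\<^sub>2.
        hyperbolic_generating_triple G a\<^sub>1 b\<^sub>1 c\<^sub>1 \<and>
        hyperbolic_generating_triple G a\<^sub>2 b\<^sub>2 c\<^sub>2 \<and>
        (\<forall>x\<in>{a\<^sub>1, b\<^sub>1, c\<^sub>1}. \<forall>y\<in>{a\<^sub>2, b\<^sub>2, c\<^sub>2}. \<forall>(i :: int) (j :: int).
           x [^]\<^bsub>G\<^esub> i \<noteq> \<one>\<^bsub>G\<^esub> \<longrightarrow> \<not> conjugate_in G (x [^]\<^bsub>G\<^esub> i) (y [^]\<^bsub>G\<^esub> j)))"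

end

theory Submission
  imports Defs
begin

text \<open>
  Write \<open>H\<close> for the alternating group of degree \<open>n \<ge> 5\<close>.  A generating pair of \<open>H\<close> is a surjection from
  the free group of rank two onto \<open>H\<close>, and its kernel is the set \<open>relators\<close> of the pair; so \<open>d2 H\<close>
  counts the kernels of generating pairs.  A pair of elements of \<open>H\<^sup>k\<close> is a list of \<open>k\<close> pairs of elements
  of \<open>H\<close>, called rows.  Since \<open>H\<close> is simple and not abelian, such a list generates \<open>H\<^sup>k\<close> exactly when
  every row generates \<open>H\<close> and the rows have distinct kernels (Hall).  Hence \<open>H\<^sup>k\<close> is a two-generator
  group exactly when \<open>k \<le> d2 H\<close> (\<open>two_generator_direct_power_iff\<close>).

  A Beauville structure on \<open>H\<^sup>k\<close> is obtained from two such lists \<open>L\<close> and \<open>L'\<close>, each containing a row of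
  hyperbolic type, with a condition on conjugate powers.  Here a row \<open>(x, y)\<close> stands for the triple
  \<open>(x, y, (x y)\<^sup>-\<^sup>1)\<close>, and the lists have three columns each.  The condition on powers holds when
  in every coordinate the entries of the two lists have no conjugate nontrivial powers, or, by looking at
  orders only, when for every prime \<open>p\<close> no column of \<open>L\<close> and column of \<open>L'\<close> have the same nonempty set of coordinates in
  which the \<open>p\<close>-part of the order is maximal (\<open>conj_disjoint_product_separated\<close>).

  For \<open>k \<le> 6\<close> two generating triples with disjoint conjugacy classes of powers suffice: the rotations
  of one stand opposite to the rotations of the other (\<open>beauville_small_power\<close>).  For \<open>6 \<le> k \<le> d2 H\<close>
  the list \<open>L\<close> consists essentially of whole orbits of kernels under rotation, starting with the orbits of two
  triples whose orders no prime divides in the same way, and \<open>L'\<close> is \<open>L\<close> shifted by one orbit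
  (\<open>beauville_large_power\<close>): comparing the two lists orbit by orbit would force the first two orbits to
  agree.  In degree at least ten the two triples have types \<open>(3, r, s)\<close> and \<open>(4, h, h)\<close>, where
  \<open>h = n div 2\<close>; they generate because every subgroup that contains a three-cycle and links all points by
  three-cycles is the whole group.  In degrees seven to nine the types \<open>(6, 3, 4)\<close> and \<open>(5, 7, 7)\<close> are
  coprime.  In degree six small powers need explicit lists.

  In degree five a computation with explicit permutations shows that there are exactly 19 kernels:
  19 generating pairs with distinct kernels are given, and every generating pair is conjugate to one of
  them under the symmetric group.  Two orderings of these pairs give Beauville structures for
  \<open>2 \<le> k \<le> 19\<close>.  For \<open>k = 1\<close> there is none, because every hyperbolic triple contains an element of order
  five, and all subgroups of order five are conjugate.
\<close>

section \<open>Words, relators and generating pairs\<close>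

abbreviation F2 :: "bool letter list monoid" where
  "F2 \<equiv> free_group (UNIV :: bool set)"

definition eval_letter :: "('a, 'b) monoid_scheme \<Rightarrow> 'a \<Rightarrow> 'a \<Rightarrow> bool letter \<Rightarrow> 'a" where
  "eval_letter G x y l =
     (let g = if fst l then x else y in if snd l then g else inv\<^bsub>G\<^esub> g)"

definition eval_word :: "('a, 'b) monoid_scheme \<Rightarrow> 'a \<Rightarrow> 'a \<Rightarrow> bool letter list \<Rightarrow> 'a" where
  "eval_word G x y w = foldr (\<lambda>l g. eval_letter G x y l \<otimes>\<^bsub>G\<^esub> g) w \<one>\<^bsub>G\<^esub>"

definition relators :: "('a, 'b) monoid_scheme \<Rightarrow> 'a \<Rightarrow> 'a \<Rightarrow> bool letter list set" where
  "relators G x y = {w \<in> carrier F2. eval_word G x y w = \<one>\<^bsub>G\<^esub>}"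

definition gen_pair :: "('a, 'b) monoid_scheme \<Rightarrow> 'a \<Rightarrow> 'a \<Rightarrow> bool" where
  "gen_pair G x y \<longleftrightarrow> x \<in> carrier G \<and> y \<in> carrier G \<and> generate G {x, y} = carrier G"

lemma eval_word_Nil [simp]: "eval_word G x y [] = \<one>\<^bsub>G\<^esub>"
  by (simp add: eval_word_def)

lemma eval_word_Cons [simp]:
  "eval_word G x y (l # w) = eval_letter G x y l \<otimes>\<^bsub>G\<^esub> eval_word G x y w"
  by (simp add: eval_word_def)

lemma carrier_F2: "w \<in> carrier F2 \<longleftrightarrow> reduced w"
  by (simp add: free_group_def)

lemma F2_group: "group F2"
  by (rule group_free_group)

lemma F2_one: "\<one>\<^bsub>F2\<^esub> = []"
  by (simp add: free_group_def)

lemma reduced_single: "reduced [l]"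
  by (simp add: reduced_def)

lemma F2_Cons:
  assumes "reduced (l # w)"
  shows "[l] \<otimes>\<^bsub>F2\<^esub> w = l # w"
  using push_reduced[OF assms] by (simp add: free_group_def)

context group
begin

lemma eval_letter_closed:
  "x \<in> carrier G \<Longrightarrow> y \<in> carrier G \<Longrightarrow> eval_letter G x y l \<in> carrier G"
  by (simp add: eval_letter_def Let_def)

lemma eval_word_closed:
  "x \<in> carrier G \<Longrightarrow> y \<in> carrier G \<Longrightarrow> eval_word G x y w \<in> carrier G"
  by (induction w) (auto simp: eval_letter_closed)

lemma hom_from_F2_is_eval:
  assumes "h \<in> hom F2 G" "reduced w"
  shows "h w = eval_word G (h [(True, True)]) (h [(False, True)]) w"
proof -
  interpret F: group F2 by (rule F2_group)
  interpret gh: group_hom F2 G h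
    using assms(1) by (intro group_hom.intro group_hom_axioms.intro F2_group is_group)
  have letter: "h [l] = eval_letter G (h [(True, True)]) (h [(False, True)]) l" for l
  proof (cases "snd l")
    case True
    then show ?thesis by (cases l) (auto simp: eval_letter_def)
  next
    case False
    obtain b where l: "l = (b, False)" using False by (cases l) auto
    have c: "[(b, True)] \<in> carrier F2" "[(b, False)] \<in> carrier F2"
      by (simp_all add: carrier_F2 reduced_single)
    have "[(b, False)] \<otimes>\<^bsub>F2\<^esub> [(b, True)] = \<one>\<^bsub>F2\<^esub>"
      by (simp add: free_group_def inv_letter_def)
    then have "inv\<^bsub>F2\<^esub> [(b, True)] = [(b, False)]"
      using c by (simp add: F.inv_equality)
    then have "h [(b, False)] = inv (h [(b, True)])"
      using gh.hom_inv c by metis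
    then show ?thesis using l by (auto simp: eval_letter_def)
  qed
  show ?thesis using assms(2)
  proof (induction w)
    case Nil
    then show ?case using gh.hom_one by (simp add: F2_one)
  next
    case (Cons l w)
    have "h (l # w) = h [l] \<otimes> h w"
      using F2_Cons[OF Cons.prems] gh.hom_mult[of "[l]" w] Cons.prems
      by (auto simp: carrier_F2 reduced_single dest: reduced_tl)
    also have "h w = eval_word G (h [(True, True)]) (h [(False, True)]) w"
      using Cons.IH reduced_tl[OF Cons.prems] .
    also have "h [l] = eval_letter G (h [(True, True)]) (h [(False, True)]) l"
      by (rule letter)
    finally show ?case by (simp only: eval_word_Cons)
  qed
qed

lemma eval_word_hom:
  assumes "x \<in> carrier G" "y \<in> carrier G"
  shows "eval_word G x y \<in> hom F2 G"
proof -
  interpret F: group F2 by (rule F2_group)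
  obtain h where h: "h \<in> hom F2 G" "\<forall>b. h [(b, True)] = (if b then x else y)"
    using free_group_universal[OF is_group, of "\<lambda>b. if b then x else y" UNIV] assms by auto
  have eq: "h w = eval_word G x y w" if "w \<in> carrier F2" for w
    using hom_from_F2_is_eval[OF h(1)] h(2) that by (simp add: carrier_F2)
  show ?thesis
  proof (rule homI)
    fix v w assume vw: "v \<in> carrier F2" "w \<in> carrier F2"
    then have "v \<otimes>\<^bsub>F2\<^esub> w \<in> carrier F2" by simp
    then show "eval_word G x y (v \<otimes>\<^bsub>F2\<^esub> w) = eval_word G x y v \<otimes> eval_word G x y w"
      using hom_mult[OF h(1) vw] by (simp add: eq vw)
  qed (simp add: assms eval_word_closed)
qed

lemma eval_word_group_hom:
  assumes "x \<in> carrier G" "y \<in> carrier G"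
  shows "group_hom F2 G (eval_word G x y)"
  by (intro group_hom.intro group_hom_axioms.intro F2_group is_group eval_word_hom assms)

lemma eval_word_gens:
  assumes "x \<in> carrier G" "y \<in> carrier G"
  shows "eval_word G x y [(True, True)] = x" "eval_word G x y [(False, True)] = y"
  using assms by (simp_all add: eval_letter_def)

lemma image_eval_word:
  assumes "x \<in> carrier G" "y \<in> carrier G"
  shows "eval_word G x y ` carrier F2 = generate G {x, y}"
proof
  interpret gh: group_hom F2 G "eval_word G x y" by (rule eval_word_group_hom[OF assms])
  have letter: "eval_letter G x y l \<in> generate G {x, y}" for l
    unfolding eval_letter_def Let_def by (auto intro: generate.incl generate.inv)
  have "eval_word G x y w \<in> generate G {x, y}" for w
    by (induction w) (auto intro: generate.one generate.eng letter)
  then show "eval_word G x y ` carrier F2 \<subseteq> generate G {x, y}" by blast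
  have "[(b, True)] \<in> carrier F2" for b by (simp add: carrier_F2 reduced_single)
  then have "{x, y} \<subseteq> eval_word G x y ` carrier F2"
    using eval_word_gens[OF assms] by (metis empty_subsetI image_eqI insert_subset)
  then show "generate G {x, y} \<subseteq> eval_word G x y ` carrier F2"
    using generate_subgroup_incl gh.img_is_subgroup by blast
qed

lemma gen_pair_image:
  "gen_pair G x y \<Longrightarrow> eval_word G x y ` carrier F2 = carrier G"
  by (simp add: gen_pair_def image_eval_word)

lemma relators_kernel: "relators G x y = kernel F2 G (eval_word G x y)"
  by (simp add: relators_def kernel_def)

lemma relators_normal:
  assumes "x \<in> carrier G" "y \<in> carrier G"
  shows "relators G x y \<lhd> F2"
  unfolding relators_kernel using group_hom.normal_kernel[OF eval_word_group_hom[OF assms]] .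

text \<open>
  An isomorphism from the quotient by \<open>N\<close> composes with the projection to a surjection, which is the
  evaluation of words at the images of the two free generators.
\<close>

lemma free_quotients_are_relators:
  "{N. N \<lhd> F2 \<and> F2 Mod N \<cong> G} = {relators G x y | x y. gen_pair G x y}"
proof (intro equalityI subsetI)
  fix N assume "N \<in> {N. N \<lhd> F2 \<and> F2 Mod N \<cong> G}"
  then have N: "N \<lhd> F2" and "F2 Mod N \<cong> G" by auto
  then obtain f where f: "f \<in> iso (F2 Mod N) G" by (auto simp: is_iso_def)
  interpret N: normal N F2 by (rule N)
  let ?h = "\<lambda>w. f (N #>\<^bsub>F2\<^esub> w)"
  have nat: "(#>\<^bsub>F2\<^esub>) N \<in> hom F2 (F2 Mod N)" by (rule N.r_coset_hom_Mod)
  have h: "?h \<in> hom F2 G"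
  proof (rule homI)
    have fh: "f \<in> hom (F2 Mod N) G" using f by (simp add: iso_def)
    show "f (N #>\<^bsub>F2\<^esub> (u \<otimes>\<^bsub>F2\<^esub> v)) = f (N #>\<^bsub>F2\<^esub> u) \<otimes> f (N #>\<^bsub>F2\<^esub> v)"
      if "u \<in> carrier F2" "v \<in> carrier F2" for u v
      using hom_mult[OF fh] hom_mult[OF nat that] hom_in_carrier[OF nat] that by simp
    show "f (N #>\<^bsub>F2\<^esub> u) \<in> carrier G" if "u \<in> carrier F2" for u
      using hom_in_carrier[OF fh] hom_in_carrier[OF nat] that by simp
  qed
  define x y where "x = ?h [(True, True)]" and "y = ?h [(False, True)]"
  have xy: "x \<in> carrier G" "y \<in> carrier G"
    by (auto simp: x_def y_def carrier_F2 reduced_single intro!: hom_in_carrier[OF h])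
  have ev: "?h w = eval_word G x y w" if "w \<in> carrier F2" for w
    using hom_from_F2_is_eval[OF h] that by (simp add: x_def y_def carrier_F2)
  have "?h ` carrier F2 = carrier G"
  proof -
    have "carrier (F2 Mod N) = (\<lambda>w. N #>\<^bsub>F2\<^esub> w) ` carrier F2"
      by (auto simp: FactGroup_def RCOSETS_def)
    then show ?thesis using f by (auto simp: iso_def bij_betw_def image_image)
  qed
  then have "eval_word G x y ` carrier F2 = carrier G" using ev by simp
  then have gp: "gen_pair G x y" using xy image_eval_word[OF xy] by (simp add: gen_pair_def)
  interpret Q: group "F2 Mod N" by (rule N.factorgroup_is_group)
  have inj: "inj_on f (carrier (F2 Mod N))" and fh: "f \<in> hom (F2 Mod N) G"
    using f by (auto simp: iso_def bij_betw_def)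
  have "N = relators G x y"
  proof (rule Set.set_eqI)
    fix w
    have key: "w \<in> N \<longleftrightarrow> eval_word G x y w = \<one>" if w: "w \<in> carrier F2"
    proof -
      have "eval_word G x y w = \<one> \<longleftrightarrow> f (N #>\<^bsub>F2\<^esub> w) = f \<one>\<^bsub>F2 Mod N\<^esub>"
        using ev[OF w] hom_one[OF fh Q.is_group is_group] by simp
      also have "\<dots> \<longleftrightarrow> N #>\<^bsub>F2\<^esub> w = \<one>\<^bsub>F2 Mod N\<^esub>"
        by (rule inj_on_eq_iff[OF inj hom_in_carrier[OF nat w] Q.one_closed])
      also have "\<dots> \<longleftrightarrow> w \<in> N"
        using N.coset_join1[of N w] N.coset_join2[of w N] w N.subset N.is_subgroup
        by (auto simp: FactGroup_def)
      finally show ?thesis by simp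
    qed
    show "w \<in> N \<longleftrightarrow> w \<in> relators G x y"
      using key N.subset by (auto simp: relators_def)
  qed
  then show "N \<in> {relators G x y | x y. gen_pair G x y}" using gp by blast
next
  fix N assume "N \<in> {relators G x y | x y. gen_pair G x y}"
  then obtain x y where N: "N = relators G x y" and gp: "gen_pair G x y" by blast
  then have xy: "x \<in> carrier G" "y \<in> carrier G" by (auto simp: gen_pair_def)
  show "N \<in> {N. N \<lhd> F2 \<and> F2 Mod N \<cong> G}"
    using relators_normal[OF xy] group_hom.FactGroup_iso[OF eval_word_group_hom[OF xy] gen_pair_image[OF gp]]
    by (simp add: N relators_kernel)
qed

lemma d2_eq_card_relators: "d2 G = card {relators G x y | x y. gen_pair G x y}"
  by (simp add: d2_def free_quotients_are_relators)

lemma finite_relators: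
  assumes "finite (carrier G)"
  shows "finite {relators G x y | x y. gen_pair G x y}"
proof (rule finite_subset)
  show "{relators G x y | x y. gen_pair G x y} \<subseteq> (\<lambda>(x, y). relators G x y) ` (carrier G \<times> carrier G)"
    by (auto simp: gen_pair_def)
qed (use assms in simp)

lemma eval_word_pow:
  assumes "x \<in> carrier G" "y \<in> carrier G" "w \<in> carrier F2"
  shows "eval_word G x y (w [^]\<^bsub>F2\<^esub> (d :: nat)) = eval_word G x y w [^] d"
  using group_hom.hom_nat_pow[OF eval_word_group_hom[OF assms(1,2)] assms(3)] .

end

lemma relators_eq_ord:
  assumes "group G" "group G'" "x \<in> carrier G" "y \<in> carrier G" "x' \<in> carrier G'" "y' \<in> carrier G'"
    and "relators G x y = relators G' x' y'" "w \<in> carrier F2"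
  shows "group.ord G (eval_word G x y w) = group.ord G' (eval_word G' x' y' w)"
proof -
  interpret G: group G by fact
  interpret G': group G' by fact
  interpret F: group F2 by (rule F2_group)
  have "eval_word G x y w [^]\<^bsub>G\<^esub> d = \<one>\<^bsub>G\<^esub> \<longleftrightarrow> eval_word G' x' y' w [^]\<^bsub>G'\<^esub> d = \<one>\<^bsub>G'\<^esub>" for d :: nat
  proof -
    have "w [^]\<^bsub>F2\<^esub> d \<in> carrier F2" using assms(8) by simp
    then have "eval_word G x y (w [^]\<^bsub>F2\<^esub> d) = \<one>\<^bsub>G\<^esub> \<longleftrightarrow> eval_word G' x' y' (w [^]\<^bsub>F2\<^esub> d) = \<one>\<^bsub>G'\<^esub>"
      using assms(7) by (auto simp: relators_def)
    then show ?thesis using G.eval_word_pow G'.eval_word_pow assms by metis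
  qed
  then have "G.ord (eval_word G x y w) dvd d \<longleftrightarrow> G'.ord (eval_word G' x' y' w) dvd d" for d
    using G.pow_eq_id G'.pow_eq_id G.eval_word_closed G'.eval_word_closed assms by metis
  then show ?thesis by (meson dvd_antisym dvd_refl)
qed

section \<open>Generating pairs of direct powers\<close>

lemma eval_word_product_group:
  assumes H: "group H" and XY: "\<And>i. i \<in> I \<Longrightarrow> P i \<in> carrier H" "\<And>i. i \<in> I \<Longrightarrow> Q i \<in> carrier H"
  shows "eval_word (product_group I (\<lambda>_. H)) (restrict P I) (restrict Q I) w
       = (\<lambda>i\<in>I. eval_word H (P i) (Q i) w)"
proof (induction w)
  case (Cons l w)
  have "eval_letter (product_group I (\<lambda>_. H)) (restrict P I) (restrict Q I) l
      = (\<lambda>i\<in>I. eval_letter H (P i) (Q i) l)"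
    using assms by (auto simp: eval_letter_def Let_def fun_eq_iff)
  then show ?case unfolding eval_word_Cons Cons by (intro ext) simp
qed simp

lemma nonabelian_not_comm:
  assumes "group H" "\<not> comm_group H"
  obtains a b where "a \<in> carrier H" "b \<in> carrier H" "a \<otimes>\<^bsub>H\<^esub> b \<noteq> b \<otimes>\<^bsub>H\<^esub> a"
  using group.group_comm_groupI[OF assms(1)] assms(2) by blast

text \<open>
  A containment of kernels induces a surjection from \<open>H\<close> onto itself, which is injective as \<open>H\<close> is finite.
\<close>

lemma relators_subset_eq:
  assumes H: "group H" "finite (carrier H)" and a: "gen_pair H x y" and b: "gen_pair H x' y'"
    and sub: "relators H x y \<subseteq> relators H x' y'"
  shows "relators H x y = relators H x' y'"
proof -
  interpret group H by fact
  interpret F: group F2 by (rule F2_group)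
  have c: "x \<in> carrier H" "y \<in> carrier H" "x' \<in> carrier H" "y' \<in> carrier H"
    using a b by (auto simp: gen_pair_def)
  interpret e: group_hom F2 H "eval_word H x y" by (rule eval_word_group_hom[OF c(1,2)])
  interpret e': group_hom F2 H "eval_word H x' y'" by (rule eval_word_group_hom[OF c(3,4)])
  have fact: "eval_word H x' y' v = eval_word H x' y' w"
    if vw: "v \<in> carrier F2" "w \<in> carrier F2" and eq: "eval_word H x y v = eval_word H x y w" for v w
  proof -
    have "eval_word H x y (v \<otimes>\<^bsub>F2\<^esub> inv\<^bsub>F2\<^esub> w) = \<one>\<^bsub>H\<^esub>"
      using vw eq by (simp add: r_inv)
    then have "v \<otimes>\<^bsub>F2\<^esub> inv\<^bsub>F2\<^esub> w \<in> relators H x' y'"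
      using vw by (intro subsetD[OF sub]) (simp add: relators_def)
    then have "eval_word H x' y' v \<otimes>\<^bsub>H\<^esub> inv\<^bsub>H\<^esub> eval_word H x' y' w = \<one>\<^bsub>H\<^esub>"
      using vw by (simp add: relators_def)
    then have "inv\<^bsub>H\<^esub> (inv\<^bsub>H\<^esub> eval_word H x' y' w) = eval_word H x' y' v"
      using vw by (intro inv_equality) auto
    then show ?thesis using vw by simp
  qed
  define f where "f g = eval_word H x' y' (SOME w. w \<in> carrier F2 \<and> eval_word H x y w = g)" for g
  have f: "f (eval_word H x y w) = eval_word H x' y' w" if "w \<in> carrier F2" for w
  proof -
    let ?v = "SOME v. v \<in> carrier F2 \<and> eval_word H x y v = eval_word H x y w"
    have "?v \<in> carrier F2 \<and> eval_word H x y ?v = eval_word H x y w"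
      by (rule someI[of _ w]) (use that in simp)
    then show ?thesis unfolding f_def using fact that by blast
  qed
  have "f ` carrier H = carrier H"
  proof -
    have "f ` eval_word H x y ` carrier F2 = eval_word H x' y' ` carrier F2"
      using f by (auto simp: image_iff)
    then show ?thesis using gen_pair_image[OF a] gen_pair_image[OF b] by simp
  qed
  then have inj: "inj_on f (carrier H)"
    using H(2) by (simp add: eq_card_imp_inj_on)
  have f1: "f \<one>\<^bsub>H\<^esub> = \<one>\<^bsub>H\<^esub>" using f[of "\<one>\<^bsub>F2\<^esub>"] by simp
  have "w \<in> relators H x y" if w: "w \<in> relators H x' y'" for w
  proof -
    have wc: "w \<in> carrier F2" and "eval_word H x' y' w = \<one>\<^bsub>H\<^esub>" using w by (auto simp: relators_def)
    then have "f (eval_word H x y w) = f \<one>\<^bsub>H\<^esub>" using f f1 by simp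
    then have "eval_word H x y w = \<one>\<^bsub>H\<^esub>" using inj wc by (auto simp: inj_on_def)
    then show ?thesis using wc by (simp add: relators_def)
  qed
  then show ?thesis using sub by blast
qed

text \<open>
  The words that vanish in the coordinates \<open>J\<close> form a normal subgroup, so its image in coordinate \<open>k\<close> is
  trivial or everything.  It is not trivial: for one more coordinate \<open>j\<close>, a commutator of a word vanishing
  on \<open>J\<close> with a word vanishing in \<open>j\<close> vanishes on both, and its value can be any commutator of \<open>H\<close>.
\<close>

lemma separate_coordinate:
  assumes H: "simple_group H" "finite (carrier H)" "\<not> comm_group H"
    and g: "\<And>i. i \<in> I \<Longrightarrow> gen_pair H (P i) (Q i)"
    and inj: "inj_on (\<lambda>i. relators H (P i) (Q i)) I"
    and k: "k \<in> I" and J: "finite J" "J \<subseteq> I - {k}"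
  shows "eval_word H (P k) (Q k) ` (carrier F2 \<inter> (\<Inter>j\<in>J. relators H (P j) (Q j))) = carrier H"
  using J
proof (induction J rule: finite_induct)
  case empty
  interpret simple_group H by fact
  show ?case using gen_pair_image[OF g[OF k]] by simp
next
  case (insert j J)
  interpret simple_group H by fact
  interpret F: group F2 by (rule F2_group)
  let ?e = "eval_word H (P k) (Q k)"
  let ?N = "\<lambda>J. carrier F2 \<inter> (\<Inter>j\<in>J. relators H (P j) (Q j))"
  have xy: "P i \<in> carrier H" "Q i \<in> carrier H" if "i \<in> I" for i
    using g[OF that] by (auto simp: gen_pair_def)
  interpret e: group_hom F2 H ?e by (rule eval_word_group_hom[OF xy[OF k]])
  have surj: "?e ` carrier F2 = carrier H" by (rule gen_pair_image[OF g[OF k]])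
  have nontrivial: "?e ` M = carrier H" if M: "M \<lhd> F2" and w: "w \<in> M" "?e w \<noteq> \<one>\<^bsub>H\<^esub>" for M w
  proof -
    have "?e ` M \<lhd> H"
      by (rule normal.surj_hom_normal_subgroup[OF M e.group_hom_axioms surj])
    then have "?e ` M = carrier H \<or> ?e ` M = {\<one>\<^bsub>H\<^esub>}" by (rule no_real_normal_subgroup)
    then show ?thesis using w by auto
  qed
  have normalN: "?N L \<lhd> F2" if L: "L \<subseteq> I" for L
  proof (rule F.normal_invI)
    have sub: "subgroup (relators H (P j) (Q j)) F2" if "j \<in> L" for j
      using relators_normal[of "P j" "Q j"] xy[of j] that L normal_imp_subgroup by blast
    show "subgroup (?N L) F2"
    proof (rule F.subgroupI)
      have "\<one>\<^bsub>F2\<^esub> \<in> ?N L" using subgroup.one_closed[OF sub] by blast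
      then show "?N L \<noteq> {}" by blast
      show "inv\<^bsub>F2\<^esub> u \<in> ?N L" if "u \<in> ?N L" for u
        using subgroup.m_inv_closed[OF sub] that F.inv_closed by blast
      show "u \<otimes>\<^bsub>F2\<^esub> v \<in> ?N L" if "u \<in> ?N L" "v \<in> ?N L" for u v
        using subgroup.m_closed[OF sub] that F.m_closed by blast
    qed blast
    have nrm: "relators H (P j) (Q j) \<lhd> F2" if "j \<in> L" for j
      using relators_normal xy that L by blast
    fix u w assume uw: "u \<in> carrier F2" "w \<in> ?N L"
    have "u \<otimes>\<^bsub>F2\<^esub> w \<otimes>\<^bsub>F2\<^esub> inv\<^bsub>F2\<^esub> u \<in> relators H (P j) (Q j)" if "j \<in> L" for j
      using normal.inv_op_closed2[OF nrm[OF that] uw(1)] uw(2) that by blast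
    then show "u \<otimes>\<^bsub>F2\<^esub> w \<otimes>\<^bsub>F2\<^esub> inv\<^bsub>F2\<^esub> u \<in> ?N L"
      using uw by simp
  qed
  have J: "?e ` ?N J = carrier H" "J \<subseteq> I" "j \<in> I" "j \<noteq> k" using insert by auto
  have Nj: "?e ` ?N {j} = carrier H"
  proof -
    have "\<not> relators H (P j) (Q j) \<subseteq> relators H (P k) (Q k)"
      using relators_subset_eq[OF is_group H(2) g[OF J(3)] g[OF k]] inj J(3,4) k by (auto simp: inj_on_def)
    then obtain w where "w \<in> relators H (P j) (Q j)" "w \<notin> relators H (P k) (Q k)" by blast
    then have w: "w \<in> ?N {j}" "?e w \<noteq> \<one>\<^bsub>H\<^esub>" by (simp_all add: relators_def)
    have "?N {j} \<lhd> F2" by (rule normalN) (use J(3) in simp)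
    then show ?thesis using w by (rule nontrivial)
  qed
  obtain a b where ab: "a \<in> carrier H" "b \<in> carrier H" "a \<otimes>\<^bsub>H\<^esub> b \<noteq> b \<otimes>\<^bsub>H\<^esub> a"
    using nonabelian_not_comm[OF is_group H(3)] .
  have "a \<in> ?e ` ?N J" "b \<in> ?e ` ?N {j}" using J(1) Nj ab(1,2) by simp_all
  then obtain u v where u: "u \<in> ?N J" "?e u = a" and v: "v \<in> ?N {j}" "?e v = b"
    by (elim imageE) (rule that, assumption, simp, assumption, simp)
  let ?c = "u \<otimes>\<^bsub>F2\<^esub> v \<otimes>\<^bsub>F2\<^esub> inv\<^bsub>F2\<^esub> u \<otimes>\<^bsub>F2\<^esub> inv\<^bsub>F2\<^esub> v"
  have uv: "u \<in> carrier F2" "v \<in> carrier F2" using u v by auto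
  have nJ: "?N J \<lhd> F2" by (rule normalN) (rule J(2))
  have nj: "?N {j} \<lhd> F2" by (rule normalN) (use J(3) in simp)
  have "u \<otimes>\<^bsub>F2\<^esub> (v \<otimes>\<^bsub>F2\<^esub> inv\<^bsub>F2\<^esub> u \<otimes>\<^bsub>F2\<^esub> inv\<^bsub>F2\<^esub> v) \<in> ?N J"
    by (intro subgroup.m_closed[OF normal_imp_subgroup[OF nJ]] normal.inv_op_closed2[OF nJ]
        subgroup.m_inv_closed[OF normal_imp_subgroup[OF nJ]] u uv)
  moreover have "(u \<otimes>\<^bsub>F2\<^esub> v \<otimes>\<^bsub>F2\<^esub> inv\<^bsub>F2\<^esub> u) \<otimes>\<^bsub>F2\<^esub> inv\<^bsub>F2\<^esub> v \<in> ?N {j}"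
    by (intro subgroup.m_closed[OF normal_imp_subgroup[OF nj]] normal.inv_op_closed2[OF nj]
        subgroup.m_inv_closed[OF normal_imp_subgroup[OF nj]] v uv)
  ultimately have c: "?c \<in> ?N (insert j J)" using uv by (auto simp: F.m_assoc)
  have c1: "?e ?c \<noteq> \<one>\<^bsub>H\<^esub>"
  proof
    assume "?e ?c = \<one>\<^bsub>H\<^esub>"
    then have "(a \<otimes>\<^bsub>H\<^esub> b) \<otimes>\<^bsub>H\<^esub> inv\<^bsub>H\<^esub> (b \<otimes>\<^bsub>H\<^esub> a) = \<one>\<^bsub>H\<^esub>"
      using uv u(2) v(2) ab by (simp add: m_assoc inv_mult_group)
    then have "inv\<^bsub>H\<^esub> (inv\<^bsub>H\<^esub> (b \<otimes>\<^bsub>H\<^esub> a)) = a \<otimes>\<^bsub>H\<^esub> b"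
      using ab by (intro inv_equality) auto
    then show False using ab by simp
  qed
  have "?N (insert j J) \<lhd> F2" by (rule normalN) (use J in simp)
  then show ?case using c c1 by (rule nontrivial)
qed

text \<open>
  By \<open>separate_coordinate\<close> each coordinate can be prescribed without changing the others.
\<close>

theorem gen_pair_product_group:
  assumes H: "simple_group H" "finite (carrier H)" "\<not> comm_group H"
    and I: "finite I"
    and g: "\<And>i. i \<in> I \<Longrightarrow> gen_pair H (P i) (Q i)"
    and inj: "inj_on (\<lambda>i. relators H (P i) (Q i)) I"
  shows "gen_pair (product_group I (\<lambda>_. H)) (restrict P I) (restrict Q I)"
proof -
  interpret simple_group H by fact
  interpret F: group F2 by (rule F2_group)
  let ?G = "product_group I (\<lambda>_. H)"
  interpret G: group ?G by simp
  have xy: "P i \<in> carrier H" "Q i \<in> carrier H" if "i \<in> I" for i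
    using g[OF that] by (auto simp: gen_pair_def)
  have XY: "restrict P I \<in> carrier ?G" "restrict Q I \<in> carrier ?G" using xy by auto
  interpret e: group_hom F2 ?G "eval_word ?G (restrict P I) (restrict Q I)"
    by (rule G.eval_word_group_hom[OF XY])
  have ev: "eval_word ?G (restrict P I) (restrict Q I) w = (\<lambda>i\<in>I. eval_word H (P i) (Q i) w)" for w
    by (rule eval_word_product_group[OF is_group xy])
  \<comment> \<open>Prescribe the coordinates one after the other.\<close>
  have "\<exists>w\<in>carrier F2. \<forall>i\<in>I. eval_word H (P i) (Q i) w = (if i \<in> J then g i else \<one>\<^bsub>H\<^esub>)"
    if "finite J" "J \<subseteq> I" and gc: "\<And>i. i \<in> I \<Longrightarrow> g i \<in> carrier H" for J g
    using that(1,2)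
  proof (induction J rule: finite_induct)
    case empty
    show ?case by (rule bexI[OF _ F.one_closed]) (simp add: F2_one)
  next
    case (insert j J)
    then obtain w where w: "w \<in> carrier F2"
      "\<forall>i\<in>I. eval_word H (P i) (Q i) w = (if i \<in> J then g i else \<one>\<^bsub>H\<^esub>)" by auto
    have j: "j \<in> I" "g j \<in> carrier H" using insert gc by auto
    have "eval_word H (P j) (Q j) ` (carrier F2 \<inter> (\<Inter>i\<in>I - {j}. relators H (P i) (Q i))) = carrier H"
      by (rule separate_coordinate[OF H \<open>\<And>i. i \<in> I \<Longrightarrow> gen_pair H (P i) (Q i)\<close> inj j(1)]) (use I in auto)
    then have "g j \<in> eval_word H (P j) (Q j) ` (carrier F2 \<inter> (\<Inter>i\<in>I - {j}. relators H (P i) (Q i)))"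
      using j(2) by simp
    then obtain v where v: "v \<in> carrier F2" "v \<in> (\<Inter>i\<in>I - {j}. relators H (P i) (Q i))"
      and vj: "eval_word H (P j) (Q j) v = g j"
      by (elim imageE IntE) simp
    have vi: "eval_word H (P i) (Q i) v = \<one>\<^bsub>H\<^esub>" if "i \<in> I" "i \<noteq> j" for i
      using v(2) that by (auto simp: relators_def)
    have "eval_word H (P i) (Q i) (w \<otimes>\<^bsub>F2\<^esub> v) = (if i \<in> insert j J then g i else \<one>\<^bsub>H\<^esub>)"
      if i: "i \<in> I" for i
    proof -
      have "eval_word H (P i) (Q i) (w \<otimes>\<^bsub>F2\<^esub> v)
          = eval_word H (P i) (Q i) w \<otimes>\<^bsub>H\<^esub> eval_word H (P i) (Q i) v"
        using hom_mult[OF eval_word_hom[OF xy[OF i]] w(1) v(1)] .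
      then show ?thesis
        using w(2) vj vi[OF i] insert(2) i j(2) gc[OF i] by (cases "i = j") auto
    qed
    then show ?case using w(1) v(1) by blast
  qed
  note 1 = this
  have "carrier ?G \<subseteq> eval_word ?G (restrict P I) (restrict Q I) ` carrier F2"
  proof
    fix h assume h: "h \<in> carrier ?G"
    then obtain w where w: "w \<in> carrier F2" "\<forall>i\<in>I. eval_word H (P i) (Q i) w = (if i \<in> I then h i else \<one>\<^bsub>H\<^esub>)"
      using 1[of I h] I by auto
    have "h = eval_word ?G (restrict P I) (restrict Q I) w"
      unfolding ev using h w(2) by (intro PiE_ext[of _ I "\<lambda>_. carrier H"]) (auto simp: xy eval_word_closed)
    then show "h \<in> eval_word ?G (restrict P I) (restrict Q I) ` carrier F2" using w(1) by blast
  qed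
  then have "generate ?G {restrict P I, restrict Q I} = carrier ?G"
    using G.image_eval_word[OF XY] G.generate_incl[of "{restrict P I, restrict Q I}"] XY by auto
  then show ?thesis using XY by (simp add: gen_pair_def)
qed

text \<open>
  If two coordinates had the same kernel, no word could be trivial in one and nontrivial in the other.
\<close>

theorem gen_pair_product_group_inj:
  assumes H: "group H" "carrier H \<noteq> {\<one>\<^bsub>H\<^esub>}"
    and g: "gen_pair (product_group I (\<lambda>_. H)) x y"
  shows "\<And>i. i \<in> I \<Longrightarrow> gen_pair H (x i) (y i)"
    and "inj_on (\<lambda>i. relators H (x i) (y i)) I"
proof -
  interpret group H by fact
  let ?G = "product_group I (\<lambda>_. H)"
  interpret G: group ?G by simp
  have XY: "x \<in> carrier ?G" "y \<in> carrier ?G" using g by (auto simp: gen_pair_def)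
  then have xy: "x i \<in> carrier H" "y i \<in> carrier H" if "i \<in> I" for i using that by auto
  have r: "restrict x I = x" "restrict y I = y" using XY by (auto simp: PiE_def extensional_restrict)
  have ev: "eval_word ?G x y w = (\<lambda>i\<in>I. eval_word H (x i) (y i) w)" for w
    using eval_word_product_group[OF is_group, of I x y w] xy r by simp
  have surj: "\<exists>w\<in>carrier F2. \<forall>i\<in>I. eval_word H (x i) (y i) w = h i" if "\<And>i. i \<in> I \<Longrightarrow> h i \<in> carrier H" for h
  proof -
    have "restrict h I \<in> eval_word ?G x y ` carrier F2" using G.gen_pair_image[OF g] that by auto
    then obtain w where w: "w \<in> carrier F2" "restrict h I = eval_word ?G x y w" by blast
    have "eval_word H (x i) (y i) w = h i" if "i \<in> I" for i
      using fun_cong[OF w(2), of i] that by (simp add: ev)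
    then show ?thesis using w(1) by blast
  qed
  show "gen_pair H (x i) (y i)" if i: "i \<in> I" for i
  proof -
    have "c \<in> eval_word H (x i) (y i) ` carrier F2" if "c \<in> carrier H" for c
      using surj[of "\<lambda>_. c"] that i by auto
    then have "carrier H \<subseteq> generate H {x i, y i}"
      using image_eval_word[OF xy[OF i]] by blast
    moreover have "generate H {x i, y i} \<subseteq> carrier H"
      by (rule generate_incl) (use xy[OF i] in simp)
    ultimately show ?thesis using xy[OF i] by (simp add: gen_pair_def)
  qed
  show "inj_on (\<lambda>i. relators H (x i) (y i)) I"
  proof (rule inj_onI, rule ccontr)
    fix i j assume ij: "i \<in> I" "j \<in> I" "relators H (x i) (y i) = relators H (x j) (y j)" "i \<noteq> j"
    obtain c where c: "c \<in> carrier H" "c \<noteq> \<one>\<^bsub>H\<^esub>" using H(2) by blast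
    have "(if l = i then c else \<one>\<^bsub>H\<^esub>) \<in> carrier H" for l using c(1) by simp
    then obtain w where w: "w \<in> carrier F2" "\<forall>l\<in>I. eval_word H (x l) (y l) w = (if l = i then c else \<one>\<^bsub>H\<^esub>)"
      using surj[of "\<lambda>l. if l = i then c else \<one>\<^bsub>H\<^esub>"] by blast
    have "eval_word H (x i) (y i) w = c" "eval_word H (x j) (y j) w = \<one>\<^bsub>H\<^esub>"
      using w(2) ij(1,2,4) by simp_all
    then have "w \<in> relators H (x j) (y j)" "w \<notin> relators H (x i) (y i)"
      using w(1) c(2) by (simp_all add: relators_def)
    then show False using ij(3) by simp
  qed
qed

theorem two_generator_direct_power_iff:
  assumes H: "simple_group H" "finite (carrier H)" "\<not> comm_group H"
  shows "two_generator_group (direct_power H k) \<longleftrightarrow> k \<le> d2 H"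
proof -
  interpret simple_group H by fact
  let ?R = "{relators H x y | x y. gen_pair H x y}"
  have fin: "finite ?R" by (rule finite_relators[OF H(2)])
  have d2: "d2 H = card ?R" by (rule d2_eq_card_relators)
  have "two_generator_group (direct_power H k) \<longleftrightarrow> (\<exists>x y. gen_pair (product_group {1..k} (\<lambda>_. H)) x y)"
    by (auto simp: two_generator_group_def gen_pair_def direct_power_def)
  also have "\<dots> \<longleftrightarrow> k \<le> d2 H"
  proof
    assume "\<exists>x y. gen_pair (product_group {1..k} (\<lambda>_. H)) x y"
    then obtain x y where g: "gen_pair (product_group {1..k} (\<lambda>_. H)) x y" by blast
    have "(\<lambda>i. relators H (x i) (y i)) ` {1..k} \<subseteq> ?R"
      using gen_pair_product_group_inj(1)[OF is_group simple_not_triv g] by blast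
    then show "k \<le> d2 H"
      using card_inj_on_le[OF gen_pair_product_group_inj(2)[OF is_group simple_not_triv g] _ fin] d2 by simp
  next
    assume "k \<le> d2 H"
    then obtain S where S: "S \<subseteq> ?R" "card S = k" "finite S"
      using obtain_subset_with_card_n[of k ?R] d2 by auto
    then obtain f where f: "bij_betw f {1..k} S"
      using ex_bij_betw_nat_finite_1 by blast
    have "\<forall>i\<in>{1..k}. \<exists>r. gen_pair H (fst r) (snd r) \<and> relators H (fst r) (snd r) = f i"
    proof
      fix i assume "i \<in> {1..k}"
      then have "f i \<in> ?R" using bij_betwE[OF f] S(1) by blast
      then show "\<exists>r. gen_pair H (fst r) (snd r) \<and> relators H (fst r) (snd r) = f i" by force
    qed
    from bchoice[OF this] obtain r where
      r: "\<forall>i\<in>{1..k}. gen_pair H (fst (r i)) (snd (r i)) \<and> relators H (fst (r i)) (snd (r i)) = f i"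
      by (elim exE)
    have "inj_on (\<lambda>i. relators H (fst (r i)) (snd (r i))) {1..k}"
    proof (rule inj_onI)
      fix i j assume ij: "i \<in> {1..k}" "j \<in> {1..k}"
        "relators H (fst (r i)) (snd (r i)) = relators H (fst (r j)) (snd (r j))"
      then have "f i = f j" using r by metis
      then show "i = j" using inj_onD[OF bij_betw_imp_inj_on[OF f]] ij(1,2) by blast
    qed
    then have "gen_pair (product_group {1..k} (\<lambda>_. H))
        (\<lambda>i\<in>{1..k}. fst (r i)) (\<lambda>i\<in>{1..k}. snd (r i))"
      using r by (intro gen_pair_product_group[OF H]) simp_all
    then show "\<exists>x y. gen_pair (product_group {1..k} (\<lambda>_. H)) x y" by (intro exI)
  qed
  finally show ?thesis .
qed

section \<open>Generating triples and their rotations\<close>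

text \<open>A generating pair stands for the triple \<open>(x, y, (x y)\<^sup>-\<^sup>1)\<close> with product one.\<close>

definition rot :: "('a, 'b) monoid_scheme \<Rightarrow> 'a \<times> 'a \<Rightarrow> 'a \<times> 'a" where
  "rot G r = (snd r, inv\<^bsub>G\<^esub> (fst r \<otimes>\<^bsub>G\<^esub> snd r))"

definition gen_row :: "('a, 'b) monoid_scheme \<Rightarrow> 'a \<times> 'a \<Rightarrow> bool" where
  "gen_row G r \<longleftrightarrow> gen_pair G (fst r) (snd r)"

abbreviation row_relators :: "('a, 'b) monoid_scheme \<Rightarrow> 'a \<times> 'a \<Rightarrow> bool letter list set" where
  "row_relators G r \<equiv> relators G (fst r) (snd r)"

definition entry :: "('a, 'b) monoid_scheme \<Rightarrow> nat \<Rightarrow> 'a \<times> 'a \<Rightarrow> 'a" where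
  "entry G u r = fst ((rot G ^^ u) r)"

definition entry_ord :: "('a, 'b) monoid_scheme \<Rightarrow> nat \<Rightarrow> 'a \<times> 'a \<Rightarrow> nat" where
  "entry_ord G u r = group.ord G (entry G u r)"

definition hyperbolic_row :: "('a, 'b) monoid_scheme \<Rightarrow> 'a \<times> 'a \<Rightarrow> bool" where
  "hyperbolic_row G r \<longleftrightarrow>
     1 / real (entry_ord G 0 r) + 1 / real (entry_ord G 1 r) + 1 / real (entry_ord G 2 r) < 1"

definition conj_disjoint :: "('a, 'b) monoid_scheme \<Rightarrow> 'a \<Rightarrow> 'a \<Rightarrow> bool" where
  "conj_disjoint G x y \<longleftrightarrow> (\<forall>(i :: int) (j :: int).
     x [^]\<^bsub>G\<^esub> i \<noteq> \<one>\<^bsub>G\<^esub> \<longrightarrow> \<not> conjugate_in G (x [^]\<^bsub>G\<^esub> i) (y [^]\<^bsub>G\<^esub> j))"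

lemma entry_simps:
  "entry G 0 r = fst r" "entry G 1 r = snd r" "entry G (Suc 0) r = snd r"
  "entry G 2 r = inv\<^bsub>G\<^esub> (fst r \<otimes>\<^bsub>G\<^esub> snd r)"
  by (simp_all add: entry_def rot_def eval_nat_numeral)

lemma entry_rot: "entry G u (rot G r) = entry G (Suc u) r"
  by (simp add: entry_def funpow_swap1)

context group
begin

lemma gen_row_closed:
  assumes "gen_row G r"
  shows "fst r \<in> carrier G" "snd r \<in> carrier G"
  using assms by (auto simp: gen_row_def gen_pair_def)

lemma gen_pair_subgroup:
  assumes "x \<in> carrier G" "y \<in> carrier G"
    and "\<And>K. subgroup K G \<Longrightarrow> x \<in> K \<Longrightarrow> y \<in> K \<Longrightarrow> K = carrier G"
  shows "gen_pair G x y"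
  unfolding gen_pair_def
  using assms(1,2) assms(3)[OF generate_is_subgroup[of "{x, y}"]] generate.incl[of _ "{x, y}" G] by auto

lemma gen_pair_subgroupD:
  assumes "gen_pair G x y" "subgroup K G" "x \<in> K" "y \<in> K"
  shows "K = carrier G"
  using assms generate_subgroup_incl[of "{x, y}" K] subgroup.subset[OF assms(2)]
  by (auto simp: gen_pair_def)

lemma gen_pair_transfer:
  assumes "gen_pair G x y" "x' \<in> carrier G" "y' \<in> carrier G"
    and "\<And>K. subgroup K G \<Longrightarrow> x' \<in> K \<Longrightarrow> y' \<in> K \<Longrightarrow> x \<in> K \<and> y \<in> K"
  shows "gen_pair G x' y'"
  using assms gen_pair_subgroup gen_pair_subgroupD by metis

lemma rot3:
  assumes "fst r \<in> carrier G" "snd r \<in> carrier G"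
  shows "rot G (rot G (rot G r)) = r"
proof -
  have *: "inv (b \<otimes> inv (a \<otimes> b)) = a" if "a \<in> carrier G" "b \<in> carrier G" for a b
    using that by (simp add: inv_mult_group m_assoc[symmetric])
  have "inv (inv (fst r \<otimes> snd r) \<otimes> fst r) = snd r"
    using assms by (simp add: inv_mult_group m_assoc)
  then show ?thesis using assms by (simp add: rot_def *)
qed

lemma gen_row_rot:
  assumes "gen_row G r"
  shows "gen_row G (rot G r)"
proof -
  have c: "fst r \<in> carrier G" "snd r \<in> carrier G" using gen_row_closed[OF assms] .
  have "fst r = inv (snd r \<otimes> inv (fst r \<otimes> snd r))"
    using rot3[OF c] by (simp add: rot_def prod_eq_iff)
  then have "fst r \<in> K \<and> snd r \<in> K"
    if "subgroup K G" "snd r \<in> K" "inv (fst r \<otimes> snd r) \<in> K" for K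
    using that by (metis subgroup.m_closed subgroup.m_inv_closed)
  then show ?thesis
    using assms c unfolding gen_row_def rot_def by (auto intro: gen_pair_transfer)
qed

lemma gen_row_rot_funpow: "gen_row G r \<Longrightarrow> gen_row G ((rot G ^^ u) r)"
  by (induction u) (auto simp: gen_row_rot)

lemma entry_closed: "gen_row G r \<Longrightarrow> entry G u r \<in> carrier G"
  using gen_row_closed(1)[OF gen_row_rot_funpow] by (simp add: entry_def)

lemma entry_add3:
  assumes "gen_row G r"
  shows "entry G (u + 3) r = entry G u r"
  using rot3[OF gen_row_closed[OF gen_row_rot_funpow[OF assms, of u]]]
  by (simp add: entry_def numeral_3_eq_3)

lemma row_relators_eq_entry_ord:
  assumes "gen_row G r" "gen_row G r'" "row_relators G r = row_relators G r'" "u < 3"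
  shows "entry_ord G u r = entry_ord G u r'"
proof -
  note c = gen_row_closed[OF assms(1)] gen_row_closed[OF assms(2)]
  have eq: "ord (eval_word G (fst r) (snd r) w) = ord (eval_word G (fst r') (snd r') w)" if "reduced w" for w
    by (rule relators_eq_ord[OF is_group is_group c assms(3)]) (use that in \<open>simp add: carrier_F2\<close>)
  have "reduced [(True, True)]" "reduced [(False, True)]" "reduced [(False, False), (True, False)]"
    by (simp_all add: reduced_def inv_letter_def)
  note eqs = this[THEN eq]
  consider "u = 0" | "u = 1" | "u = 2" using assms(4) by linarith
  then show ?thesis
  proof cases
    case 1 then show ?thesis using eqs(1) c by (simp add: entry_ord_def entry_simps eval_letter_def)
  next
    case 2 then show ?thesis using eqs(2) c by (simp add: entry_ord_def entry_simps eval_letter_def)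
  next
    case 3 then show ?thesis
      using eqs(3) c by (simp add: entry_ord_def entry_simps eval_letter_def inv_mult_group)
  qed
qed

end

section \<open>Conjugacy of powers in direct powers\<close>

context group
begin

lemma proj_hom: "i \<in> I \<Longrightarrow> (\<lambda>x. x i) \<in> hom (product_group I (\<lambda>_. G)) G"
  by (rule homI) auto

lemma proj_group_hom: "i \<in> I \<Longrightarrow> group_hom (product_group I (\<lambda>_. G)) G (\<lambda>x. x i)"
  by (intro group_hom.intro group_hom_axioms.intro proj_hom is_group product_group)

lemma product_group_int_pow:
  assumes "x \<in> carrier (product_group I (\<lambda>_. G))" "i \<in> I"
  shows "(x [^]\<^bsub>product_group I (\<lambda>_. G)\<^esub> (m :: int)) i = x i [^] m"
  using group_hom.hom_int_pow[OF proj_group_hom[OF assms(2)] assms(1)] .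

lemma product_group_conjugate:
  assumes "x \<in> carrier (product_group I (\<lambda>_. G))"
    and "conjugate_in (product_group I (\<lambda>_. G)) x y" "i \<in> I"
  shows "conjugate_in G (x i) (y i)"
proof -
  let ?P = "product_group I (\<lambda>_. G)"
  obtain g where g: "g \<in> carrier ?P" "g \<otimes>\<^bsub>?P\<^esub> x \<otimes>\<^bsub>?P\<^esub> inv\<^bsub>?P\<^esub> g = y"
    using assms(2) by (auto simp: conjugate_in_def)
  have inv: "(inv\<^bsub>?P\<^esub> g) i = inv (g i)" using g(1) assms(3) by simp
  have "y i = g i \<otimes> x i \<otimes> inv (g i)"
    unfolding g(2)[symmetric] mult_product_group using assms(3) inv by simp
  then show ?thesis using g(1) assms(3) by (auto simp: conjugate_in_def)
qed

lemma conjugate_one_iff: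
  assumes "conjugate_in G x y" "x \<in> carrier G"
  shows "x = \<one> \<longleftrightarrow> y = \<one>"
proof -
  obtain g where g: "g \<in> carrier G" "g \<otimes> x \<otimes> inv g = y" using assms(1) by (auto simp: conjugate_in_def)
  have "y = \<one> \<Longrightarrow> g \<otimes> x = g"
    using g assms(2) by (metis inv_closed inv_inv inv_equality m_closed)
  then show ?thesis using g assms(2) by auto
qed

lemma conjugate_pow:
  assumes "conjugate_in G x y" "x \<in> carrier G"
  shows "conjugate_in G (x [^] (m :: int)) (y [^] m)"
proof -
  obtain g where g: "g \<in> carrier G" "g \<otimes> x \<otimes> inv g = y" using assms(1) by (auto simp: conjugate_in_def)
  have "(\<lambda>x. g \<otimes> x \<otimes> inv g) \<in> hom G G"
  proof (rule homI)
    fix a b assume ab: "a \<in> carrier G" "b \<in> carrier G"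
    have "inv g \<otimes> (g \<otimes> z) = z" if "z \<in> carrier G" for z
      using that g(1) by (simp add: m_assoc[symmetric])
    then show "g \<otimes> (a \<otimes> b) \<otimes> inv g = g \<otimes> a \<otimes> inv g \<otimes> (g \<otimes> b \<otimes> inv g)"
      using ab g(1) by (simp add: m_assoc)
  qed (use g in simp)
  then have "group_hom G G (\<lambda>x. g \<otimes> x \<otimes> inv g)"
    by (intro group_hom.intro group_hom_axioms.intro is_group)
  from group_hom.hom_int_pow[OF this assms(2), of m] show ?thesis
    using g by (auto simp: conjugate_in_def)
qed

lemma conj_disjoint_product:
  assumes "x \<in> carrier (product_group I (\<lambda>_. G))" "y \<in> carrier (product_group I (\<lambda>_. G))"
    and "\<And>i. i \<in> I \<Longrightarrow> conj_disjoint G (x i) (y i)"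
  shows "conj_disjoint (product_group I (\<lambda>_. G)) x y"
  unfolding conj_disjoint_def
proof (intro allI impI notI)
  let ?P = "product_group I (\<lambda>_. G)"
  interpret P: group ?P by simp
  fix m l :: int
  assume ne: "x [^]\<^bsub>?P\<^esub> m \<noteq> \<one>\<^bsub>?P\<^esub>" and conj: "conjugate_in ?P (x [^]\<^bsub>?P\<^esub> m) (y [^]\<^bsub>?P\<^esub> l)"
  have "x i [^] m = \<one>" if i: "i \<in> I" for i
  proof -
    have "conjugate_in G (x i [^] m) (y i [^] l)"
      using product_group_conjugate[OF P.int_pow_closed[OF assms(1)] conj i]
        product_group_int_pow[OF assms(1) i] product_group_int_pow[OF assms(2) i] by simp
    then show ?thesis using assms(3)[OF i] by (auto simp: conj_disjoint_def)
  qed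
  then have "x [^]\<^bsub>?P\<^esub> m = \<one>\<^bsub>?P\<^esub>"
    using product_group_int_pow[OF assms(1)] P.int_pow_closed[OF assms(1), of m]
    by (intro PiE_ext[of _ I "\<lambda>_. carrier G"]) auto
  then show False using ne by simp
qed

end

text \<open>
  For a prime \<open>p\<close> these are the coordinates in which the \<open>p\<close>-part of \<open>f\<close> is nontrivial and as large as possible.
\<close>

definition p_full :: "nat \<Rightarrow> 'i set \<Rightarrow> ('i \<Rightarrow> nat) \<Rightarrow> 'i set" where
  "p_full p I f = {i \<in> I. p dvd f i \<and> (\<forall>j\<in>I. multiplicity p (f j) \<le> multiplicity p (f i))}"

definition p_separated :: "'i set \<Rightarrow> ('i \<Rightarrow> nat) \<Rightarrow> ('i \<Rightarrow> nat) \<Rightarrow> bool" where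
  "p_separated I f g \<longleftrightarrow> (\<forall>p. Factorial_Ring.prime p \<longrightarrow> p_full p I f = p_full p I g \<longrightarrow> p_full p I f = {})"

text \<open>
  The condition on \<open>m\<close> says that \<open>m * p\<close> is a common multiple of the values of \<open>f\<close> and \<open>m\<close> is not, so a
  value fails to divide \<open>m\<close> exactly when its \<open>p\<close>-part is the largest one.
\<close>

lemma p_full_as_nondivisors:
  fixes f :: "'i \<Rightarrow> nat"
  assumes p: "Factorial_Ring.prime p" and m: "m > 0" and f: "\<And>i. i \<in> I \<Longrightarrow> f i > 0" "\<And>i. i \<in> I \<Longrightarrow> f i dvd m * p"
    and ex: "\<exists>i\<in>I. \<not> f i dvd m"
  shows "{i \<in> I. \<not> f i dvd m} = p_full p I f"
proof -
  have le: "multiplicity p (f i) \<le> Suc (multiplicity p m)" if "i \<in> I" for i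
  proof -
    have "multiplicity p (f i) \<le> multiplicity p (m * p)"
      by (rule dvd_imp_multiplicity_le[OF f(2)[OF that]]) (use m p in \<open>auto simp: prime_gt_0_nat\<close>)
    also have "\<dots> = Suc (multiplicity p m)"
      using p m by (simp add: prime_elem_multiplicity_mult_distrib prime_gt_0_nat)
    finally show ?thesis .
  qed
  have iff: "f i dvd m \<longleftrightarrow> multiplicity p (f i) \<le> multiplicity p m" if i: "i \<in> I" for i
  proof
    assume "f i dvd m" then show "multiplicity p (f i) \<le> multiplicity p m"
      using m by (simp add: dvd_imp_multiplicity_le)
  next
    assume *: "multiplicity p (f i) \<le> multiplicity p m"
    show "f i dvd m"
    proof (rule multiplicity_le_imp_dvd)
      fix q :: nat assume q: "Factorial_Ring.prime q"
      show "multiplicity q (f i) \<le> multiplicity q m"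
      proof (cases "q = p")
        case False
        have "multiplicity q (f i) \<le> multiplicity q (m * p)"
          by (rule dvd_imp_multiplicity_le[OF f(2)[OF i]]) (use m p in \<open>auto simp: prime_gt_0_nat\<close>)
        also have "\<dots> = multiplicity q m"
          using p q m False by (simp add: prime_elem_multiplicity_mult_distrib prime_multiplicity_other prime_gt_0_nat)
        finally show ?thesis .
      qed (use * in simp)
    qed (use f(1)[OF i] in simp)
  qed
  obtain i0 where i0: "i0 \<in> I" "\<not> f i0 dvd m" using ex by blast
  have "i \<in> p_full p I f \<longleftrightarrow> \<not> f i dvd m" if i: "i \<in> I" for i
  proof
    assume "i \<in> p_full p I f"
    then have "multiplicity p (f i0) \<le> multiplicity p (f i)" using i0 by (auto simp: p_full_def)
    then show "\<not> f i dvd m" using iff[OF i] iff[OF i0(1)] i0(2) by linarith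
  next
    assume "\<not> f i dvd m"
    then have *: "multiplicity p (f i) = Suc (multiplicity p m)" using iff[OF i] le[OF i] by linarith
    then have "p dvd f i" using not_dvd_imp_multiplicity_0 by fastforce
    then show "i \<in> p_full p I f" using * le i by (auto simp: p_full_def)
  qed
  then show ?thesis by (auto simp: p_full_def)
qed

text \<open>
  If nontrivial powers of \<open>x\<close> and \<open>y\<close> are conjugate, raise both to a further power that leaves elements of
  prime order \<open>p\<close>.  Their nontrivial coordinates are those of full \<open>p\<close>-part for \<open>x\<close> and for \<open>y\<close>; conjugate
  elements have the same nontrivial coordinates, so the two sets coincide.
\<close>

lemma (in group) conj_disjoint_product_separated:
  assumes fin: "finite (carrier G)" "finite I"
    and xy: "x \<in> carrier (product_group I (\<lambda>_. G))" "y \<in> carrier (product_group I (\<lambda>_. G))"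
    and sep: "p_separated I (\<lambda>i. ord (x i)) (\<lambda>i. ord (y i))"
  shows "conj_disjoint (product_group I (\<lambda>_. G)) x y"
  unfolding conj_disjoint_def
proof (intro allI impI notI)
  let ?P = "product_group I (\<lambda>_. G)"
  interpret P: group ?P by simp
  fix m l :: int
  assume ne: "x [^]\<^bsub>?P\<^esub> m \<noteq> \<one>\<^bsub>?P\<^esub>" and conj: "conjugate_in ?P (x [^]\<^bsub>?P\<^esub> m) (y [^]\<^bsub>?P\<^esub> l)"
  have xyi: "x i \<in> carrier G" "y i \<in> carrier G" if "i \<in> I" for i using xy that by auto
  have pos: "ord (x i) > 0" "ord (y i) > 0" if "i \<in> I" for i
    using xyi[OF that] fin(1) ord_ge_1 by (metis less_le_trans zero_less_one)+
  have conj_i: "conjugate_in G (x i [^] m) (y i [^] l)" if i: "i \<in> I" for i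
    using product_group_conjugate[OF P.int_pow_closed[OF xy(1)] conj i]
      product_group_int_pow[OF xy(1) i] product_group_int_pow[OF xy(2) i] by simp
  define c where "c i = ord (x i [^] m)" for i
  define L where "L = (LCM i\<in>I. c i)"
  have cpos: "c i > 0" if "i \<in> I" for i
    unfolding c_def using xyi[OF that] fin(1) ord_ge_1 by (metis int_pow_closed less_le_trans zero_less_one)
  have cdvd: "c i dvd L" if "i \<in> I" for i using that by (simp add: L_def)
  have Lpos: "L > 0"
    using cpos fin(2) by (auto simp: L_def intro!: Nat.gr0I) (metis less_not_refl)
  have "\<exists>i\<in>I. x i [^] m \<noteq> \<one>"
  proof (rule ccontr)
    assume "\<not> ?thesis"
    then have "x [^]\<^bsub>?P\<^esub> m = \<one>\<^bsub>?P\<^esub>"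
      using product_group_int_pow[OF xy(1)] P.int_pow_closed[OF xy(1), of m]
      by (intro PiE_ext[of _ I "\<lambda>_. carrier G"]) auto
    then show False using ne by simp
  qed
  then obtain i0 where i0: "i0 \<in> I" "c i0 \<noteq> 1"
    using ord_eq_1[OF int_pow_closed[OF xyi(1)]] by (auto simp: c_def)
  then have "L \<noteq> 1" using cdvd[OF i0(1)] by auto
  then obtain p where p: "Factorial_Ring.prime p" "p dvd L" using prime_factor_nat by blast
  define s where "s = L div p"
  have s: "L = s * p" using p(2) by (simp add: s_def)
  have "s > 0" using s Lpos by (cases "s = 0") auto
  have "s < L" using s \<open>s > 0\<close> prime_gt_1_nat[OF p(1)] by simp
  have ns: "\<exists>i\<in>I. \<not> c i dvd s"
  proof (rule ccontr)
    assume "\<not> ?thesis"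
    then have "L dvd s" unfolding L_def by (auto intro: Lcm_least)
    then show False using \<open>s > 0\<close> \<open>s < L\<close> by (auto dest: dvd_imp_le)
  qed
  define m' l' where "m' = nat \<bar>m * int s\<bar>" and "l' = nat \<bar>l * int s\<bar>"
  have dx: "ord (x i) dvd m' * q \<longleftrightarrow> c i dvd s * q" if "i \<in> I" for i q
  proof -
    have "int (m' * q) = \<bar>m * int (s * q)\<bar>" by (simp add: m'_def abs_mult)
    then have "ord (x i) dvd m' * q \<longleftrightarrow> int (ord (x i)) dvd m * int (s * q)"
      by (metis dvd_abs_iff int_dvd_int_iff)
    also have "\<dots> \<longleftrightarrow> x i [^] (m * int (s * q)) = \<one>"
      by (simp only: int_pow_eq_id[OF xyi(1)[OF that]])
    also have "\<dots> \<longleftrightarrow> (x i [^] m) [^] (s * q) = \<one>"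
      by (simp only: int_pow_pow[OF xyi(1)[OF that], symmetric] int_pow_int)
    also have "\<dots> \<longleftrightarrow> c i dvd s * q"
      unfolding c_def using xyi[OF that] by (simp add: pow_eq_id)
    finally show ?thesis .
  qed
  have dy: "ord (y i) dvd l' * q \<longleftrightarrow> c i dvd s * q" if i: "i \<in> I" for i q
  proof -
    have "int (l' * q) = \<bar>l * int (s * q)\<bar>" by (simp add: l'_def abs_mult)
    then have "ord (y i) dvd l' * q \<longleftrightarrow> int (ord (y i)) dvd l * int (s * q)"
      by (metis dvd_abs_iff int_dvd_int_iff)
    also have "\<dots> \<longleftrightarrow> y i [^] (l * int (s * q)) = \<one>"
      by (simp only: int_pow_eq_id[OF xyi(2)[OF i]])
    also have "\<dots> \<longleftrightarrow> (y i [^] l) [^] int (s * q) = \<one>"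
      by (simp only: int_pow_pow[OF xyi(2)[OF i], symmetric])
    also have "\<dots> \<longleftrightarrow> (x i [^] m) [^] int (s * q) = \<one>"
      using conjugate_one_iff[OF conjugate_pow[OF conj_i[OF i]]] int_pow_closed[OF int_pow_closed] xyi[OF i]
      by blast
    also have "\<dots> \<longleftrightarrow> c i dvd s * q"
      unfolding c_def int_pow_int by (rule pow_eq_id) (simp add: xyi[OF i])
    finally show ?thesis .
  qed
  have nx: "\<exists>i\<in>I. \<not> ord (x i) dvd m'" and ny: "\<exists>i\<in>I. \<not> ord (y i) dvd l'"
    using ns dx[of _ 1] dy[of _ 1] by auto
  then have "m' > 0" "l' > 0" by (auto intro!: Nat.gr0I)
  have "p_full p I (\<lambda>i. ord (x i)) = {i \<in> I. \<not> ord (x i) dvd m'}"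
    using p_full_as_nondivisors[OF p(1) \<open>m' > 0\<close>, of I "\<lambda>i. ord (x i)"] pos nx dx cdvd s by simp
  moreover have "p_full p I (\<lambda>i. ord (y i)) = {i \<in> I. \<not> ord (y i) dvd l'}"
    using p_full_as_nondivisors[OF p(1) \<open>l' > 0\<close>, of I "\<lambda>i. ord (y i)"] pos ny dy cdvd s by simp
  moreover have "{i \<in> I. \<not> ord (x i) dvd m'} = {i \<in> I. \<not> ord (y i) dvd l'}"
    using dx[of _ 1] dy[of _ 1] by auto
  moreover have "{i \<in> I. \<not> ord (x i) dvd m'} \<noteq> {}" using nx by blast
  ultimately show False using sep p(1) by (auto simp: p_separated_def)
qed

section \<open>Beauville structures from lists of generating triples\<close>

definition column :: "('a, 'b) monoid_scheme \<Rightarrow> nat \<Rightarrow> ('a \<times> 'a) list \<Rightarrow> nat \<Rightarrow> 'a" where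
  "column H u L = (\<lambda>i\<in>{1..length L}. entry H u (L ! (i - 1)))"

definition row_list :: "('a, 'b) monoid_scheme \<Rightarrow> ('a \<times> 'a) list \<Rightarrow> bool" where
  "row_list H L \<longleftrightarrow> (\<forall>r\<in>set L. gen_row H r) \<and> distinct (map (row_relators H) L)
     \<and> (\<exists>r\<in>set L. hyperbolic_row H r)"

lemma (in group) column_closed:
  assumes "\<forall>r\<in>set L. gen_row G r"
  shows "column G u L \<in> carrier (product_group {1..length L} (\<lambda>_. G))"
  unfolding column_def using assms by (auto intro!: entry_closed)

lemma row_list_hyperbolic_generating_triple:
  assumes H: "simple_group H" "finite (carrier H)" "\<not> comm_group H" and L: "row_list H L"
  shows "hyperbolic_generating_triple (direct_power H (length L)) (column H 0 L) (column H 1 L) (column H 2 L)"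
proof -
  interpret simple_group H by fact
  let ?I = "{1..length L}"
  let ?P = "product_group ?I (\<lambda>_. H)"
  interpret P: group ?P by simp
  have g: "\<forall>r\<in>set L. gen_row H r" using L by (simp add: row_list_def)
  then have gi: "gen_row H (L ! (i - 1))" if "i \<in> ?I" for i using that by auto
  note col = column_closed[OF g]
  have "gen_pair ?P (\<lambda>i\<in>?I. entry H 0 (L ! (i - 1))) (\<lambda>i\<in>?I. entry H 1 (L ! (i - 1)))"
  proof (rule gen_pair_product_group[OF H])
    show "inj_on (\<lambda>i. relators H (entry H 0 (L ! (i - 1))) (entry H 1 (L ! (i - 1)))) ?I"
    proof (rule inj_onI)
      fix i j assume ij: "i \<in> ?I" "j \<in> ?I"
        "relators H (entry H 0 (L ! (i - 1))) (entry H 1 (L ! (i - 1)))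
         = relators H (entry H 0 (L ! (j - 1))) (entry H 1 (L ! (j - 1)))"
      have len: "i - 1 < length L" "j - 1 < length L" using ij(1,2) by auto
      then have "map (row_relators H) L ! (i - 1) = map (row_relators H) L ! (j - 1)"
        using ij(3) by (simp add: entry_simps)
      then have "i - 1 = j - 1"
        using L len nth_eq_iff_index_eq[of "map (row_relators H) L" "i - 1" "j - 1"]
        by (simp add: row_list_def)
      then show "i = j" using ij(1,2) by auto
    qed
  qed (use gi in \<open>auto simp: gen_row_def entry_simps\<close>)
  then have gp: "gen_pair ?P (column H 0 L) (column H 1 L)" by (simp add: column_def)
  have c: "column H 2 L = inv\<^bsub>?P\<^esub> (column H 0 L \<otimes>\<^bsub>?P\<^esub> column H 1 L)"
  proof -
    have "column H 0 L \<otimes>\<^bsub>?P\<^esub> column H 1 L \<in> carrier ?P" using col by (intro P.m_closed)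
    then have "inv\<^bsub>?P\<^esub> (column H 0 L \<otimes>\<^bsub>?P\<^esub> column H 1 L)
        = (\<lambda>i\<in>?I. inv\<^bsub>H\<^esub> ((column H 0 L \<otimes>\<^bsub>?P\<^esub> column H 1 L) i))"
      by (intro inv_product_group) auto
    also have "\<dots> = column H 2 L" by (auto simp: column_def fun_eq_iff entry_simps)
    finally show ?thesis by simp
  qed
  have gen: "generate ?P {column H 0 L, column H 1 L, column H 2 L} = carrier ?P"
  proof
    show "generate ?P {column H 0 L, column H 1 L, column H 2 L} \<subseteq> carrier ?P"
      by (rule P.generate_incl) (use col in blast)
    have "generate ?P {column H 0 L, column H 1 L} \<subseteq> generate ?P {column H 0 L, column H 1 L, column H 2 L}"
      by (rule P.mono_generate) auto
    then show "carrier ?P \<subseteq> generate ?P {column H 0 L, column H 1 L, column H 2 L}"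
      using gp by (simp add: gen_pair_def)
  qed
  have prod1: "column H 0 L \<otimes>\<^bsub>?P\<^esub> column H 1 L \<otimes>\<^bsub>?P\<^esub> column H 2 L = \<one>\<^bsub>?P\<^esub>"
    unfolding c using col by (intro P.r_inv P.m_closed)
  obtain r where r: "r \<in> set L" "hyperbolic_row H r" using L by (auto simp: row_list_def)
  then obtain i where i: "i < length L" "r = L ! i" by (auto simp: in_set_conv_nth)
  have fin: "finite (carrier ?P)" using H(2) by (auto intro: finite_PiE)
  have le: "1 / real (P.ord (column H u L)) \<le> 1 / real (entry_ord H u r)" for u
  proof -
    have iI: "Suc i \<in> ?I" using i by auto
    have "column H u L (Suc i) = entry H u r" using iI i by (simp add: column_def)
    moreover have "(column H u L [^]\<^bsub>?P\<^esub> int (P.ord (column H u L))) (Suc i) = \<one>\<^bsub>H\<^esub>"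
      using P.int_pow_eq_id[OF col, of u "int (P.ord (column H u L))"] iI by simp
    ultimately have "entry H u r [^]\<^bsub>H\<^esub> int (P.ord (column H u L)) = \<one>\<^bsub>H\<^esub>"
      using product_group_int_pow[OF col iI] by simp
    then have "entry_ord H u r dvd P.ord (column H u L)"
      using int_pow_eq_id[OF entry_closed] g r(1) by (simp add: entry_ord_def)
    moreover have "P.ord (column H u L) > 0" "entry_ord H u r > 0"
      using P.ord_ge_1[OF fin col, of u] ord_ge_1[OF H(2) entry_closed, of r u] g r(1)
      by (auto simp: entry_ord_def)
    ultimately have "entry_ord H u r \<le> P.ord (column H u L)" "entry_ord H u r > 0"
      by (auto dest: dvd_imp_le)
    then show ?thesis by (intro divide_left_mono) auto
  qed
  have "1 / real (P.ord (column H 0 L)) + 1 / real (P.ord (column H 1 L)) + 1 / real (P.ord (column H 2 L)) < 1"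
    using le[of 0] le[of 1] le[of 2] r(2) unfolding hyperbolic_row_def by linarith
  then show ?thesis
    unfolding hyperbolic_generating_triple_def direct_power_def using col gen prod1 by simp
qed

theorem beauville_direct_powerI:
  assumes H: "simple_group H" "finite (carrier H)" "\<not> comm_group H"
    and L: "row_list H L" "row_list H L'" "length L = k" "length L' = k"
    and disj: "\<And>u v. u < 3 \<Longrightarrow> v < 3 \<Longrightarrow> conj_disjoint (direct_power H k) (column H u L) (column H v L')"
  shows "beauville_group (direct_power H k)"
  unfolding beauville_group_def
proof (intro conjI exI)
  interpret simple_group H by fact
  show "group (direct_power H k)" "finite (carrier (direct_power H k))"
    using H(2) by (auto simp: direct_power_def intro: finite_PiE)
  show "hyperbolic_generating_triple (direct_power H k) (column H 0 L) (column H 1 L) (column H 2 L)"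
    using row_list_hyperbolic_generating_triple[OF H L(1)] L(3) by simp
  show "hyperbolic_generating_triple (direct_power H k) (column H 0 L') (column H 1 L') (column H 2 L')"
    using row_list_hyperbolic_generating_triple[OF H L(2)] L(4) by simp
  have "\<forall>x\<in>{column H 0 L, column H 1 L, column H 2 L}. \<forall>y\<in>{column H 0 L', column H 1 L', column H 2 L'}.
      conj_disjoint (direct_power H k) x y"
    using disj by simp
  then show "\<forall>x\<in>{column H 0 L, column H 1 L, column H 2 L}. \<forall>y\<in>{column H 0 L', column H 1 L', column H 2 L'}.
      \<forall>(i :: int) (j :: int). x [^]\<^bsub>direct_power H k\<^esub> i \<noteq> \<one>\<^bsub>direct_power H k\<^esub> \<longrightarrow>
        \<not> conjugate_in (direct_power H k) (x [^]\<^bsub>direct_power H k\<^esub> i) (y [^]\<^bsub>direct_power H k\<^esub> j)"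
    unfolding conj_disjoint_def .
qed

corollary beauville_coordinatewise:
  assumes H: "simple_group H" "finite (carrier H)" "\<not> comm_group H"
    and L: "row_list H L" "row_list H L'" "length L = k" "length L' = k"
    and disj: "\<And>i u v. i < k \<Longrightarrow> u < 3 \<Longrightarrow> v < 3 \<Longrightarrow> conj_disjoint H (entry H u (L ! i)) (entry H v (L' ! i))"
  shows "beauville_group (direct_power H k)"
proof (rule beauville_direct_powerI[OF H L])
  interpret simple_group H by fact
  fix u v :: nat assume uv: "u < 3" "v < 3"
  have g: "\<forall>r\<in>set L. gen_row H r" "\<forall>r\<in>set L'. gen_row H r" using L by (auto simp: row_list_def)
  show "conj_disjoint (direct_power H k) (column H u L) (column H v L')"
    unfolding direct_power_def
  proof (rule conj_disjoint_product)
    show "column H u L \<in> carrier (product_group {1..k} (\<lambda>_. H))" using column_closed[OF g(1)] L(3) by simp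
    show "column H v L' \<in> carrier (product_group {1..k} (\<lambda>_. H))" using column_closed[OF g(2)] L(4) by simp
    fix i assume "i \<in> {1..k}"
    then show "conj_disjoint H (column H u L i) (column H v L' i)"
      using disj[of "i - 1" u v] uv L(3,4) by (auto simp: column_def)
  qed
qed

lemma p_separated_shift:
  fixes f g :: "nat \<Rightarrow> nat"
  assumes "p_separated {..<k} f g"
  shows "p_separated {1..k} (\<lambda>i. f (i - 1)) (\<lambda>i. g (i - 1))"
proof -
  have im: "{1..k} = Suc ` {..<k}" by (simp add: lessThan_atLeast0 image_Suc_atLeastLessThan atLeastLessThanSuc_atLeastAtMost)
  have "p_full p {1..k} (\<lambda>i. f (i - 1)) = Suc ` p_full p {..<k} f" for p and f :: "nat \<Rightarrow> nat"
    unfolding p_full_def im by auto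
  then show ?thesis using assms by (simp add: p_separated_def inj_image_eq_iff)
qed

corollary beauville_separated:
  assumes H: "simple_group H" "finite (carrier H)" "\<not> comm_group H"
    and L: "row_list H L" "row_list H L'" "length L = k" "length L' = k"
    and sep: "\<And>u v. u < 3 \<Longrightarrow> v < 3 \<Longrightarrow>
      p_separated {..<k} (\<lambda>i. entry_ord H u (L ! i)) (\<lambda>i. entry_ord H v (L' ! i))"
  shows "beauville_group (direct_power H k)"
proof (rule beauville_direct_powerI[OF H L])
  interpret simple_group H by fact
  fix u v :: nat assume uv: "u < 3" "v < 3"
  have g: "\<forall>r\<in>set L. gen_row H r" "\<forall>r\<in>set L'. gen_row H r" using L by (auto simp: row_list_def)
  have cong: "p_separated {1..k} f g \<longleftrightarrow> p_separated {1..k} f' g'"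
    if "\<And>i. i \<in> {1..k} \<Longrightarrow> f i = f' i" "\<And>i. i \<in> {1..k} \<Longrightarrow> g i = g' i" for f g f' g' :: "nat \<Rightarrow> nat"
    using that by (simp add: p_separated_def p_full_def cong: conj_cong)
  show "conj_disjoint (direct_power H k) (column H u L) (column H v L')"
    unfolding direct_power_def
  proof (rule conj_disjoint_product_separated[OF H(2)])
    show "column H u L \<in> carrier (product_group {1..k} (\<lambda>_. H))" using column_closed[OF g(1)] L(3) by simp
    show "column H v L' \<in> carrier (product_group {1..k} (\<lambda>_. H))" using column_closed[OF g(2)] L(4) by simp
    show "p_separated {1..k} (\<lambda>i. ord (column H u L i)) (\<lambda>i. ord (column H v L' i))"
      using p_separated_shift[OF sep[OF uv]] L(3,4)
      by (subst cong) (auto simp: column_def entry_ord_def)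
  qed simp
qed

section \<open>Small powers\<close>

definition rots :: "('a, 'b) monoid_scheme \<Rightarrow> 'a \<times> 'a \<Rightarrow> ('a \<times> 'a) list" where
  "rots H r = [r, rot H r, rot H (rot H r)]"

definition ord_set :: "('a, 'b) monoid_scheme \<Rightarrow> 'a \<times> 'a \<Rightarrow> nat set" where
  "ord_set H r = {entry_ord H 0 r, entry_ord H 1 r, entry_ord H 2 r}"

context group
begin

lemma conj_disjoint_sym:
  assumes "conj_disjoint G x y" "x \<in> carrier G" "y \<in> carrier G"
  shows "conj_disjoint G y x"
  unfolding conj_disjoint_def
proof (intro allI impI notI)
  fix i j :: int
  assume ne: "y [^] i \<noteq> \<one>" and conj: "conjugate_in G (y [^] i) (x [^] j)"
  have c: "y [^] i \<in> carrier G" "x [^] j \<in> carrier G" using assms(2,3) by simp_all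
  obtain g where g: "g \<in> carrier G" "g \<otimes> y [^] i \<otimes> inv g = x [^] j" using conj by (auto simp: conjugate_in_def)
  have "inv g \<otimes> (x [^] j) \<otimes> inv (inv g) = y [^] i"
  proof -
    have "inv g \<otimes> (g \<otimes> z) = z" if "z \<in> carrier G" for z
      using that g(1) by (simp add: m_assoc[symmetric])
    then show ?thesis using g(1) c by (simp add: m_assoc flip: g(2))
  qed
  then have "conjugate_in G (x [^] j) (y [^] i)"
    unfolding conjugate_in_def by (intro bexI[of _ "inv g"]) (use g(1) in simp_all)
  moreover have "x [^] j \<noteq> \<one>" using conjugate_one_iff[OF conj c(1)] ne by simp
  ultimately show False using assms(1) by (auto simp: conj_disjoint_def)
qed

lemma entry_ord_rot: "entry_ord G u (rot G r) = entry_ord G (Suc u) r"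
  by (simp add: entry_ord_def entry_rot)

lemma entry_ord_add3: "gen_row G r \<Longrightarrow> entry_ord G (u + 3) r = entry_ord G u r"
  using entry_add3[of r u] by (simp add: entry_ord_def)

lemma entry_ord_34:
  assumes "gen_row G r"
  shows "entry_ord G 3 r = entry_ord G 0 r" "entry_ord G 4 r = entry_ord G 1 r"
  using entry_ord_add3[OF assms, of 0] entry_ord_add3[OF assms, of 1] by simp_all

lemma ord_set_rot: "gen_row G r \<Longrightarrow> ord_set G (rot G r) = ord_set G r"
  using entry_ord_34[of r] by (auto simp: ord_set_def entry_ord_rot numeral_3_eq_3 numeral_2_eq_2)

lemma hyperbolic_row_rot: "gen_row G r \<Longrightarrow> hyperbolic_row G (rot G r) = hyperbolic_row G r"
  using entry_ord_34[of r]
  by (simp add: hyperbolic_row_def entry_ord_rot numeral_3_eq_3 numeral_2_eq_2 add_ac)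

lemma row_relators_eq_ord_set:
  "gen_row G r \<Longrightarrow> gen_row G r' \<Longrightarrow> row_relators G r = row_relators G r' \<Longrightarrow> ord_set G r = ord_set G r'"
  using row_relators_eq_entry_ord[of r r'] by (simp add: ord_set_def)

lemma distinct_rots:
  assumes "gen_row G r" and ne: "\<not> (entry_ord G 0 r = entry_ord G 1 r \<and> entry_ord G 1 r = entry_ord G 2 r)"
  shows "distinct (map (row_relators G) (rots G r))"
proof -
  note e = entry_ord_34[OF assms(1)]
  have g: "gen_row G (rot G r)" "gen_row G (rot G (rot G r))" using assms(1) gen_row_rot by auto
  have "row_relators G r \<noteq> row_relators G (rot G r)"
    using row_relators_eq_entry_ord[OF assms(1) g(1), of 0] row_relators_eq_entry_ord[OF assms(1) g(1), of 1] ne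
    by (auto simp: entry_ord_rot numeral_2_eq_2)
  moreover have "row_relators G r \<noteq> row_relators G (rot G (rot G r))"
    using row_relators_eq_entry_ord[OF assms(1) g(2), of 0] row_relators_eq_entry_ord[OF assms(1) g(2), of 1] ne e
    by (auto simp: entry_ord_rot numeral_2_eq_2 numeral_3_eq_3)
  moreover have "row_relators G (rot G r) \<noteq> row_relators G (rot G (rot G r))"
    using row_relators_eq_entry_ord[OF g, of 0] row_relators_eq_entry_ord[OF g, of 1] ne e
    by (auto simp: entry_ord_rot numeral_2_eq_2 numeral_3_eq_3)
  ultimately show ?thesis by (simp add: rots_def)
qed

lemma set_rots:
  assumes "gen_row G r" "s \<in> set (rots G r)"
  shows "gen_row G s" "ord_set G s = ord_set G r" "hyperbolic_row G s = hyperbolic_row G r"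
  using assms gen_row_rot[of r] gen_row_rot[of "rot G r"] ord_set_rot[of r] ord_set_rot[of "rot G r"]
    hyperbolic_row_rot[of r] hyperbolic_row_rot[of "rot G r"]
  by (auto simp: rots_def)

lemma entry_rots:
  assumes "gen_row G r" "s \<in> set (rots G r)" "u < 3"
  shows "\<exists>v<3. entry G u s = entry G v r"
proof -
  obtain w where w: "w < 3" "entry G u s = entry G (u + w) r"
    using assms(2) by (auto simp: rots_def entry_rot intro: that[of 0] that[of 1] that[of 2])
  have "entry G (u + w) r = entry G ((u + w) mod 3) r"
  proof (cases "u + w < 3")
    case False
    then have "u + w = (u + w - 3) + 3" "(u + w) mod 3 = u + w - 3"
      using assms(3) w(1) by (auto simp: mod_if)
    then show ?thesis using entry_add3[OF assms(1), of "u + w - 3"] by simp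
  qed simp
  then show ?thesis using w(2) by (intro exI[of _ "(u + w) mod 3"]) simp
qed

end

text \<open>
  The lists are the rotations of \<open>r\<close> followed by those of \<open>r'\<close>, and the same six rows with the halves
  exchanged, cut off after \<open>k\<close> rows.  In each coordinate a rotation of \<open>r\<close> faces a rotation of \<open>r'\<close>.  The
  rotations have distinct kernels because the order triple is not constant.
\<close>

theorem beauville_small_power:
  assumes H: "simple_group H" "finite (carrier H)" "\<not> comm_group H"
    and g: "gen_row H r" "gen_row H r'" and hyp: "hyperbolic_row H r" "hyperbolic_row H r'"
    and ne: "\<not> (entry_ord H 0 r = entry_ord H 1 r \<and> entry_ord H 1 r = entry_ord H 2 r)"
      "\<not> (entry_ord H 0 r' = entry_ord H 1 r' \<and> entry_ord H 1 r' = entry_ord H 2 r')"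
    and os: "ord_set H r \<noteq> ord_set H r'"
    and disj: "\<And>u v. u < 3 \<Longrightarrow> v < 3 \<Longrightarrow> conj_disjoint H (entry H u r) (entry H v r')"
    and k: "1 \<le> k" "k \<le> 6"
  shows "beauville_group (direct_power H k)"
proof -
  interpret simple_group H by fact
  let ?L = "rots H r @ rots H r'" and ?L' = "rots H r' @ rots H r"
  have dis: "distinct (map (row_relators H) ?L)" "distinct (map (row_relators H) ?L')"
  proof -
    have neq: "row_relators H s \<noteq> row_relators H s'" if "s \<in> set (rots H r)" "s' \<in> set (rots H r')" for s s'
      using row_relators_eq_ord_set[of s s'] set_rots[OF g(1) that(1)] set_rots[OF g(2) that(2)] os by auto
    have disj: "row_relators H ` set (rots H r) \<inter> row_relators H ` set (rots H r') = {}"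
    proof (rule equals0I)
      fix N assume "N \<in> row_relators H ` set (rots H r) \<inter> row_relators H ` set (rots H r')"
      then obtain s s' where "s \<in> set (rots H r)" "s' \<in> set (rots H r')" "row_relators H s = row_relators H s'"
        by (elim IntE imageE) simp
      then show False using neq by simp
    qed
    show "distinct (map (row_relators H) ?L)" "distinct (map (row_relators H) ?L')"
      unfolding map_append distinct_append set_map
      using distinct_rots[OF g(1) ne(1)] distinct_rots[OF g(2) ne(2)] disj
      by (simp_all add: Int_commute)
  qed
  have rl: "row_list H (take k L)"
    if "set L \<subseteq> set (rots H r) \<union> set (rots H r')" "distinct (map (row_relators H) L)" "L \<noteq> []" for L
  proof -
    have "gen_row H s \<and> hyperbolic_row H s" if "s \<in> set (take k L)" for s
    proof -
      have "s \<in> set (rots H r) \<union> set (rots H r')"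
        using subsetD[OF \<open>set L \<subseteq> _\<close> in_set_takeD[OF that]] .
      then show ?thesis using set_rots[OF g(1), of s] set_rots[OF g(2), of s] hyp by auto
    qed
    moreover have "hd L \<in> set (take k L)" using k(1) \<open>L \<noteq> []\<close> by (cases L; cases k) auto
    moreover have "distinct (map (row_relators H) (take k L))"
      using that(2) by (simp only: take_map[symmetric] distinct_take)
    ultimately show ?thesis unfolding row_list_def by blast
  qed
  show ?thesis
  proof (rule beauville_coordinatewise[OF H])
    show "row_list H (take k ?L)" "row_list H (take k ?L')"
      using dis by (intro rl; auto simp: rots_def)+
    show "length (take k ?L) = k" "length (take k ?L') = k" using k by (auto simp: rots_def)
    fix i u v :: nat assume i: "i < k" and uv: "u < 3" "v < 3"
    have both: "conj_disjoint H (entry H u s) (entry H v s') \<and> conj_disjoint H (entry H v s') (entry H u s)"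
      if ss: "s \<in> set (rots H r)" "s' \<in> set (rots H r')" "u < 3" "v < 3" for s s' u v
    proof -
      obtain u' v' where "u' < 3" "entry H u s = entry H u' r" "v' < 3" "entry H v s' = entry H v' r'"
        using entry_rots[OF g(1) ss(1,3)] entry_rots[OF g(2) ss(2,4)] by blast
      then show ?thesis using disj[of u' v'] conj_disjoint_sym entry_closed[OF g(1)] entry_closed[OF g(2)] by simp
    qed
    have len: "length (rots H r) = 3" "length (rots H r') = 3" by (simp_all add: rots_def)
    show "conj_disjoint H (entry H u (take k ?L ! i)) (entry H v (take k ?L' ! i))"
    proof (cases "i < 3")
      case True
      then have "?L ! i \<in> set (rots H r)" "?L' ! i \<in> set (rots H r')"
        using len by (auto simp: nth_append)
      then show ?thesis unfolding nth_take[OF i] using both uv by blast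
    next
      case False
      then have "?L ! i \<in> set (rots H r')" "?L' ! i \<in> set (rots H r)"
        using len i k(2) by (auto simp: nth_append)
      then show ?thesis unfolding nth_take[OF i] using both uv by blast
    qed
  qed
qed

section \<open>Rotation acts on kernels\<close>

text \<open>
  The kernel of a rotated pair depends only on the kernel of the pair: rotation is precomposition with the
  automorphism of the free group that sends the generators \<open>a\<close>, \<open>b\<close> to \<open>b\<close>, \<open>(a b)\<^sup>-\<^sup>1\<close>.
\<close>

definition rot_relators :: "bool letter list set \<Rightarrow> bool letter list set" where
  "rot_relators N = {w \<in> carrier F2. eval_word F2 [(False, True)]
     (inv\<^bsub>F2\<^esub> ([(True, True)] \<otimes>\<^bsub>F2\<^esub> [(False, True)])) w \<in> N}"

lemma (in group) row_relators_rot: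
  assumes "fst r \<in> carrier G" "snd r \<in> carrier G"
  shows "row_relators G (rot G r) = rot_relators (row_relators G r)"
proof -
  interpret F: group F2 by (rule F2_group)
  let ?a = "[(True, True)] :: bool letter list" and ?b = "[(False, True)] :: bool letter list"
  let ?c = "inv\<^bsub>F2\<^esub> (?a \<otimes>\<^bsub>F2\<^esub> ?b)"
  have ab: "?a \<in> carrier F2" "?b \<in> carrier F2" by (simp_all add: carrier_F2 reduced_single)
  then have c: "?c \<in> carrier F2" by simp
  let ?e = "eval_word G (fst r) (snd r)" and ?s = "eval_word F2 ?b ?c"
  interpret e: group_hom F2 G ?e by (rule eval_word_group_hom[OF assms])
  have s: "?s \<in> hom F2 F2" by (rule F.eval_word_hom[OF ab(2) c])
  have h: "?e \<circ> ?s \<in> hom F2 G"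
    by (rule homI) (simp_all add: hom_mult[OF s] hom_in_carrier[OF s])
  have "(?e \<circ> ?s) ?a = snd r"
    using F.eval_word_gens[OF ab(2) c] eval_word_gens[OF assms] by simp
  moreover have "(?e \<circ> ?s) ?b = inv (fst r \<otimes> snd r)"
    using F.eval_word_gens[OF ab(2) c] eval_word_gens[OF assms] ab by simp
  ultimately have ev: "?e (?s w) = eval_word G (snd r) (inv (fst r \<otimes> snd r)) w" if "w \<in> carrier F2" for w
    using hom_from_F2_is_eval[OF h, of w] that by (simp add: carrier_F2)
  have sc: "?s w \<in> carrier F2" if "w \<in> carrier F2" for w using hom_in_carrier[OF s that] .
  show ?thesis
    unfolding relators_def rot_relators_def rot_def fst_conv snd_conv mem_Collect_eq
  proof (rule Collect_cong, rule conj_cong[OF refl])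
    fix w assume w: "w \<in> carrier F2"
    show "eval_word G (snd r) (inv (fst r \<otimes> snd r)) w = \<one> \<longleftrightarrow> ?s w \<in> carrier F2 \<and> ?e (?s w) = \<one>"
      unfolding ev[OF w] using sc[OF w] by blast
  qed
qed

section \<open>A shifted arrangement of rotation orbits\<close>

definition orb3 :: "('n \<Rightarrow> 'n) \<Rightarrow> 'n \<Rightarrow> 'n list" where
  "orb3 \<rho> x = [x, \<rho> x, \<rho> (\<rho> x)]"

lemma nth_orb3: "i < 3 \<Longrightarrow> orb3 \<rho> x ! i = (\<rho> ^^ i) x"
  by (auto simp: orb3_def numeral_3_eq_3 less_Suc_eq)

lemma length_concat_orb3: "length (concat (map (orb3 \<rho>) ts)) = 3 * length ts"
  by (induction ts) (auto simp: orb3_def)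

lemma nth_concat_orb3:
  "j < length ts \<Longrightarrow> i < 3 \<Longrightarrow> concat (map (orb3 \<rho>) ts) ! (3 * j + i) = (\<rho> ^^ i) (ts ! j)"
proof (induction ts arbitrary: j)
  case (Cons t ts)
  show ?case
  proof (cases j)
    case 0
    then show ?thesis using Cons.prems by (simp add: nth_append nth_orb3) (simp add: orb3_def)
  next
    case (Suc j')
    have len: "length (orb3 \<rho> t) = 3" by (simp add: orb3_def)
    show ?thesis using Cons.IH[of j'] Cons.prems Suc by (simp add: nth_append len)
  qed
qed simp

text \<open>
  A permutation of order three without fixed points splits its domain into orbits of size three.
\<close>

lemma list_of_orbits:
  assumes "finite S" "\<And>x. x \<in> S \<Longrightarrow> \<rho> x \<in> S" "\<And>x. x \<in> S \<Longrightarrow> \<rho> (\<rho> (\<rho> x)) = x" "\<And>x. x \<in> S \<Longrightarrow> \<rho> x \<noteq> x"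
  shows "\<exists>ts. distinct (concat (map (orb3 \<rho>) ts)) \<and> set (concat (map (orb3 \<rho>) ts)) = S"
  using assms
proof (induction "card S" arbitrary: S rule: less_induct)
  case less
  show ?case
  proof (cases "S = {}")
    case True
    then show ?thesis by (intro exI[of _ "[]"]) simp
  next
    case False
    then obtain t where t: "t \<in> S" by blast
    have o: "\<rho> t \<in> S" "\<rho> (\<rho> t) \<in> S" "\<rho> (\<rho> (\<rho> t)) = t" "\<rho> t \<noteq> t" "\<rho> (\<rho> t) \<noteq> \<rho> t" "\<rho> (\<rho> t) \<noteq> t"
    proof -
      show 1: "\<rho> t \<in> S" "\<rho> (\<rho> t) \<in> S" "\<rho> (\<rho> (\<rho> t)) = t" "\<rho> t \<noteq> t" "\<rho> (\<rho> t) \<noteq> \<rho> t"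
        using less.prems(2-4) t by simp_all
      then show "\<rho> (\<rho> t) \<noteq> t" by metis
    qed
    let ?S = "S - set (orb3 \<rho> t)"
    have closed: "\<rho> x \<in> ?S" if "x \<in> ?S" for x
    proof -
      have "\<rho> x \<notin> set (orb3 \<rho> t)"
      proof
        assume "\<rho> x \<in> set (orb3 \<rho> t)"
        then have "\<rho> (\<rho> (\<rho> x)) \<in> set (orb3 \<rho> t)" using o(3) by (auto simp: orb3_def)
        then show False using less.prems(3)[of x] that by auto
      qed
      then show ?thesis using less.prems(2) that by auto
    qed
    have "card ?S < card S"
      using t less.prems(1) by (intro psubset_card_mono) (auto simp: orb3_def)
    moreover have "finite ?S" using less.prems(1) by simp
    ultimately obtain ts where ts: "distinct (concat (map (orb3 \<rho>) ts))" "set (concat (map (orb3 \<rho>) ts)) = ?S"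
      using less.hyps[of ?S] closed less.prems(3,4) by blast
    show ?thesis
    proof (intro exI[of _ "t # ts"] conjI)
      show "distinct (concat (map (orb3 \<rho>) (t # ts)))"
        using ts o(4-6) by (auto simp: orb3_def)
      show "set (concat (map (orb3 \<rho>) (t # ts))) = S"
        using ts(2) o(1,2) t by (auto simp: orb3_def)
    qed
  qed
qed

lemma count_rotated:
  fixes \<rho> :: "'n \<Rightarrow> 'n"
  assumes "\<rho> (\<rho> (\<rho> x)) = x"
  shows "card {i. i < 3 \<and> F ((\<rho> ^^ (u + i)) x)} = card {i. i < (3::nat) \<and> F ((\<rho> ^^ i) x)}"
proof (induction u)
  case (Suc u)
  have three: "{i. i < (3::nat) \<and> P i} = (if P 0 then {0} else {}) \<union> (if P 1 then {1} else {}) \<union> (if P 2 then {2} else {})" for P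
    by (auto simp: numeral_3_eq_3 less_Suc_eq numeral_2_eq_2 intro: gr0I)
  have "(\<rho> ^^ (u + 3)) x = (\<rho> ^^ u) x"
  proof -
    have "(\<rho> ^^ 3) x = x" using assms by (simp add: numeral_3_eq_3)
    then show ?thesis by (simp only: funpow_add o_apply)
  qed
  then have "card {i. i < 3 \<and> F ((\<rho> ^^ (Suc u + i)) x)} = card {i. i < 3 \<and> F ((\<rho> ^^ (u + i)) x)}"
    unfolding three by (simp add: numeral_3_eq_3 numeral_2_eq_2 del: funpow.simps)
  then show ?case using Suc by simp
qed simp


text \<open>
  \<open>U\<close> is meant to be the set of kernels, \<open>\<rho>\<close> the rotation and \<open>ordr\<close> the order of the first entry.  \<open>C\<close>
  provides a third orbit that supplies up to two extra elements when the length is not divisible by three; its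
  orders are among those of \<open>T\<close> and \<open>T'\<close>, so that it never has a maximal \<open>p\<close>-part alone.  The condition
  \<open>unbalanced\<close> says that a maximal \<open>p\<close>-part cannot occur equally often in the orbits of \<open>T\<close> and \<open>T'\<close>
  unless it occurs in neither.
\<close>

locale rotated_orders =
  fixes U :: "'n set" and \<rho> :: "'n \<Rightarrow> 'n" and ordr :: "'n \<Rightarrow> nat"
    and T T' C :: 'n
  assumes finU: "finite U" and rho_closed: "x \<in> U \<Longrightarrow> \<rho> x \<in> U" and rho3: "x \<in> U \<Longrightarrow> \<rho> (\<rho> (\<rho> x)) = x"
    and ordr_pos: "x \<in> U \<Longrightarrow> ordr x > 0"
    and TTC: "T \<in> U" "T' \<in> U" "C \<in> U" "distinct (orb3 \<rho> T @ orb3 \<rho> T' @ orb3 \<rho> C)"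
    and dominated: "\<And>c. c \<in> set (orb3 \<rho> C) \<Longrightarrow> \<exists>t\<in>set (orb3 \<rho> T) \<union> set (orb3 \<rho> T'). ordr c = ordr t"
    and unbalanced: "\<And>p e. Factorial_Ring.prime p \<Longrightarrow> e > 0 \<Longrightarrow>
      (\<And>i. i < 3 \<Longrightarrow> multiplicity p (ordr ((\<rho> ^^ i) T)) \<le> e \<and> multiplicity p (ordr ((\<rho> ^^ i) T')) \<le> e) \<Longrightarrow>
      card {i. i < 3 \<and> multiplicity p (ordr ((\<rho> ^^ i) T)) = e}
        = card {i. i < 3 \<and> multiplicity p (ordr ((\<rho> ^^ i) T')) = e} \<Longrightarrow>
      card {i. i < (3::nat) \<and> multiplicity p (ordr ((\<rho> ^^ i) T)) = e} = 0"
begin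

lemma funpow_closed: "x \<in> U \<Longrightarrow> (\<rho> ^^ a) x \<in> U"
  by (induction a) (auto simp: rho_closed)

lemma set_orb3_closed: "x \<in> U \<Longrightarrow> y \<in> set (orb3 \<rho> x) \<Longrightarrow> (\<rho> ^^ a) y \<in> set (orb3 \<rho> x)"
  by (induction a) (auto simp: orb3_def rho3)

text \<open>
  When all orbits of size three fit, the remaining places are taken by fixed points of \<open>\<rho>\<close>.  Otherwise the
  list is filled with whole orbits, and \<open>k mod 3\<close> elements of the orbit of \<open>C\<close> are added.
\<close>

lemma arrangement_exists:
  assumes k: "6 \<le> k" "k \<le> card U"
  shows "\<exists>ts E. length (concat (map (orb3 \<rho>) (T # T' # ts)) @ E) = k
    \<and> distinct (concat (map (orb3 \<rho>) (T # T' # ts)) @ E)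
    \<and> set (concat (map (orb3 \<rho>) (T # T' # ts)) @ E) \<subseteq> U
    \<and> (\<forall>e\<in>set E. \<rho> e = e \<or> e \<in> set (orb3 \<rho> C))"
proof -
  let ?c = "\<lambda>ts. concat (map (orb3 \<rho>) ts)"
  define S where "S = {x \<in> U. \<rho> x \<noteq> x} - set (?c [T, T', C])"
  define fixed where "fixed = {x \<in> U. \<rho> x = x}"
  have fin: "finite S" "finite fixed" using finU by (auto simp: S_def fixed_def)
  have inj: "\<rho> x = \<rho> y \<Longrightarrow> x = y" if "x \<in> U" "y \<in> U" for x y using rho3 that by metis
  have sp: "set (?c [T, T', C]) \<subseteq> U" using TTC(1-3) rho_closed by (auto simp: orb3_def)
  have closed: "\<rho> x \<in> S" if x: "x \<in> S" for x
  proof -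
    have xU: "x \<in> U" "\<rho> x \<noteq> x" using x by (auto simp: S_def)
    have "\<rho> (\<rho> x) \<noteq> \<rho> x" using inj[of "\<rho> x" x] rho_closed xU by blast
    moreover have "\<rho> x \<notin> set (?c [T, T', C])"
    proof
      assume "\<rho> x \<in> set (?c [T, T', C])"
      then obtain y where "y \<in> {T, T', C}" "\<rho> x \<in> set (orb3 \<rho> y)" by auto
      then have "(\<rho> ^^ 2) (\<rho> x) \<in> set (orb3 \<rho> y)" using set_orb3_closed TTC(1-3) by blast
      then have "x \<in> set (orb3 \<rho> y)" using rho3[OF xU(1)] by (simp add: numeral_2_eq_2)
      then show False using x \<open>y \<in> {T, T', C}\<close> by (auto simp: S_def)
    qed
    ultimately show ?thesis using rho_closed xU by (auto simp: S_def)
  qed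
  obtain ts where ts: "distinct (?c ts)" "set (?c ts) = S"
    using list_of_orbits[of S \<rho>, OF fin(1) closed] rho3 unfolding S_def by blast
  obtain fx where fx: "set fx = fixed" "distinct fx" using finite_distinct_list[OF fin(2)] by blast
  have nonfix: "\<rho> x \<noteq> x" if xin: "x \<in> set (?c [T, T', C])" for x
  proof
    assume fixx: "\<rho> x = x"
    obtain y where y: "y \<in> {T, T', C}" "x \<in> set (orb3 \<rho> y)" using xin by auto
    have "x = \<rho> y \<or> x = y \<or> x = \<rho> (\<rho> y)" using y by (auto simp: orb3_def)
    moreover have "\<rho> (\<rho> (\<rho> y)) = y" using y TTC(1-3) rho3 by auto
    ultimately have "\<rho> y = y" using fixx by metis
    then show False using y(1) TTC(4) by (auto simp: orb3_def)
  qed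
  have "set (?c ts) \<inter> set (?c [T, T', C]) = {}" using ts(2) by (auto simp: S_def)
  then have dts: "distinct (?c (T # T' # ts @ [C]))" using ts(1) TTC(4) by auto
  have sts: "set (?c (T # T' # ts @ [C])) = {x \<in> U. \<rho> x \<noteq> x}"
    using ts(2) sp nonfix by (auto simp: S_def)
  let ?q = "length ts + 3"
  have cardU: "card U = 3 * ?q + length fx"
  proof -
    have "card U = card {x \<in> U. \<rho> x \<noteq> x} + card fixed"
      unfolding fixed_def using finU by (subst card_Un_disjoint[symmetric]) (auto intro: arg_cong[of _ _ card])
    moreover have "card {x \<in> U. \<rho> x \<noteq> x} = 3 * ?q"
      using distinct_card[OF dts] unfolding sts length_concat_orb3 by simp
    moreover have "card fixed = length fx" using distinct_card[OF fx(2)] fx(1) by simp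
    ultimately show ?thesis by simp
  qed
  show ?thesis
  proof (cases "3 * ?q \<le> k")
    case True
    have len: "length (?c (T # T' # ts @ [C]) @ take (k - 3 * ?q) fx) = k"
      unfolding length_append length_concat_orb3 using True k(2) cardU by simp
    have dis: "distinct (?c (T # T' # ts @ [C]) @ take (k - 3 * ?q) fx)"
    proof -
      have "set (?c (T # T' # ts @ [C])) \<inter> set (take (k - 3 * ?q) fx) = {}"
        unfolding sts using set_take_subset[of "k - 3 * ?q" fx] fx(1) by (auto simp: fixed_def)
      then show ?thesis using dts fx(2) by (simp only: distinct_append) simp
    qed
    have "set (take (k - 3 * ?q) fx) \<subseteq> fixed" using set_take_subset[of "k - 3 * ?q" fx] fx(1) by simp
    then have sub: "set (?c (T # T' # ts @ [C]) @ take (k - 3 * ?q) fx) \<subseteq> U"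
      and E: "\<forall>e\<in>set (take (k - 3 * ?q) fx). \<rho> e = e \<or> e \<in> set (orb3 \<rho> C)"
      unfolding set_append sts by (auto simp: fixed_def)
    show ?thesis
      by (rule exI[of _ "ts @ [C]"], rule exI[of _ "take (k - 3 * ?q) fx"]) (intro conjI len dis sub E)
  next
    case False
    let ?ts = "take (k div 3 - 2) ts" and ?E = "take (k mod 3) (orb3 \<rho> C)"
    have lts: "length ?ts = k div 3 - 2" using False by simp
    have "length (?c (T # T' # ?ts) @ ?E) = 3 * (length ?ts + 2) + k mod 3"
      unfolding length_append length_concat_orb3 by (simp add: orb3_def)
    also have "\<dots> = k"
    proof -
      have q: "length ?ts + 2 = k div 3" unfolding lts using k(1) by linarith
      show ?thesis unfolding q by simp
    qed
    finally have len: "length (?c (T # T' # ?ts) @ ?E) = k" .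
    have sub: "set (?c ?ts) \<subseteq> set (?c ts)"
      using set_take_subset[of "k div 3 - 2" ts] by auto
    have dis: "distinct (?c (T # T' # ?ts) @ ?E)"
    proof -
      have "?c ts = ?c ?ts @ ?c (drop (k div 3 - 2) ts)"
        by (metis append_take_drop_id concat_append map_append)
      then have "distinct (?c ?ts)" using ts(1) by (metis distinct_append)
      moreover have "set ?E \<subseteq> set (orb3 \<rho> C)" "distinct ?E" using TTC(4) by (auto dest: in_set_takeD)
      moreover have "set (?c ?ts) \<inter> (set (orb3 \<rho> T) \<union> set (orb3 \<rho> T') \<union> set (orb3 \<rho> C)) = {}"
        using sub ts(2) by (auto simp: S_def)
      ultimately show ?thesis using TTC(4) by auto
    qed
    have subU: "set (?c (T # T' # ?ts) @ ?E) \<subseteq> U"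
      using sub ts(2) sp by (auto simp: S_def dest: in_set_takeD)
    have E: "\<forall>e\<in>set ?E. \<rho> e = e \<or> e \<in> set (orb3 \<rho> C)" by (auto dest: in_set_takeD)
    show ?thesis by (rule exI[of _ ?ts], rule exI[of _ ?E]) (intro conjI len dis subU E)
  qed
qed

text \<open>
  Suppose that the sets of full coordinates for \<open>p\<close> agree.  The shift by three places moves each orbit to the
  place of the next, so all orbits contain equally many elements of maximal \<open>p\<close>-part.  If this number is
  positive, \<open>T\<close> and \<open>T'\<close> contradict \<open>unbalanced\<close>.  If it is zero, the full coordinates lie in \<open>E\<close> and hold
  fixed points of \<open>\<rho>\<close>; the shift maps the least of them to a smaller one.
\<close>

lemma arrangement_separated:
  fixes ts E :: "'n list"
  defines "L \<equiv> concat (map (orb3 \<rho>) (T # T' # ts)) @ E"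
  assumes sub: "set L \<subseteq> U" and E: "\<And>e. e \<in> set E \<Longrightarrow> \<rho> e = e \<or> e \<in> set (orb3 \<rho> C)"
  shows "p_separated {..<length L} (\<lambda>i. ordr ((\<rho> ^^ u) (L ! i))) (\<lambda>i. ordr ((\<rho> ^^ v) (rotate (length L - 3) L ! i)))"
  unfolding p_separated_def
proof (intro allI impI, rule ccontr)
  fix p :: nat
  let ?k = "length L" and ?L' = "rotate (length L - 3) L" and ?bs = "T # T' # ts"
  let ?m = "length ?bs"
  let ?v = "\<lambda>x. multiplicity p (ordr x)"
  assume p: "Factorial_Ring.prime p"
    and eq: "p_full p {..<?k} (\<lambda>i. ordr ((\<rho> ^^ u) (L ! i))) = p_full p {..<?k} (\<lambda>i. ordr ((\<rho> ^^ v) (?L' ! i)))"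
    and ne: "p_full p {..<?k} (\<lambda>i. ordr ((\<rho> ^^ u) (L ! i))) \<noteq> {}"
  have m: "?m \<ge> 2" and k: "?k = 3 * ?m + length E"
    unfolding L_def length_append length_concat_orb3 by simp_all
  have Lblock: "L ! (3 * j + r) = (\<rho> ^^ r) (?bs ! j)" if "j < ?m" "r < 3" for j r
  proof -
    have "3 * j + r < length (concat (map (orb3 \<rho>) ?bs))" using that unfolding length_concat_orb3 by linarith
    then show ?thesis unfolding L_def using nth_concat_orb3[OF that] by (simp only: nth_append if_True)
  qed
  have bsU: "?bs ! j \<in> U" if "j < ?m" for j
  proof -
    have "3 * j + 0 < ?k" using that k by simp
    then have "L ! (3 * j + 0) \<in> U" using sub nth_mem by blast
    then show ?thesis using Lblock[OF that, of 0] by simp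
  qed
  define vals where "vals = (\<lambda>(x, a). ?v ((\<rho> ^^ a) x)) ` (set L \<times> {..<3})"
  define \<mu> where "\<mu> = Max vals"
  have finv: "finite vals" "vals \<noteq> {}" using m k by (auto simp: vals_def lessThan_empty_iff)
  have le3: "?v ((\<rho> ^^ a) x) \<le> \<mu>" if "x \<in> set L" "a < 3" for x a
    unfolding \<mu>_def by (rule Max_ge[OF finv(1)]) (use that in \<open>auto simp: vals_def\<close>)
  have mod3: "(\<rho> ^^ a) x = (\<rho> ^^ (a mod 3)) x" if "x \<in> U" for a x
  proof -
    have "(\<rho> ^^ 3) x = x" using rho3[OF that] by (simp add: numeral_3_eq_3)
    then show ?thesis by (metis funpow_mod_eq)
  qed
  have le: "?v ((\<rho> ^^ a) x) \<le> \<mu>" if "x \<in> set L" for x a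
    using le3[OF that, of "a mod 3"] mod3[of x a] that sub by auto
  obtain x0 a0 where x0: "x0 \<in> set L" "?v ((\<rho> ^^ a0) x0) = \<mu>"
    using Max_in[OF finv] unfolding \<mu>_def vals_def by auto
  let ?F = "\<lambda>x. ?v x = \<mu>"
  have \<mu>: "\<mu> > 0"
  proof -
    obtain i where i: "i < ?k" "p dvd ordr ((\<rho> ^^ u) (L ! i))" using ne by (auto simp: p_full_def)
    have "ordr ((\<rho> ^^ u) (L ! i)) > 0"
      using ordr_pos funpow_closed sub nth_mem[OF i(1)] by blast
    then have "?v ((\<rho> ^^ u) (L ! i)) > 0" using i(2) p
      by (simp add: prime_multiplicity_gt_zero_iff)
    then show ?thesis using le[OF nth_mem[OF i(1)], of u] by linarith
  qed
  have full: "p_full p {..<?k} (\<lambda>i. ordr ((\<rho> ^^ a) (M ! i))) = {i. i < ?k \<and> ?F ((\<rho> ^^ a) (M ! i))}"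
    if M: "set M = set L" "length M = ?k" and ex: "\<exists>x\<in>set M. ?F ((\<rho> ^^ a) x)" for M a
  proof -
    obtain i0 where i0: "i0 < ?k" "?F ((\<rho> ^^ a) (M ! i0))" using ex M(2) by (metis in_set_conv_nth)
    have leM: "?v ((\<rho> ^^ a) (M ! i)) \<le> \<mu>" if "i < ?k" for i
      using le[of "M ! i" a] nth_mem[of i M] that M by simp
    have "?F ((\<rho> ^^ a) (M ! i)) \<longleftrightarrow> p dvd ordr ((\<rho> ^^ a) (M ! i)) \<and>
        (\<forall>j\<in>{..<?k}. ?v ((\<rho> ^^ a) (M ! j)) \<le> ?v ((\<rho> ^^ a) (M ! i)))" if i: "i < ?k" for i
    proof
      assume F: "?F ((\<rho> ^^ a) (M ! i))"
      then have "p dvd ordr ((\<rho> ^^ a) (M ! i))" using \<mu> not_dvd_imp_multiplicity_0 by fastforce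
      then show "p dvd ordr ((\<rho> ^^ a) (M ! i)) \<and>
        (\<forall>j\<in>{..<?k}. ?v ((\<rho> ^^ a) (M ! j)) \<le> ?v ((\<rho> ^^ a) (M ! i)))" using F leM by simp
    next
      assume "p dvd ordr ((\<rho> ^^ a) (M ! i)) \<and>
        (\<forall>j\<in>{..<?k}. ?v ((\<rho> ^^ a) (M ! j)) \<le> ?v ((\<rho> ^^ a) (M ! i)))"
      then have "\<mu> \<le> ?v ((\<rho> ^^ a) (M ! i))" using i0 by force
      then show "?F ((\<rho> ^^ a) (M ! i))" using leM[OF i] by linarith
    qed
    then show ?thesis by (auto simp: p_full_def)
  qed
  define w where "w x = card {r. r < (3::nat) \<and> ?F ((\<rho> ^^ r) x)}" for x
  have w_rot: "w x = card {r. r < (3::nat) \<and> ?F ((\<rho> ^^ (a + r)) x)}" if "x \<in> U" for a x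
    unfolding w_def using count_rotated[of \<rho> x ?F a] rho3[OF that] by simp
  have w_pos: "(\<exists>r<3. ?F ((\<rho> ^^ (a + r)) x)) \<longleftrightarrow> w x > 0" if "x \<in> U" for a x
    unfolding w_rot[OF that, of a] by (auto simp: card_gt_0_iff)
  have w_zero: "\<not> ?F ((\<rho> ^^ a) x)" if "x \<in> U" "w x = 0" for a x
  proof
    assume "?F ((\<rho> ^^ a) x)"
    then have "\<exists>r<3. ?F ((\<rho> ^^ (a + r)) x)" by (intro exI[of _ 0]) simp
    then show False using w_pos[OF that(1), of a] that(2) by simp
  qed
  have L': "set ?L' = set L" "length ?L' = ?k" by simp_all
  have nthL': "?L' ! i = L ! ((?k - 3 + i) mod ?k)" if "i < ?k" for i
    using nth_rotate[OF that] .
  show False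
  proof (cases "\<exists>j<?m. w (?bs ! j) > 0")
    case True
    then obtain j0 where j0: "j0 < ?m" "w (?bs ! j0) > 0" by blast
    have att: "\<exists>x\<in>set L. ?F ((\<rho> ^^ a) x)" for a
    proof -
      obtain r where r: "r < 3" "?F ((\<rho> ^^ (a + r)) (?bs ! j0))"
        using w_pos[OF bsU[OF j0(1)], of a] j0(2) by blast
      then have "?F ((\<rho> ^^ a) (L ! (3 * j0 + r)))" unfolding Lblock[OF j0(1) r(1)] by (simp add: funpow_add)
      moreover have "3 * j0 + r < ?k" using j0(1) r(1) k by linarith
      ultimately show ?thesis using nth_mem by blast
    qed
    have S: "?F ((\<rho> ^^ u) (L ! i)) \<longleftrightarrow> ?F ((\<rho> ^^ v) (?L' ! i))" if "i < ?k" for i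
    proof -
      have "{i. i < ?k \<and> ?F ((\<rho> ^^ u) (L ! i))} = {i. i < ?k \<and> ?F ((\<rho> ^^ v) (?L' ! i))}"
        using eq full[OF refl refl att, of u] full[OF L', of v] att[of v] by simp
      then show ?thesis using that by blast
    qed
    have step: "w (?bs ! Suc j) = w (?bs ! j)" if j: "Suc j < ?m" for j
    proof -
      have "?F ((\<rho> ^^ (u + r)) (?bs ! Suc j)) \<longleftrightarrow> ?F ((\<rho> ^^ (v + r)) (?bs ! j))" if r: "r < 3" for r
      proof -
        have i: "3 * Suc j + r < ?k" using j r by (simp add: k)
        have "(?k - 3 + (3 * Suc j + r)) mod ?k = (?k + (3 * j + r)) mod ?k"
          using i by (intro arg_cong[of _ _ "\<lambda>x. x mod ?k"]) simp
        also have "\<dots> = 3 * j + r" using i by simp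
        finally have "?L' ! (3 * Suc j + r) = L ! (3 * j + r)" using nthL'[OF i] by simp
        then show ?thesis
          using S[OF i] Lblock[OF j r] Lblock[OF Suc_lessD[OF j] r] by (simp add: funpow_add)
      qed
      then have "{r. r < 3 \<and> ?F ((\<rho> ^^ (u + r)) (?bs ! Suc j))} = {r. r < 3 \<and> ?F ((\<rho> ^^ (v + r)) (?bs ! j))}"
        by blast
      then show ?thesis
        unfolding w_rot[OF bsU[OF j], of u] w_rot[OF bsU[OF Suc_lessD[OF j]], of v] by simp
    qed
    have all: "w (?bs ! j) = w T" if "j < ?m" for j
      using that
    proof (induction j)
      case (Suc j) then show ?case using step[of j] by simp
    qed simp
    have "w T' = w T" using all[of 1] by simp
    have TL: "T \<in> set L" "T' \<in> set L" by (auto simp: L_def orb3_def)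
    have "w T = 0"
      unfolding w_def
    proof (rule unbalanced[OF p \<mu>])
      show "?v ((\<rho> ^^ i) T) \<le> \<mu> \<and> ?v ((\<rho> ^^ i) T') \<le> \<mu>" for i using le TL by blast
    qed (use \<open>w T' = w T\<close> in \<open>simp add: w_def\<close>)
    then show False using all[OF j0(1)] j0(2) by simp
  next
    case False
    then have none: "w (?bs ! j) = 0" if "j < ?m" for j using that by auto
    have noblock: "\<not> ?F ((\<rho> ^^ a) (L ! i))" if i: "i < 3 * ?m" for a i
    proof -
      have j: "i div 3 < ?m" using i by linarith
      have "L ! i = (\<rho> ^^ (i mod 3)) (?bs ! (i div 3))" using Lblock[OF j, of "i mod 3"] by simp
      then have "(\<rho> ^^ a) (L ! i) = (\<rho> ^^ (a + i mod 3)) (?bs ! (i div 3))" by (simp add: funpow_add)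
      then show ?thesis using w_zero[OF bsU[OF j] none[OF j]] by simp
    qed
    have noT: "\<not> ?F t" if "t \<in> set (orb3 \<rho> T) \<union> set (orb3 \<rho> T')" for t
      using w_zero[OF TTC(1), of 0] w_zero[OF TTC(1), of 1] w_zero[OF TTC(1), of 2]
        w_zero[OF TTC(2), of 0] w_zero[OF TTC(2), of 1] w_zero[OF TTC(2), of 2]
        none[of 0] none[of 1] that
      by (auto simp: orb3_def numeral_2_eq_2)
    have fixd: "\<rho> (L ! i) = L ! i" if i: "i < ?k" "?F ((\<rho> ^^ a) (L ! i))" for i a
    proof -
      have i3: "\<not> i < 3 * ?m" using noblock i(2) by blast
      then have "L ! i = E ! (i - 3 * ?m)"
        unfolding L_def by (simp add: nth_append length_concat_orb3 del: concat.simps list.map)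
      moreover have "i - 3 * ?m < length E" using i(1) k i3 by linarith
      ultimately have LE: "L ! i \<in> set E" by simp
      have "L ! i \<notin> set (orb3 \<rho> C)"
      proof
        assume "L ! i \<in> set (orb3 \<rho> C)"
        then have "(\<rho> ^^ a) (L ! i) \<in> set (orb3 \<rho> C)" by (rule set_orb3_closed[OF TTC(3)])
        then show False using dominated noT i(2) by metis
      qed
      then show ?thesis using E[OF LE] by blast
    qed
    have fixa: "(\<rho> ^^ a) x = x" if "\<rho> x = x" for a x
      using that by (induction a) auto
    obtain i0 where "i0 < ?k" "?F ((\<rho> ^^ a0) (L ! i0))" using x0 by (metis in_set_conv_nth)
    then have i0: "i0 < ?k" "?F (L ! i0)" using fixd[of i0 a0] fixa[of "L ! i0" a0] by simp_all
    define i where "i = (LEAST i. i < ?k \<and> ?F (L ! i))"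
    have i: "i < ?k" "?F (L ! i)" unfolding i_def using LeastI[of "\<lambda>i. i < ?k \<and> ?F (L ! i)" i0] i0 by auto
    have fi: "\<rho> (L ! i) = L ! i" using fixd[of i 0] i by simp
    have att: "\<exists>x\<in>set L. ?F ((\<rho> ^^ a) x)" for a by (rule bexI[OF _ nth_mem[OF i(1)]]) (simp only: fixa[OF fi] i(2))
    have S: "{i. i < ?k \<and> ?F ((\<rho> ^^ u) (L ! i))} = {i. i < ?k \<and> ?F ((\<rho> ^^ v) (?L' ! i))}"
      using eq full[OF refl refl att, of u] full[OF L', of v] att[of v] by simp
    have "?F ((\<rho> ^^ u) (L ! i))" by (simp only: fixa[OF fi] i(2))
    then have "i \<in> {i. i < ?k \<and> ?F ((\<rho> ^^ v) (?L' ! i))}" unfolding S[symmetric] using i(1) by blast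
    then have "?F ((\<rho> ^^ v) (?L' ! i))" by blast
    moreover have i3: "3 \<le> i" using noblock[of i 0] i(2) m by (cases "i < 3 * ?m") auto
    have "(?k - 3 + i) mod ?k = (?k + (i - 3)) mod ?k"
      using i3 i(1) by (intro arg_cong[of _ _ "\<lambda>x. x mod ?k"]) simp
    then have "?L' ! i = L ! (i - 3)" using nthL'[OF i(1)] i(1) by simp
    ultimately have F3: "?F ((\<rho> ^^ v) (L ! (i - 3)))" by simp
    have "i - 3 < ?k" using i(1) by simp
    then have "?F (L ! (i - 3))" using F3 fixa[OF fixd[OF _ F3]] by simp
    then have "i \<le> i - 3" unfolding i_def using \<open>i - 3 < ?k\<close> by (intro Least_le) (simp add: i_def)
    then show False using i3 by linarith
  qed
qed

end

section \<open>Large powers\<close>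

text \<open>
  The reversed triple \<open>(z\<^sup>-\<^sup>1, y\<^sup>-\<^sup>1, x\<^sup>-\<^sup>1)\<close>.  Its orders are those of the triple in the opposite cyclic order.
\<close>

definition rev_row :: "('a, 'b) monoid_scheme \<Rightarrow> 'a \<times> 'a \<Rightarrow> 'a \<times> 'a" where
  "rev_row G r = (inv\<^bsub>G\<^esub> entry G 2 r, inv\<^bsub>G\<^esub> entry G 1 r)"

lemma (in group) rev_row:
  assumes "gen_row G r"
  shows "gen_row G (rev_row G r)"
    and "entry_ord G 0 (rev_row G r) = entry_ord G 2 r"
    and "entry_ord G 1 (rev_row G r) = entry_ord G 1 r"
    and "entry_ord G 2 (rev_row G r) = entry_ord G 0 r"
proof -
  define x y where "x = fst r" and "y = snd r"
  have c: "x \<in> carrier G" "y \<in> carrier G" and g: "gen_pair G x y"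
    using assms gen_row_closed[OF assms] by (simp_all add: x_def y_def gen_row_def)
  have rv: "rev_row G r = (x \<otimes> y, inv y)"
    using c by (simp add: rev_row_def entry_simps x_def y_def)
  have "gen_pair G (x \<otimes> y) (inv y)"
  proof (rule gen_pair_transfer[OF g])
    fix K assume K: "subgroup K G" "x \<otimes> y \<in> K" "inv y \<in> K"
    have e: "(x \<otimes> y) \<otimes> inv y = x" "inv (inv y) = y" using c by (simp_all add: m_assoc)
    show "x \<in> K \<and> y \<in> K"
      using subgroup.m_closed[OF K] subgroup.m_inv_closed[OF K(1,3)] unfolding e by simp
  qed (use c in simp_all)
  then show "gen_row G (rev_row G r)" by (simp add: rv gen_row_def)
  show "entry_ord G 0 (rev_row G r) = entry_ord G 2 r"
    using c by (simp add: entry_ord_def rv entry_simps flip: x_def y_def)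
  show "entry_ord G 1 (rev_row G r) = entry_ord G 1 r"
    using c by (simp add: entry_ord_def rv entry_simps flip: x_def y_def)
  show "entry_ord G 2 (rev_row G r) = entry_ord G 0 r"
    using c by (simp add: entry_ord_def rv entry_simps m_assoc flip: x_def y_def)
qed

text \<open>
  The arrangement of kernels is used with the orbits of \<open>r\<close>, \<open>r'\<close> and the reversal of \<open>r\<close>.  Since the orders of
  \<open>r\<close> are distinct, the reversal is not equivalent to a rotation of \<open>r\<close>, and it has the same orders.
\<close>

theorem beauville_large_power:
  assumes H: "simple_group H" "finite (carrier H)" "\<not> comm_group H"
    and g: "gen_row H r" "gen_row H r'" and hyp: "hyperbolic_row H r"
    and dist: "distinct [entry_ord H 0 r, entry_ord H 1 r, entry_ord H 2 r]"
    and ne: "\<not> (entry_ord H 0 r' = entry_ord H 1 r' \<and> entry_ord H 1 r' = entry_ord H 2 r')"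
    and os: "ord_set H r \<noteq> ord_set H r'"
    and unbalanced: "\<And>p e. Factorial_Ring.prime p \<Longrightarrow> e > 0 \<Longrightarrow>
      (\<And>u. u < 3 \<Longrightarrow> multiplicity p (entry_ord H u r) \<le> e \<and> multiplicity p (entry_ord H u r') \<le> e) \<Longrightarrow>
      card {u. u < 3 \<and> multiplicity p (entry_ord H u r) = e}
        = card {u. u < 3 \<and> multiplicity p (entry_ord H u r') = e} \<Longrightarrow>
      card {u. u < (3::nat) \<and> multiplicity p (entry_ord H u r) = e} = 0"
    and k: "6 \<le> k" "k \<le> d2 H"
  shows "beauville_group (direct_power H k)"
proof -
  interpret simple_group H by fact
  define U where "U = {relators H x y | x y. gen_pair H x y}"
  have U: "N \<in> U \<longleftrightarrow> (\<exists>s. gen_row H s \<and> row_relators H s = N)" for N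
    by (auto simp: U_def gen_row_def)
  define rep where "rep N = (SOME s. gen_row H s \<and> row_relators H s = N)" for N
  have rep: "gen_row H (rep N)" "row_relators H (rep N) = N" if "N \<in> U" for N
    using someI_ex[of "\<lambda>s. gen_row H s \<and> row_relators H s = N"] that U by (auto simp: rep_def)
  define ordr where "ordr N = entry_ord H 0 (rep N)" for N
  have rrot: "rot_relators (row_relators H s) = row_relators H (rot H s)" if "gen_row H s" for s
    using row_relators_rot[OF gen_row_closed[OF that]] by simp
  have rpow: "(rot_relators ^^ u) (row_relators H s) = row_relators H ((rot H ^^ u) s)" if "gen_row H s" for u s
    by (induction u) (simp_all add: rrot gen_row_rot_funpow[OF that])
  have ordr: "ordr (row_relators H s) = entry_ord H 0 s" if s: "gen_row H s" for s
  proof -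
    have "row_relators H s \<in> U" using s U by blast
    then show ?thesis unfolding ordr_def using row_relators_eq_entry_ord[OF rep(1) s rep(2)] by simp
  qed
  have ordr_pow: "ordr ((rot_relators ^^ u) (row_relators H s)) = entry_ord H u s" if s: "gen_row H s" for u s
    unfolding rpow[OF s] ordr[OF gen_row_rot_funpow[OF s]] by (simp add: entry_ord_def entry_def)
  have orb: "orb3 rot_relators (row_relators H s) = map (row_relators H) (rots H s)" if "gen_row H s" for s
    using that gen_row_rot by (simp add: orb3_def rots_def rrot)
  let ?T = "row_relators H r" and ?T' = "row_relators H r'" and ?C = "row_relators H (rev_row H r)"
  note rv = rev_row[OF g(1)]
  have ord_pos: "entry_ord H u s > 0" if "gen_row H s" for u s
    using ord_ge_1[OF H(2) entry_closed[OF that]] by (auto simp: entry_ord_def Suc_le_eq)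
  have osr: "ord_set H (rev_row H r) = ord_set H r" using rv(2-4) by (auto simp: ord_set_def)
  \<comment> \<open>Orders read cyclically tell the six triples apart.\<close>
  have key: "row_relators H s \<noteq> row_relators H s'" if s: "s \<in> set (rots H r)" "s' \<in> set (rots H (rev_row H r))" for s s'
  proof
    assume eq: "row_relators H s = row_relators H s'"
    let ?o = "\<lambda>s. (entry_ord H 0 s, entry_ord H 1 s, entry_ord H 2 s)"
    have three: "?o s \<in> {(a, b, c), (b, c, a), (c, a, b)}"
      if "s \<in> set (rots H t)" "gen_row H t" "?o t = (a, b, c)" for s t a b c
      using that entry_ord_34[OF that(2)]
      by (auto simp: rots_def entry_ord_rot eval_nat_numeral)
    have "?o s = ?o s'"
      using row_relators_eq_entry_ord[OF set_rots(1)[OF g(1) s(1)] set_rots(1)[OF rv(1) s(2)] eq] by simp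
    then show False
      using three[OF s(1) g(1) refl] three[OF s(2) rv(1) refl] dist unfolding rv(2-4) by auto
  qed
  have keyT': "row_relators H s \<noteq> row_relators H s'"
    if s: "s \<in> set (rots H t)" "s' \<in> set (rots H r')" and t: "t \<in> {r, rev_row H r}" for s s' t
  proof
    assume eq: "row_relators H s = row_relators H s'"
    have gt: "gen_row H t" using t g(1) rv(1) by auto
    have "ord_set H s = ord_set H s'"
      by (rule row_relators_eq_ord_set[OF set_rots(1)[OF gt s(1)] set_rots(1)[OF g(2) s(2)] eq])
    then have "ord_set H t = ord_set H r'"
      using set_rots(2)[OF gt s(1)] set_rots(2)[OF g(2) s(2)] by simp
    then show False using t osr os by auto
  qed
  have nrv: "\<not> (entry_ord H 0 (rev_row H r) = entry_ord H 1 (rev_row H r)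
      \<and> entry_ord H 1 (rev_row H r) = entry_ord H 2 (rev_row H r))"
    using dist unfolding rv(2-4) by auto
  have nr: "\<not> (entry_ord H 0 r = entry_ord H 1 r \<and> entry_ord H 1 r = entry_ord H 2 r)"
    using dist by auto
  interpret A: rotated_orders U rot_relators ordr ?T ?T' ?C
  proof unfold_locales
    show "finite U" unfolding U_def by (rule finite_relators[OF H(2)])
    show "rot_relators N \<in> U" if "N \<in> U" for N
      using that U rrot gen_row_rot by metis
    show "rot_relators (rot_relators (rot_relators N)) = N" if N: "N \<in> U" for N
    proof -
      have "(rot_relators ^^ 3) (row_relators H (rep N)) = row_relators H ((rot H ^^ 3) (rep N))"
        by (rule rpow[OF rep(1)[OF N]])
      then show ?thesis
        using rot3[OF gen_row_closed[OF rep(1)[OF N]]] rep(2)[OF N] by (simp add: numeral_3_eq_3)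
    qed
    show "ordr N > 0" if "N \<in> U" for N unfolding ordr_def by (rule ord_pos[OF rep(1)[OF that]])
    show "?T \<in> U" "?T' \<in> U" "?C \<in> U" using U g rv(1) by blast+
    show "distinct (orb3 rot_relators ?T @ orb3 rot_relators ?T' @ orb3 rot_relators ?C)"
    proof -
      have d: "row_relators H ` A \<inter> row_relators H ` B = {}"
        if "\<And>s s'. s \<in> A \<Longrightarrow> s' \<in> B \<Longrightarrow> row_relators H s \<noteq> row_relators H s'" for A B
      proof (rule equals0I)
        fix N assume "N \<in> row_relators H ` A \<inter> row_relators H ` B"
        then obtain s s' where "s \<in> A" "s' \<in> B" "row_relators H s = row_relators H s'"
          by (elim IntE imageE) simp
        then show False using that by simp
      qed
      have "row_relators H ` set (rots H r) \<inter> row_relators H ` set (rots H r') = {}"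
        "row_relators H ` set (rots H r) \<inter> row_relators H ` set (rots H (rev_row H r)) = {}"
        "row_relators H ` set (rots H (rev_row H r)) \<inter> row_relators H ` set (rots H r') = {}"
        using keyT'[of _ r] keyT'[of _ "rev_row H r"] key by (intro d; simp)+
      then show ?thesis
        unfolding orb[OF g(1)] orb[OF g(2)] orb[OF rv(1)] distinct_append set_append set_map
        using distinct_rots[OF g(1) nr] distinct_rots[OF g(2) ne] distinct_rots[OF rv(1) nrv]
        by (simp add: Int_Un_distrib Int_commute)
    qed
    show "\<exists>t\<in>set (orb3 rot_relators ?T) \<union> set (orb3 rot_relators ?T'). ordr c = ordr t"
      if c: "c \<in> set (orb3 rot_relators ?C)" for c
    proof -
      have o: "ordr (row_relators H s) = entry_ord H 0 s" if "s \<in> set (rots H t)" "gen_row H t" for s t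
        using ordr set_rots(1)[OF that(2,1)] by blast
      obtain s where s: "s \<in> set (rots H (rev_row H r))" "c = row_relators H s"
        using c unfolding orb[OF rv(1)] by auto
      have "entry_ord H 0 s \<in> entry_ord H 0 ` set (rots H r)"
        using s(1) rv(2-4) by (auto simp: rots_def entry_ord_rot numeral_2_eq_2)
      then obtain t where t: "t \<in> set (rots H r)" "entry_ord H 0 s = entry_ord H 0 t" by blast
      have "row_relators H t \<in> set (orb3 rot_relators ?T)" unfolding orb[OF g(1)] using t(1) by simp
      moreover have "ordr c = ordr (row_relators H t)"
        unfolding s(2) o[OF s(1) rv(1)] o[OF t(1) g(1)] by (rule t(2))
      ultimately show ?thesis by blast
    qed
  next
    fix p e assume *: "Factorial_Ring.prime p" "(e::nat) > 0"
      and le: "\<And>i. i < 3 \<Longrightarrow> multiplicity p (ordr ((rot_relators ^^ i) ?T)) \<le> e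
        \<and> multiplicity p (ordr ((rot_relators ^^ i) ?T')) \<le> e"
      and card: "card {i. i < 3 \<and> multiplicity p (ordr ((rot_relators ^^ i) ?T)) = e}
        = card {i. i < 3 \<and> multiplicity p (ordr ((rot_relators ^^ i) ?T')) = e}"
    show "card {i. i < (3::nat) \<and> multiplicity p (ordr ((rot_relators ^^ i) ?T)) = e} = 0"
      using unbalanced[OF * le[unfolded ordr_pow[OF g(1)] ordr_pow[OF g(2)]]
        card[unfolded ordr_pow[OF g(1)] ordr_pow[OF g(2)]]]
      unfolding ordr_pow[OF g(1)] .
  qed
  have "k \<le> card U" using k(2) d2_eq_card_relators by (simp add: U_def)
  from A.arrangement_exists[OF k(1) this] obtain ts E where
    len: "length (concat (map (orb3 rot_relators) (?T # ?T' # ts)) @ E) = k"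
    and dis: "distinct (concat (map (orb3 rot_relators) (?T # ?T' # ts)) @ E)"
    and sub: "set (concat (map (orb3 rot_relators) (?T # ?T' # ts)) @ E) \<subseteq> U"
    and E: "\<forall>e\<in>set E. rot_relators e = e \<or> e \<in> set (orb3 rot_relators ?C)"
    by (elim exE conjE)
  define L where "L = concat (map (orb3 rot_relators) (?T # ?T' # ts)) @ E"
  have L: "length L = k" "distinct L" "set L \<subseteq> U" using len dis sub unfolding L_def by blast+
  have TL: "?T \<in> set L" unfolding L_def by (simp add: orb3_def)
  have rl: "row_list H (map rep M)" if M: "set M = set L" "distinct M" for M
    unfolding row_list_def
  proof (intro conjI)
    have MU: "N \<in> U" if "N \<in> set M" for N using that M(1) L(3) by blast
    show "\<forall>s\<in>set (map rep M). gen_row H s" using rep(1) MU by auto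
    have "map (row_relators H) (map rep M) = M"
      unfolding map_map by (rule map_idI) (simp add: rep(2) MU)
    then show "distinct (map (row_relators H) (map rep M))" using M(2) by simp
    have TU: "?T \<in> U" using TL L(3) by blast
    have "hyperbolic_row H (rep ?T)"
      using hyp row_relators_eq_entry_ord[OF rep(1)[OF TU] g(1) rep(2)[OF TU]] by (simp add: hyperbolic_row_def)
    then show "\<exists>s\<in>set (map rep M). hyperbolic_row H s" using TL M(1) by auto
  qed
  show ?thesis
  proof (rule beauville_separated[OF H])
    show "row_list H (map rep L)" by (rule rl[OF refl L(2)])
    show "row_list H (map rep (rotate (k - 3) L))" by (rule rl) (simp_all add: L(2))
    show "length (map rep L) = k" "length (map rep (rotate (k - 3) L)) = k" using L(1) by simp_all
    fix u v :: nat
    have eo: "entry_ord H a (map rep M ! i) = ordr ((rot_relators ^^ a) (M ! i))"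
      if "i < k" "length M = k" "set M \<subseteq> U" for a M i
    proof -
      have MU: "M ! i \<in> U" using that nth_mem by (metis subsetD)
      have "entry_ord H a (map rep M ! i) = entry_ord H a (rep (M ! i))" using that by simp
      also have "\<dots> = ordr ((rot_relators ^^ a) (row_relators H (rep (M ! i))))"
        using ordr_pow[OF rep(1)[OF MU]] by simp
      finally show ?thesis using rep(2)[OF MU] by simp
    qed
    have "p_separated {..<k} (\<lambda>i. ordr ((rot_relators ^^ u) (L ! i)))
        (\<lambda>i. ordr ((rot_relators ^^ v) (rotate (k - 3) L ! i)))"
      using A.arrangement_separated[OF sub, of u v] E unfolding L_def[symmetric] L(1) by blast
    then show "p_separated {..<k} (\<lambda>i. entry_ord H u (map rep L ! i))
        (\<lambda>i. entry_ord H v (map rep (rotate (k - 3) L) ! i))"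
      using eo[OF _ L(1,3), of _ u] eo[of _ "rotate (k - 3) L" v] L(1,3)
      by (simp add: p_separated_def p_full_def cong: conj_cong)
  qed
qed

section \<open>Generating alternating groups by three-cycles\<close>

lemma cycle3_apply:
  assumes "distinct [a, b, c]"
  shows "cycle_of_list [a, b, c] x = (if x = a then b else if x = b then c else if x = c then a else x)"
  using assms by (auto simp: transpose_def)

lemma cycle3_square:
  assumes "distinct [a, b, c]"
  shows "cycle_of_list [a, b, c] \<circ> cycle_of_list [a, b, c] = cycle_of_list [a, c, b]"
  using assms by (auto simp: fun_eq_iff transpose_def)

lemma cycle3_rotate:
  assumes "distinct [a, b, c]"
  shows "cycle_of_list [a, b, c] = cycle_of_list [b, c, a]"
  using cycle_of_list_rotate_independent[OF assms, of 1] by simp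

lemma cycle3_inverse:
  assumes "distinct [a, b, c]"
  shows "inv' (cycle_of_list [a, b, c]) = cycle_of_list [a, c, b]"
proof (rule inv_unique_comp)
  have d: "distinct [a, c, b]" "distinct [c, b, a]" using assms by auto
  show "cycle_of_list [a, b, c] \<circ> cycle_of_list [a, c, b] = id"
    "cycle_of_list [a, c, b] \<circ> cycle_of_list [a, b, c] = id"
    unfolding fun_eq_iff o_apply cycle3_apply[OF assms] cycle3_apply[OF d(1)] using assms d(2) by auto
qed

lemma cycle3_products:
  shows "distinct [a, b, c, d] \<Longrightarrow>
      cycle_of_list [b, c, d] \<circ> cycle_of_list [a, d, b] = transpose a b \<circ> transpose c d"
    and "distinct [a, b, d, e] \<Longrightarrow>
      cycle_of_list [b, a, e] \<circ> cycle_of_list [a, d, b] = transpose a d \<circ> transpose b e"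
    and "distinct [a, b, d] \<Longrightarrow>
      cycle_of_list [b, a, d] \<circ> cycle_of_list [a, d, b] = cycle_of_list [a, b, d]"
    and "distinct [d, a, b, c] \<Longrightarrow>
      cycle_of_list [b, c, a] \<circ> cycle_of_list [a, d, b] = cycle_of_list [a, d, c]"
    and "distinct [p, q, q', r, s] \<Longrightarrow>
      transpose p q \<circ> transpose r s \<circ> (transpose q' q \<circ> transpose r s) = cycle_of_list [p, q, q']"
  by (auto simp: fun_eq_iff transpose_def)

lemma alt_group_mult_apply [simp]: "p \<otimes>\<^bsub>alt_group n\<^esub> q = p \<circ> q"
  by (simp add: alt_group_mult)

lemma cycle3_in_alt_group:
  assumes "distinct [a, b, c]" "{a, b, c} \<subseteq> {1..n}"
  shows "cycle_of_list [a, b, c] \<in> carrier (alt_group n)"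
proof -
  have "cycle_of_list [a, b, c] \<in> three_cycles n"
    using assms by (intro CollectI exI[of _ "[a, b, c]"]) auto
  then show ?thesis using three_cycles_incl by blast
qed

lemma alt_group_bij: "p \<in> carrier (alt_group n) \<Longrightarrow> bij p"
  by (auto simp: alt_group_carrier permutes_bij)

lemma conj_double_transposition:
  assumes "bij g"
  shows "g \<circ> (transpose a b \<circ> transpose c d) \<circ> inv' g = transpose (g a) (g b) \<circ> transpose (g c) (g d)"
proof -
  have "g \<circ> transpose x y = transpose (g x) (g y) \<circ> g" for x y
    using bij_is_inj[OF assms] by (auto simp: fun_eq_iff transpose_def inj_eq)
  then have "g \<circ> (transpose a b \<circ> transpose c d) = transpose (g a) (g b) \<circ> transpose (g c) (g d) \<circ> g"
    by (metis comp_assoc)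
  then show ?thesis using assms by (metis bij_is_surj comp_assoc comp_id surj_iff)
qed

text \<open>
  Two points are linked if some three-cycle in \<open>K\<close> maps one to the other.  For a subgroup \<open>K\<close> this is an
  equivalence relation invariant under \<open>K\<close>; a single class means that \<open>K\<close> is the alternating group.
\<close>

definition linked :: "(nat \<Rightarrow> nat) set \<Rightarrow> nat \<Rightarrow> nat \<Rightarrow> bool" where
  "linked K i j \<longleftrightarrow> i = j \<or> (\<exists>k. distinct [i, j, k] \<and> cycle_of_list [i, j, k] \<in> K)"

locale alt_subgroup =
  fixes n :: nat and K :: "(nat \<Rightarrow> nat) set"
  assumes sub: "subgroup K (alt_group n)"
begin

lemma comp_closed: "p \<in> K \<Longrightarrow> q \<in> K \<Longrightarrow> p \<circ> q \<in> K"
  using subgroup.m_closed[OF sub] by simp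

lemma inv_closed: "p \<in> K \<Longrightarrow> inv' p \<in> K"
  using subgroup.m_inv_closed[OF sub] alt_group_inv_equality[of p n] subgroup.mem_carrier[OF sub] by metis

lemma funpow_closed: "p \<in> K \<Longrightarrow> p ^^ i \<in> K"
proof (induction i)
  case 0
  show ?case using subgroup.one_closed[OF sub] by (simp add: alt_group_one id_def)
next
  case (Suc i) then show ?case unfolding funpow.simps by (intro comp_closed) blast+
qed

lemma conj_cycle_closed:
  assumes "g \<in> K" "cycle_of_list cs \<in> K" "distinct cs"
  shows "cycle_of_list (map g cs) \<in> K"
proof -
  have "bij g" using assms(1) subgroup.mem_carrier[OF sub] alt_group_bij by blast
  then show ?thesis
    using conjugation_of_cycle[OF assms(3), of g] comp_closed[OF comp_closed[OF assms(1,2)] inv_closed[OF assms(1)]]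
    by simp
qed

lemma bijK: "g \<in> K \<Longrightarrow> bij g"
  using subgroup.mem_carrier[OF sub] alt_group_bij by blast

lemma swap3:
  assumes "distinct [a, b, c]" "cycle_of_list [a, b, c] \<in> K"
  shows "cycle_of_list [a, c, b] \<in> K"
  using comp_closed[OF assms(2,2)] cycle3_square[OF assms(1)] by simp

lemma rot3:
  assumes "distinct [a, b, c]" "cycle_of_list [a, b, c] \<in> K"
  shows "cycle_of_list [b, c, a] \<in> K"
  using assms(2) unfolding cycle3_rotate[OF assms(1)] .

lemma linked_image:
  assumes "linked K i j" "g \<in> K"
  shows "linked K (g i) (g j)"
proof (cases "i = j")
  case False
  then obtain k where k: "distinct [i, j, k]" "cycle_of_list [i, j, k] \<in> K"
    using assms(1) by (auto simp: linked_def)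
  have "inj g" using bijK[OF assms(2)] by (rule bij_is_inj)
  then have "distinct [g i, g j, g k]" using k(1) by (auto dest: injD)
  then show ?thesis using conj_cycle_closed[OF assms(2) k(2,1)] unfolding linked_def by auto
qed (simp add: linked_def)

lemma linked_funpow:
  assumes "linked K i j" "g \<in> K"
  shows "linked K ((g ^^ m) i) ((g ^^ m) j)"
  using linked_image[OF assms(1) funpow_closed[OF assms(2)]] .

lemma linked_sym:
  assumes "linked K i j"
  shows "linked K j i"
proof (cases "i = j")
  case False
  then obtain k where k: "distinct [i, j, k]" "cycle_of_list [i, j, k] \<in> K"
    using assms by (auto simp: linked_def)
  have "cycle_of_list [i, k, j] \<in> K" using swap3[OF k] .
  then have "cycle_of_list [j, i, k] \<in> K" using rot3[of i k j] rot3[of k j i] k(1) by auto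
  then show ?thesis using k(1) unfolding linked_def by auto
qed (simp add: linked_def)

lemma linked_trans:
  assumes "linked K i j" "linked K j l"
  shows "linked K i l"
proof (cases "i = j \<or> j = l \<or> i = l")
  case True
  then show ?thesis using assms by (auto simp: linked_def)
next
  case False
  then obtain k m where k: "distinct [i, j, k]" "cycle_of_list [i, j, k] \<in> K"
    and m: "distinct [j, l, m]" "cycle_of_list [j, l, m] \<in> K"
    using assms by (auto simp: linked_def)
  show ?thesis
  proof (cases "l = k")
    case True
    then have "cycle_of_list [i, l, j] \<in> K" using swap3[OF k] by simp
    then show ?thesis using k(1) True unfolding linked_def by auto
  next
    case l: False
    define g where "g = cycle_of_list [i, k, j]"
    have g: "g \<in> K" unfolding g_def by (rule swap3[OF k])
    have "g j = i" "g l = l"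
      unfolding g_def using k(1) l False by (subst cycle3_apply; auto)+
    then show ?thesis using linked_image[OF assms(2) g] by simp
  qed
qed

text \<open>
  Inside a class every three points carry a three-cycle of \<open>K\<close>: a cycle through \<open>i\<close>, \<open>j\<close> and some \<open>l\<close> is
  conjugated by a three-cycle that moves \<open>l\<close> to \<open>k\<close>.
\<close>

lemma cycle3_of_linked:
  assumes d: "distinct [i, j, k]" and ij: "linked K i j" and jk: "linked K j k"
  shows "cycle_of_list [i, j, k] \<in> K"
proof -
  obtain l where l: "distinct [i, j, l]" "cycle_of_list [i, j, l] \<in> K"
    using ij d by (auto simp: linked_def)
  show ?thesis
  proof (cases "l = k")
    case False
    have "linked K j l" using rot3[OF l] l(1) unfolding linked_def by auto
    then have "linked K l k" using linked_trans[OF linked_sym jk] by blast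
    then obtain t where t: "distinct [l, k, t]" "cycle_of_list [l, k, t] \<in> K"
      using False by (auto simp: linked_def)
    have sq: "cycle_of_list [l, t, k] \<in> K" by (rule swap3[OF t])
    consider "t \<noteq> i" "t \<noteq> j" | "t = i" | "t = j" by blast
    then show ?thesis
    proof cases
      case 1
      have "map (cycle_of_list [l, k, t]) [i, j, l] = [i, j, k]"
        using 1 t(1) l(1) d unfolding list.map by (simp only: cycle3_apply[OF t(1)]) auto
      then show ?thesis using conj_cycle_closed[OF t(2) l(2,1)] by simp
    next
      case 2
      have td: "distinct [l, t, k]" using t(1) by auto
      have "map (cycle_of_list [l, t, k]) [i, j, l] = [k, j, i]"
        using 2 t(1) l(1) d unfolding list.map by (simp only: cycle3_apply[OF td]) auto
      then have "cycle_of_list [k, j, i] \<in> K" using conj_cycle_closed[OF sq l(2,1)] by simp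
      then have "cycle_of_list [k, i, j] \<in> K" using swap3[of k j i] d by auto
      then show ?thesis using rot3[of k i j] d by auto
    next
      case 3
      have td: "distinct [l, t, k]" using t(1) by auto
      have "map (cycle_of_list [l, t, k]) [i, j, l] = [i, k, j]"
        using 3 t(1) l(1) d unfolding list.map by (simp only: cycle3_apply[OF td]) auto
      then have "cycle_of_list [i, k, j] \<in> K" using conj_cycle_closed[OF sq l(2,1)] by simp
      then show ?thesis using swap3[of i k j] d by auto
    qed
  qed (use l in simp)
qed

lemma all_if_linked:
  assumes "\<And>i. i \<in> {1..n} \<Longrightarrow> linked K a i"
  shows "K = carrier (alt_group n)"
proof -
  interpret A: group "alt_group n" by (rule alt_group_is_group)
  have "three_cycles n \<subseteq> K"
  proof
    fix p assume "p \<in> three_cycles n"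
    then obtain cs where cs: "p = cycle_of_list cs" "distinct cs" "length cs = 3" "set cs \<subseteq> {1..n}" by blast
    then obtain i j k where ijk: "cs = [i, j, k]" using stupid_lemma by blast
    have "i \<in> {1..n}" "j \<in> {1..n}" "k \<in> {1..n}" using cs(4) ijk by auto
    then have l: "linked K a i" "linked K a j" "linked K a k" using assms by blast+
    have "cycle_of_list [i, j, k] \<in> K"
      by (rule cycle3_of_linked[OF _ linked_trans[OF linked_sym[OF l(1)] l(2)]
            linked_trans[OF linked_sym[OF l(2)] l(3)]]) (use cs(2) ijk in simp)
    then show "p \<in> K" unfolding cs(1) ijk .
  qed
  then have "carrier (alt_group n) \<subseteq> K"
    unfolding alt_group_carrier_as_three_cycles by (rule A.generate_subgroup_incl[OF _ sub])
  then show ?thesis using subgroup.subset[OF sub] by blast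
qed

text \<open>
  Conjugation by \<open>w\<close> changes only one point of the double transposition, so the product of the double
  transposition with its conjugate is the three-cycle on \<open>p\<close>, \<open>q\<close>, \<open>q'\<close>.
\<close>

lemma linked_by_double_transpositions:
  assumes K: "transpose p q \<circ> transpose r s \<in> K" "w \<in> K"
    and w: "w p = q'" "w q = q" "w r = r" "w s = s" and d: "distinct [p, q, q', r, s]"
  shows "linked K p q" "linked K p q'"
proof -
  have "w \<circ> (transpose p q \<circ> transpose r s) \<circ> inv' w = transpose (w p) (w q) \<circ> transpose (w r) (w s)"
    by (rule conj_double_transposition[OF bijK[OF K(2)]])
  then have "transpose q' q \<circ> transpose r s \<in> K"
    using comp_closed[OF comp_closed[OF K(2,1)] inv_closed[OF K(2)]] unfolding w by (simp only:)
  then have "transpose p q \<circ> transpose r s \<circ> (transpose q' q \<circ> transpose r s) \<in> K"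
    by (rule comp_closed[OF K(1)])
  also note cycle3_products(5)[OF d]
  finally have 1: "cycle_of_list [p, q, q'] \<in> K" .
  have d3: "distinct [p, q, q']" "distinct [p, q', q]" using d by auto
  show "linked K p q" using 1 d3(1) unfolding linked_def by blast
  show "linked K p q'" using swap3[OF d3(1) 1] d3(2) unfolding linked_def by blast
qed

end

section \<open>Alternating groups are simple\<close>

context
  fixes n :: nat and K :: "(nat \<Rightarrow> nat) set"
  assumes n: "n \<ge> 5" and nrm: "K \<lhd> alt_group n"
begin

interpretation K: alt_subgroup n K
  by (rule alt_subgroup.intro) (rule normal_imp_subgroup[OF nrm])

lemma normal_conj:
  assumes "g \<in> carrier (alt_group n)" "p \<in> K"
  shows "g \<circ> p \<circ> inv' g \<in> K"
  using normal.inv_op_closed2[OF nrm assms] alt_group_inv_equality[OF assms(1)] by simp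

lemma fresh:
  assumes "finite A" "card A \<le> 4"
  obtains f where "f \<in> {1..n}" "f \<notin> A"
proof -
  have "\<not> {1..n} \<subseteq> A"
    using card_mono[OF assms(1), of "{1..n}"] assms(2) n by auto
  then show ?thesis using that by blast
qed

lemma all_if_cycle3:
  assumes c: "cycle_of_list [a, b, c] \<in> K" "distinct [a, b, c]" "{a, b, c} \<subseteq> {1..n}"
  shows "K = carrier (alt_group n)"
proof (rule K.all_if_linked[of a])
  fix i assume i: "i \<in> {1..n}"
  show "linked K a i"
  proof (cases "i \<in> {a, b, c}")
    case True
    then show ?thesis using c K.swap3[OF c(2,1)] unfolding linked_def by auto
  next
    case False
    obtain x where x: "x \<in> {1..n}" "x \<notin> {a, b, c, i}"
      using fresh[of "{a, b, c, i}"] card_length[of "[a, b, c, i]"] by auto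
    have d: "distinct [b, i, x]" using False x(2) c(2) by auto
    let ?h = "cycle_of_list [b, i, x]"
    have h: "?h \<in> carrier (alt_group n)"
      by (rule cycle3_in_alt_group[OF d]) (use c(3) i x(1) in auto)
    have "map ?h [a, b, c] = [a, i, c]"
      using False x(2) c(2) unfolding list.map by (simp only: cycle3_apply[OF d]) auto
    then have "cycle_of_list [a, i, c] \<in> K"
      using normal_conj[OF h c(1)] conjugation_of_cycle[OF c(2) alt_group_bij[OF h]] by simp
    then show ?thesis using False c(2) unfolding linked_def by auto
  qed
qed

lemma all_if_double_transposition:
  assumes K: "transpose a b \<circ> transpose c d \<in> K" and d: "distinct [a, b, c, d]" "{a, b, c, d} \<subseteq> {1..n}"
  shows "K = carrier (alt_group n)"
proof -
  obtain f where f: "f \<in> {1..n}" "f \<notin> {a, b, c, d}"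
    using fresh[of "{a, b, c, d}"] card_length[of "[a, b, c, d]"] by auto
  have d3: "distinct [a, b, f]" using d f(2) by auto
  let ?h = "cycle_of_list [a, b, f]"
  have h: "?h \<in> carrier (alt_group n)" by (rule cycle3_in_alt_group[OF d3]) (use d(2) f(1) in auto)
  have bij: "bij ?h" by (rule alt_group_bij[OF h])
  have "?h a = b" "?h b = f" "?h c = c" "?h d = d"
    using d(1) f(2) by (auto simp: transpose_def)
  then have "?h \<circ> (transpose a b \<circ> transpose c d) \<circ> inv' ?h = transpose b f \<circ> transpose c d"
    using conj_double_transposition[OF bij, of a b c d] by simp
  then have "transpose b f \<circ> transpose c d \<in> K" using normal_conj[OF h K] by simp
  then have prod: "(transpose a b \<circ> transpose c d) \<circ> (transpose b f \<circ> transpose c d) \<in> K"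
    by (rule K.comp_closed[OF K])
  have "distinct [a, b, f, c, d]" using d(1) f(2) by auto
  then have "?h \<in> K"
    using prod cycle3_products(5)[of a b f c d] by (simp only: transpose_commute[of f b])
  then show ?thesis by (rule all_if_cycle3[OF _ d3]) (use d(2) f(1) in auto)
qed

text \<open>The commutator of \<open>g\<close> with a three-cycle.\<close>

lemma commutator_in_K:
  assumes g: "g \<in> K" and d: "distinct [a, b, d]" "{a, b, d} \<subseteq> {1..n}"
  shows "cycle_of_list [g a, g b, g d] \<circ> cycle_of_list [a, d, b] \<in> K"
proof -
  let ?c = "cycle_of_list [a, b, d]"
  have c: "?c \<in> carrier (alt_group n)" by (rule cycle3_in_alt_group[OF d])
  have "inv' g \<in> K" using g by (rule K.inv_closed)
  then have "?c \<circ> inv' g \<circ> inv' ?c \<in> K" by (rule normal_conj[OF c])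
  then have "g \<circ> (?c \<circ> inv' g \<circ> inv' ?c) \<in> K" using g by (rule K.comp_closed[rotated])
  then have 1: "(g \<circ> ?c \<circ> inv' g) \<circ> inv' ?c \<in> K" unfolding o_assoc .
  have 2: "g \<circ> ?c \<circ> inv' g = cycle_of_list [g a, g b, g d]"
    using conjugation_of_cycle[OF d(1) K.bijK[OF g]] unfolding list.map .
  show ?thesis using 1 unfolding 2 cycle3_inverse[OF d(1)] .
qed

lemma permutesK: "g \<in> K \<Longrightarrow> g permutes {1..n}"
  using subgroup.mem_carrier[OF K.sub, of g] by (simp add: alt_group_carrier)

lemma in_range: "g \<in> K \<Longrightarrow> x \<in> {1..n} \<Longrightarrow> g x \<in> {1..n}"
  using permutes_in_image[OF permutesK, of g x] by simp

lemma moved_in_range: "g \<in> K \<Longrightarrow> g x \<noteq> x \<Longrightarrow> x \<in> {1..n}"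
  using permutes_not_in[OF permutesK, of g x] by blast

lemma all_if_long_cycle:
  assumes g: "g \<in> K" and d: "distinct [d, a, g a, g (g a)]" "g d = a"
  shows "K = carrier (alt_group n)"
proof -
  have "d \<in> {1..n}" "a \<in> {1..n}" "g a \<in> {1..n}"
    using moved_in_range[OF g, of d] moved_in_range[OF g, of a] moved_in_range[OF g, of "g a"] d by auto
  then have r: "{d, a, g a, g (g a)} \<subseteq> {1..n}" using in_range[OF g, of "g a"] by simp
  have "cycle_of_list [g a, g (g a), g d] \<circ> cycle_of_list [a, d, g a] \<in> K"
    by (rule commutator_in_K[OF g]) (use d r in auto)
  also have "cycle_of_list [g a, g (g a), g d] \<circ> cycle_of_list [a, d, g a] = cycle_of_list [a, d, g (g a)]"
    unfolding d(2) by (rule cycle3_products(4)[OF d(1)])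
  finally show ?thesis by (rule all_if_cycle3) (use d r in auto)
qed

text \<open>
  Unless \<open>g\<close> itself has a cycle of length at least four, its commutator with a suitable three-cycle is a
  three-cycle, a double transposition or an element with such a cycle.  In each case the normal closure is everything.
\<close>

lemma normal_nontrivial_all:
  assumes g: "g \<in> K" "g \<noteq> id"
  shows "K = carrier (alt_group n)"
proof -
  have inj: "inj g" using K.bijK[OF g(1)] by (rule bij_is_inj)
  obtain a where a: "g a \<noteq> a" using g(2) by (auto simp: fun_eq_iff)
  show ?thesis
  proof (cases "\<exists>a. g a \<noteq> a \<and> g (g a) \<noteq> a")
    case True
    then obtain a where a: "g a \<noteq> a" "g (g a) \<noteq> a" by blast
    define b c where "b = g a" and "c = g b"
    have abc: "distinct [a, b, c]" "{a, b, c} \<subseteq> {1..n}"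
      using a inj moved_in_range[OF g(1), of a] in_range[OF g(1)] by (auto simp: b_def c_def dest: injD)
    show ?thesis
    proof (cases "g c = a")
      case False
      obtain d where d: "g d = a" using K.bijK[OF g(1)] by (metis bij_pointE)
      have "distinct [d, a, g a, g (g a)]"
        using d a False abc unfolding b_def c_def by auto
      then show ?thesis by (rule all_if_long_cycle[OF g(1) _ d])
    next
      case True
      obtain d where d: "d \<in> {1..n}" "d \<notin> {a, b, c}"
        using fresh[of "{a, b, c}"] card_length[of "[a, b, c]"] by auto
      define e where "e = g d"
      have e: "e \<notin> {a, b, c}" unfolding e_def using d(2) True b_def c_def injD[OF inj, of d] by auto
      have eR: "e \<in> {1..n}" unfolding e_def by (rule in_range[OF g(1) d(1)])
      have abd: "distinct [a, b, d]" "{a, b, d} \<subseteq> {1..n}" using abc d by auto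
      have h: "cycle_of_list [b, c, e] \<circ> cycle_of_list [a, d, b] \<in> K"
        using commutator_in_K[OF g(1) abd] unfolding c_def e_def by (simp only: b_def)
      have d3: "distinct [b, c, e]" "distinct [a, d, b]" using e d(2) abc(1) by auto
      show ?thesis
      proof (cases "e = d")
        case True
        have dd: "distinct [a, b, c, d]" using d(2) abc(1) by auto
        have "cycle_of_list [b, c, e] \<circ> cycle_of_list [a, d, b] = transpose a b \<circ> transpose c d"
          unfolding True by (rule cycle3_products(1)[OF dd])
        from h[unfolded this] show ?thesis by (rule all_if_double_transposition) (use d abc in auto)
      next
        case False
        let ?h = "cycle_of_list [b, c, e] \<circ> cycle_of_list [a, d, b]"
        have v: "?h b = a" "?h a = d" "?h d = c"
          unfolding o_apply cycle3_apply[OF d3(1)] cycle3_apply[OF d3(2)]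
          using False d(2) e abc(1) by auto
        show ?thesis
          by (rule all_if_long_cycle[OF h _ v(1)]) (unfold v, use abc(1) d(2) in auto)
      qed
    qed
  next
    case False
    define b where "b = g a"
    have ab: "g b = a" "a \<noteq> b" using False a by (auto simp: b_def)
    have R: "a \<in> {1..n}" "b \<in> {1..n}" using moved_in_range[OF g(1)] a ab by auto
    obtain d where d: "d \<in> {1..n}" "d \<notin> {a, b}"
      using fresh[of "{a, b}"] card_length[of "[a, b]"] by auto
    define e where "e = g d"
    have e: "e \<notin> {a, b}" unfolding e_def using d(2) ab(1) b_def injD[OF inj, of d] by auto
    have eR: "e \<in> {1..n}" unfolding e_def by (rule in_range[OF g(1) d(1)])
    have abd: "distinct [a, b, d]" "{a, b, d} \<subseteq> {1..n}" using ab R d by auto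
    have h: "cycle_of_list [b, a, e] \<circ> cycle_of_list [a, d, b] \<in> K"
      using commutator_in_K[OF g(1) abd] unfolding ab(1) e_def b_def[symmetric] .
    have d3: "distinct [b, a, e]" "distinct [a, d, b]" using e d(2) ab(2) by auto
    show ?thesis
    proof (cases "e = d")
      case True
      have "cycle_of_list [b, a, e] \<circ> cycle_of_list [a, d, b] = cycle_of_list [a, b, d]"
        unfolding True by (rule cycle3_products(3)[OF abd(1)])
      from h[unfolded this] show ?thesis by (rule all_if_cycle3) (use d R ab in auto)
    next
      case False
      have dd: "distinct [a, b, d, e]" using d(2) e ab(2) False by auto
      have "cycle_of_list [b, a, e] \<circ> cycle_of_list [a, d, b] = transpose a d \<circ> transpose b e"
        by (rule cycle3_products(2)[OF dd])
      from h[unfolded this] show ?thesis by (rule all_if_double_transposition) (use d e eR R ab False in auto)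
    qed
  qed
qed

end

lemma finite_alt_group: "finite (carrier (alt_group n))"
proof (rule finite_subset)
  show "carrier (alt_group n) \<subseteq> {p. p permutes {1..n}}" by (auto simp: alt_group_carrier)
qed (simp add: finite_permutations)

theorem simple_alt_group:
  assumes "n \<ge> 5"
  shows "simple_group (alt_group n)"
proof -
  interpret group "alt_group n" by (rule alt_group_is_group)
  have c: "cycle_of_list [1, 2, 3] \<in> carrier (alt_group n)"
    using assms by (intro cycle3_in_alt_group) auto
  have "cycle_of_list [1, 2, 3 :: nat] 1 \<noteq> id 1" by (simp add: transpose_def)
  then have ne: "cycle_of_list [1, 2, 3 :: nat] \<noteq> id" by metis
  show ?thesis
  proof unfold_locales
    have "card {id, cycle_of_list [1, 2, 3 :: nat]} \<le> card (carrier (alt_group n))"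
      by (rule card_mono[OF finite_alt_group]) (use c one_closed in \<open>auto simp: alt_group_one\<close>)
    then show "1 < order (alt_group n)" using ne by (simp add: order_def)
    fix K assume K: "K \<lhd> alt_group n"
    show "K = carrier (alt_group n) \<or> K = {\<one>\<^bsub>alt_group n\<^esub>}"
    proof (cases "\<exists>g\<in>K. g \<noteq> id")
      case True
      then show ?thesis using normal_nontrivial_all[OF assms K] by blast
    next
      case False
      then show ?thesis
        using subgroup.one_closed[OF normal_imp_subgroup[OF K]] by (auto simp: alt_group_one)
    qed
  qed
qed

lemma nonabelian_alt_group:
  assumes "n \<ge> 5"
  shows "\<not> comm_group (alt_group n)"
proof
  assume "comm_group (alt_group n)"
  then interpret comm_group "alt_group n" .
  have c: "cycle_of_list [1, 2, 3] \<in> carrier (alt_group n)" "cycle_of_list [1, 2, 4] \<in> carrier (alt_group n)"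
    using assms by (intro cycle3_in_alt_group; auto)+
  have "(cycle_of_list [1, 2, 3] \<circ> cycle_of_list [1, 2, 4 :: nat]) 1 = (cycle_of_list [1, 2, 4] \<circ> cycle_of_list [1, 2, 3 :: nat]) 1"
    using m_comm[OF c] by simp
  then show False by (simp add: transpose_def)
qed

section \<open>Products of two disjoint cycles\<close>

lemma cycle_of_list_append:
  assumes "distinct (xs @ ys)" "xs \<noteq> []" "ys \<noteq> []"
  shows "cycle_of_list (xs @ ys) = transpose (hd xs) (hd ys) \<circ> cycle_of_list xs \<circ> cycle_of_list ys"
  using assms
proof (induction xs rule: cycle_of_list.induct)
  case (1 i j cs)
  have t: "transpose i j \<circ> transpose j (hd ys) = transpose i (hd ys) \<circ> transpose i j"
    using 1(2,4) by (cases ys) (auto simp: fun_eq_iff transpose_def)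
  have "cycle_of_list ((i # j # cs) @ ys) = transpose i j \<circ> cycle_of_list ((j # cs) @ ys)" by simp
  also have "cycle_of_list ((j # cs) @ ys) = transpose (hd (j # cs)) (hd ys) \<circ> cycle_of_list (j # cs) \<circ> cycle_of_list ys"
    by (rule 1(1)) (use 1(2-) in auto)
  also have "transpose i j \<circ> (transpose (hd (j # cs)) (hd ys) \<circ> cycle_of_list (j # cs) \<circ> cycle_of_list ys)
      = transpose i j \<circ> (transpose j (hd ys) \<circ> cycle_of_list (j # cs) \<circ> cycle_of_list ys)" by simp
  also have "\<dots> = transpose i (hd ys) \<circ> transpose i j \<circ> cycle_of_list (j # cs) \<circ> cycle_of_list ys"
    by (simp only: o_assoc t)
  finally show ?case by (simp only: cycle_of_list.simps(1) list.sel(1) o_assoc)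
next
  case ("2_2" v)
  then show ?case by (cases ys) auto
qed simp

lemma cycle_of_list_nth:
  assumes "distinct cs" "i < length cs"
  shows "cycle_of_list cs (cs ! i) = cs ! (Suc i mod length cs)"
proof -
  have "cs \<noteq> []" using assms(2) by auto
  have "map (cycle_of_list cs) cs = rotate1 cs"
    using cyclic_rotation[OF assms(1), of 1] by simp
  then have "cycle_of_list cs (cs ! i) = rotate1 cs ! i" using assms(2) by (metis nth_map)
  also have "\<dots> = cs ! (Suc i mod length cs)" using nth_rotate1[OF assms(2)] .
  finally show ?thesis .
qed

lemma two_cycles_funpow:
  fixes as bs defines "p \<equiv> cycle_of_list as \<circ> cycle_of_list bs"
  assumes d: "distinct (as @ bs)"
  shows "i < length as \<Longrightarrow> (p ^^ m) (as ! i) = as ! ((i + m) mod length as)"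
    and "i < length bs \<Longrightarrow> (p ^^ m) (bs ! i) = bs ! ((i + m) mod length bs)"
    and "x \<notin> set (as @ bs) \<Longrightarrow> (p ^^ m) x = x"
proof -
  have pa: "p (as ! i) = as ! (Suc i mod length as)" if "i < length as" for i
  proof -
    have "as ! i \<notin> set bs" using d nth_mem[OF that] by auto
    then show ?thesis using cycle_of_list_nth[of as i] that d by (simp add: p_def id_outside_supp)
  qed
  have pb: "p (bs ! i) = bs ! (Suc i mod length bs)" if "i < length bs" for i
  proof -
    have "Suc i mod length bs < length bs" using that by (intro mod_less_divisor) linarith
    then have "bs ! (Suc i mod length bs) \<notin> set as" using d nth_mem by auto
    then show ?thesis using cycle_of_list_nth[of bs i] that d by (simp add: p_def id_outside_supp)
  qed
  show "(p ^^ m) (as ! i) = as ! ((i + m) mod length as)" if i: "i < length as"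
  proof (induction m)
    case (Suc m)
    have "(i + m) mod length as < length as" using i by (intro mod_less_divisor) linarith
    then show ?case using Suc pa by (simp add: mod_Suc_eq)
  qed (use i in simp)
  show "(p ^^ m) (bs ! i) = bs ! ((i + m) mod length bs)" if i: "i < length bs"
  proof (induction m)
    case (Suc m)
    have "(i + m) mod length bs < length bs" using i by (intro mod_less_divisor) linarith
    then show ?case using Suc pb by (simp add: mod_Suc_eq)
  qed (use i in simp)
  show "(p ^^ m) x = x" if x: "x \<notin> set (as @ bs)"
    using x by (induction m) (simp_all add: p_def id_outside_supp)
qed

lemma two_cycles_funpow_fix:
  fixes as bs defines "p \<equiv> cycle_of_list as \<circ> cycle_of_list bs"
  assumes d: "distinct (as @ bs)"
  shows "x \<in> set as \<Longrightarrow> (p ^^ m) x = x \<longleftrightarrow> length as dvd m"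
    and "x \<in> set bs \<Longrightarrow> (p ^^ m) x = x \<longleftrightarrow> length bs dvd m"
proof -
  have mod: "(i + m) mod l = i \<longleftrightarrow> l dvd m" if "i < l" for i l :: nat
  proof -
    have "(i + m) mod l = i mod l \<longleftrightarrow> l dvd (i + m) - i" by (rule mod_eq_dvd_iff_nat) simp
    then show ?thesis using that by simp
  qed
  show "(p ^^ m) x = x \<longleftrightarrow> length as dvd m" if x: "x \<in> set as"
  proof -
    obtain i where i: "i < length as" "x = as ! i" using x by (auto simp: in_set_conv_nth)
    have "(i + m) mod length as < length as" using i(1) by (intro mod_less_divisor) linarith
    then show ?thesis
      using two_cycles_funpow(1)[OF d i(1), of m] mod[OF i(1)] i d
      by (simp add: p_def nth_eq_iff_index_eq)
  qed
  show "(p ^^ m) x = x \<longleftrightarrow> length bs dvd m" if x: "x \<in> set bs"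
  proof -
    obtain i where i: "i < length bs" "x = bs ! i" using x by (auto simp: in_set_conv_nth)
    have "(i + m) mod length bs < length bs" using i(1) by (intro mod_less_divisor) linarith
    then show ?thesis
      using two_cycles_funpow(2)[OF d i(1), of m] mod[OF i(1)] i d
      by (simp add: p_def nth_eq_iff_index_eq)
  qed
qed

lemma two_cycles_funpow_id:
  assumes "distinct (as @ bs)" "as \<noteq> []" "bs \<noteq> []"
  shows "(cycle_of_list as \<circ> cycle_of_list bs) ^^ m = id \<longleftrightarrow> lcm (length as) (length bs) dvd m"
proof -
  have "(cycle_of_list as \<circ> cycle_of_list bs) ^^ m = id \<longleftrightarrow>
      (\<forall>x. ((cycle_of_list as \<circ> cycle_of_list bs) ^^ m) x = x)" by (simp add: fun_eq_iff)
  also have "\<dots> \<longleftrightarrow> length as dvd m \<and> length bs dvd m"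
  proof
    assume *: "\<forall>x. ((cycle_of_list as \<circ> cycle_of_list bs) ^^ m) x = x"
    show "length as dvd m \<and> length bs dvd m"
      using two_cycles_funpow_fix[OF assms(1), of _ m] * assms(2,3) by (metis hd_in_set)
  next
    assume *: "length as dvd m \<and> length bs dvd m"
    show "\<forall>x. ((cycle_of_list as \<circ> cycle_of_list bs) ^^ m) x = x"
    proof
      fix x show "((cycle_of_list as \<circ> cycle_of_list bs) ^^ m) x = x"
        using two_cycles_funpow_fix[OF assms(1), of x m] two_cycles_funpow(3)[OF assms(1), of x m] *
        by (cases "x \<in> set as"; cases "x \<in> set bs") auto
    qed
  qed
  finally show ?thesis by simp
qed

lemma cycle_funpow_id:
  assumes "distinct as" "as \<noteq> []"
  shows "cycle_of_list as ^^ m = id \<longleftrightarrow> length as dvd m"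
proof -
  have out: "(cycle_of_list as ^^ m) x = x" if "x \<notin> set as" for x
    using two_cycles_funpow(3)[of as "[]" x m] assms(1) that by simp
  have all: "(cycle_of_list as ^^ m) x = x \<longleftrightarrow> length as dvd m" if "x \<in> set as" for x
    using two_cycles_funpow_fix(1)[of as "[]" x m] assms(1) that by simp
  show ?thesis using all out assms(2) by (metis eq_id_iff hd_in_set)
qed

lemma evenperm_cycle:
  assumes "distinct cs" "cs \<noteq> []"
  shows "evenperm (cycle_of_list cs) \<longleftrightarrow> odd (length cs)"
proof -
  have "swapidseq (length cs - 1) (cycle_of_list cs)"
    using swapidseq_ext_imp_swapidseq[OF swapidseq_ext_of_cycles[OF assms(1)]] .
  then have "evenperm (cycle_of_list cs) \<longleftrightarrow> even (length cs - 1)" by (simp add: evenperm_unique)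
  then show ?thesis using assms(2) by (cases cs) auto
qed

lemma alt_group_pow: "p [^]\<^bsub>alt_group n\<^esub> (m :: nat) = p ^^ m"
proof (induction m)
  case 0
  show ?case by (simp add: alt_group_one)
next
  case (Suc m)
  interpret group "alt_group n" by (rule alt_group_is_group)
  show ?case unfolding nat_pow_Suc Suc by (simp add: funpow_swap1 fun_eq_iff)
qed

lemma alt_ord_eqI:
  assumes "p \<in> carrier (alt_group n)" "\<And>m. p ^^ m = id \<longleftrightarrow> d dvd m"
  shows "group.ord (alt_group n) p = d"
proof -
  interpret group "alt_group n" by (rule alt_group_is_group)
  show ?thesis using ord_unique[OF assms(1), of d] assms(2) by (simp add: alt_group_pow alt_group_one)
qed

lemma alt_int_pow_is_funpow:
  assumes "p \<in> carrier (alt_group n)"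
  shows "\<exists>m. p [^]\<^bsub>alt_group n\<^esub> (i :: int) = p ^^ m"
proof -
  interpret group "alt_group n" by (rule alt_group_is_group)
  have pos: "ord p > 0" using ord_ge_1[OF finite_alt_group assms] by simp
  have "p [^]\<^bsub>alt_group n\<^esub> i = p [^]\<^bsub>alt_group n\<^esub> (i mod int (ord p))"
    using int_pow_eq[OF assms, of i "i mod int (ord p)"]
    by (simp add: mod_eq_dvd_iff[symmetric])
  also have "\<dots> = p ^^ nat (i mod int (ord p))"
    using int_pow_int[of "alt_group n" p "nat (i mod int (ord p))"] pos by (simp add: alt_group_pow)
  finally show ?thesis by blast
qed

section \<open>Disjoint conjugacy classes of powers\<close>

lemma (in group) conj_disjoint_coprime:
  assumes "x \<in> carrier G" "y \<in> carrier G" "coprime (ord x) (ord y)"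
  shows "conj_disjoint G x y"
  unfolding conj_disjoint_def
proof (intro allI impI notI)
  fix i j :: int
  assume ne: "x [^] i \<noteq> \<one>" and conj: "conjugate_in G (x [^] i) (y [^] j)"
  have c: "x [^] i \<in> carrier G" using assms(1) by simp
  have "(x [^] i) [^] int (ord x) = \<one>"
    using int_pow_pow[OF assms(1), of i "int (ord x)"] int_pow_eq_id[OF assms(1)] by simp
  then have 1: "ord (x [^] i) dvd ord x" using int_pow_eq_id[OF c] by simp
  have "(y [^] j) [^] int (ord y) = \<one>"
    using int_pow_pow[OF assms(2), of j "int (ord y)"] int_pow_eq_id[OF assms(2)] by simp
  then have "(x [^] i) [^] int (ord y) = \<one>"
    using conjugate_one_iff[OF conjugate_pow[OF conj c]] c by simp
  then have 2: "ord (x [^] i) dvd ord y" using int_pow_eq_id[OF c] by simp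
  have "ord (x [^] i) = 1" using 1 2 assms(3) by (meson coprime_common_divisor_nat)
  then show False using ord_eq_1[OF c] ne by simp
qed

text \<open>
  Conjugate permutations fix equally many points: every power of \<open>x\<close> fixes many, a nontrivial power of \<open>y\<close>
  only few.
\<close>

lemma conj_disjoint_fixed_points:
  assumes x: "x \<in> carrier (alt_group n)" and y: "y \<in> carrier (alt_group n)"
    and fx: "\<And>m. card {i \<in> {1..n}. (x ^^ m) i = i} \<ge> k"
    and fy: "\<And>m. card {i \<in> {1..n}. (y ^^ m) i = i} \<ge> k \<Longrightarrow> y ^^ m = id"
  shows "conj_disjoint (alt_group n) x y"
  unfolding conj_disjoint_def
proof (intro allI impI notI)
  interpret group "alt_group n" by (rule alt_group_is_group)
  fix i j :: int
  assume ne: "x [^]\<^bsub>alt_group n\<^esub> i \<noteq> \<one>\<^bsub>alt_group n\<^esub>"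
    and conj: "conjugate_in (alt_group n) (x [^]\<^bsub>alt_group n\<^esub> i) (y [^]\<^bsub>alt_group n\<^esub> j)"
  obtain m l where m: "x [^]\<^bsub>alt_group n\<^esub> i = x ^^ m" and l: "y [^]\<^bsub>alt_group n\<^esub> j = y ^^ l"
    using alt_int_pow_is_funpow x y by meson
  obtain g where g: "g \<in> carrier (alt_group n)" "g \<circ> (x ^^ m) \<circ> inv' g = y ^^ l"
    using conj unfolding conjugate_in_def m l by (auto simp: alt_group_inv_equality)
  have gp: "g permutes {1..n}" using g(1) by (simp add: alt_group_carrier)
  have "g ` {i \<in> {1..n}. (x ^^ m) i = i} \<subseteq> {i \<in> {1..n}. (y ^^ l) i = i}"
  proof
    fix z assume "z \<in> g ` {i \<in> {1..n}. (x ^^ m) i = i}"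
    then obtain w where w: "w \<in> {1..n}" "(x ^^ m) w = w" "z = g w" by blast
    have "(y ^^ l) (g w) = g ((x ^^ m) (inv' g (g w)))" unfolding g(2)[symmetric] by simp
    then have "(y ^^ l) z = z" using w by (simp add: permutes_inverses[OF gp])
    moreover have "z \<in> {1..n}" using permutes_in_image[OF gp, of w] w by simp
    ultimately show "z \<in> {i \<in> {1..n}. (y ^^ l) i = i}" by simp
  qed
  then have "card {i \<in> {1..n}. (x ^^ m) i = i} \<le> card {i \<in> {1..n}. (y ^^ l) i = i}"
    by (intro card_inj_on_le[of g]) (auto intro: inj_on_subset[OF permutes_inj[OF gp]])
  then have "y ^^ l = id" using fx[of m] fy by (meson le_trans)
  then have "x [^]\<^bsub>alt_group n\<^esub> i = \<one>\<^bsub>alt_group n\<^esub>"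
    using conjugate_one_iff[OF conj int_pow_closed[OF x]] l by (simp add: alt_group_one)
  then show False using ne by simp
qed

section \<open>The triples containing a three-cycle\<close>

lemma alt_gen_rowI:
  assumes "x \<in> carrier (alt_group n)" "y \<in> carrier (alt_group n)"
    and "\<And>K. alt_subgroup n K \<Longrightarrow> x \<in> K \<Longrightarrow> y \<in> K \<Longrightarrow> \<exists>a. \<forall>i\<in>{1..n}. linked K a i"
  shows "gen_row (alt_group n) (x, y)"
proof -
  interpret group "alt_group n" by (rule alt_group_is_group)
  show ?thesis
    unfolding gen_row_def fst_conv snd_conv
  proof (rule gen_pair_subgroup[OF assms(1,2)])
    fix K assume K: "subgroup K (alt_group n)" "x \<in> K" "y \<in> K"
    interpret K: alt_subgroup n K by (rule alt_subgroup.intro[OF K(1)])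
    obtain a where "\<forall>i\<in>{1..n}. linked K a i"
      using assms(3)[OF K.alt_subgroup_axioms K(2,3)] by blast
    then show "K = carrier (alt_group n)" by (intro K.all_if_linked) blast
  qed
qed

lemma alt_entry_ord:
  assumes "x \<in> carrier (alt_group n)" "y \<in> carrier (alt_group n)"
    and "\<And>m. x ^^ m = id \<longleftrightarrow> a dvd m" "\<And>m. y ^^ m = id \<longleftrightarrow> b dvd m" "\<And>m. (x \<circ> y) ^^ m = id \<longleftrightarrow> c dvd m"
  shows "entry_ord (alt_group n) 0 (x, y) = a" "entry_ord (alt_group n) 1 (x, y) = b"
    "entry_ord (alt_group n) 2 (x, y) = c"
proof -
  interpret group "alt_group n" by (rule alt_group_is_group)
  have xy: "x \<circ> y \<in> carrier (alt_group n)" using m_closed[OF assms(1,2)] by simp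
  show "entry_ord (alt_group n) 0 (x, y) = a" "entry_ord (alt_group n) 1 (x, y) = b"
    using alt_ord_eqI[OF assms(1,3)] alt_ord_eqI[OF assms(2,4)] by (simp_all add: entry_ord_def entry_simps)
  show "entry_ord (alt_group n) 2 (x, y) = c"
    using alt_ord_eqI[OF xy assms(5)] xy by (simp add: entry_ord_def entry_simps)
qed

lemma cycle_in_alt_group:
  assumes "distinct cs" "set cs \<subseteq> {1..n}" "odd (length cs)"
  shows "cycle_of_list cs \<in> carrier (alt_group n)"
proof -
  have "cs \<noteq> []" using assms(3) by auto
  then show ?thesis
    using permutes_subset[OF cycle_permutes assms(2)] evenperm_cycle[OF assms(1)] assms(3)
    by (simp add: alt_group_carrier)
qed

lemma nth_upt_Suc: "i < n \<Longrightarrow> [1..<Suc n] ! i = Suc i"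
  by (simp del: upt_Suc)

text \<open>
  The product of the three-cycle with the cycle on \<open>3, ..., n\<close> is the cycle on all points, and its powers
  carry the link between \<open>1\<close> and \<open>2\<close> along the whole cycle.
\<close>

lemma three_cycle_row_odd:
  assumes n: "odd n" "n \<ge> 7"
  shows "\<exists>x y. gen_row (alt_group n) (x, y) \<and> x = cycle_of_list [1, 2, 3]
    \<and> entry_ord (alt_group n) 0 (x, y) = 3 \<and> entry_ord (alt_group n) 1 (x, y) = n - 2
    \<and> entry_ord (alt_group n) 2 (x, y) = n"
proof -
  let ?x = "cycle_of_list [1, 2, 3 :: nat]" and ?y = "cycle_of_list [3..<Suc n]" and ?z = "cycle_of_list [1..<Suc n]"
  have upt: "[1..<Suc n] = 1 # 2 # [3..<Suc n]" using n(2) by (simp add: upt_conv_Cons numeral_2_eq_2 numeral_3_eq_3 del: upt_Suc)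
  have upt3: "[3..<Suc n] = 3 # [4..<Suc n]" using n(2) by (simp add: upt_conv_Cons del: upt_Suc)
  have prod: "?x \<circ> ?y = ?z" unfolding upt unfolding upt3 by (simp add: fun_eq_iff)
  have x: "?x \<in> carrier (alt_group n)" using n by (intro cycle3_in_alt_group) auto
  have y: "?y \<in> carrier (alt_group n)" using n by (intro cycle_in_alt_group) auto
  have gen: "gen_row (alt_group n) (?x, ?y)"
  proof (rule alt_gen_rowI[OF x y])
    fix K assume "alt_subgroup n K" and K: "?x \<in> K" "?y \<in> K"
    then interpret K: alt_subgroup n K by simp
    have z: "?z \<in> K" unfolding prod[symmetric] by (rule K.comp_closed[OF K])
    have zi: "?z i = Suc i" if "1 \<le> i" "i < n" for i
    proof -
      have "?z ([1..<Suc n] ! (i - 1)) = [1..<Suc n] ! (Suc (i - 1) mod length [1..<Suc n])"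
        by (rule cycle_of_list_nth) (use that in simp_all)
      then show ?thesis using that by (simp add: nth_upt_Suc del: upt_Suc)
    qed
    have "linked K 1 2" unfolding linked_def using K(1) by (intro disjI2 exI[of _ 3]) simp
    have step: "linked K (Suc i) (Suc (Suc i))" if "Suc i < n" for i
      using that
    proof (induction i)
      case 0
      then show ?case using \<open>linked K 1 2\<close> by (simp add: numeral_2_eq_2)
    next
      case (Suc i)
      have "linked K (Suc i) (Suc (Suc i))" using Suc by simp
      then have "linked K (?z (Suc i)) (?z (Suc (Suc i)))" by (rule K.linked_image[OF _ z])
      then show ?case using zi[of "Suc i"] zi[of "Suc (Suc i)"] Suc.prems by simp
    qed
    have "linked K 1 (Suc i)" if "Suc i \<le> n" for i
      using that
    proof (induction i)
      case (Suc i)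
      then show ?case using K.linked_trans step by (meson Suc_leD Suc_le_lessD)
    qed (simp add: linked_def)
    then have "linked K 1 i" if "i \<in> {1..n}" for i
      using that by (cases i) auto
    then show "\<exists>a. \<forall>i\<in>{1..n}. linked K a i" by blast
  qed
  have 1: "?x ^^ m = id \<longleftrightarrow> 3 dvd m" for m using cycle_funpow_id[of "[1, 2, 3 :: nat]" m] by (simp add: numeral_3_eq_3 del: cycle_of_list.simps)
  have 2: "?y ^^ m = id \<longleftrightarrow> n - 2 dvd m" for m
      using cycle_funpow_id[of "[3..<Suc n]" m] n(2) by (simp del: cycle_of_list.simps upt_Suc)
  have 3: "(?x \<circ> ?y) ^^ m = id \<longleftrightarrow> n dvd m" for m
      using cycle_funpow_id[of "[1..<Suc n]" m] n(2) unfolding prod by (simp del: cycle_of_list.simps upt_Suc)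
  note alt_entry_ord[OF x y 1 2 3]
  then show ?thesis using gen by blast
qed

text \<open>
  The three-cycle joins \<open>n\<close> to the cycle on \<open>1, ..., n - 1\<close> and cuts the result into two cycles of lengths
  \<open>a\<close> and \<open>n - a\<close>.
\<close>

lemma three_cycle_row_even:
  assumes n: "even n" "n \<ge> 4" and a: "2 \<le> a" "a < n"
  shows "\<exists>x y. gen_row (alt_group n) (x, y) \<and> x = cycle_of_list [n, 1, a]
    \<and> entry_ord (alt_group n) 0 (x, y) = 3 \<and> entry_ord (alt_group n) 1 (x, y) = n - 1
    \<and> entry_ord (alt_group n) 2 (x, y) = lcm a (n - a)"
proof -
  let ?x = "cycle_of_list [n, 1, a]" and ?y = "cycle_of_list [1..<n]"
  let ?as = "n # [1..<a]" and ?bs = "[a..<n]"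
  have upt: "[1..<n] = [1..<a] @ [a..<n]" using upt_add_eq_append[of 1 a "n - a"] a by simp
  have upt1: "[1..<n] = 1 # [2..<n]" using n(2) by (simp add: upt_conv_Cons numeral_2_eq_2)
  have hd: "hd ?bs = a" using a by simp
  have d: "distinct (?as @ ?bs)" using a by auto
  have "transpose n 1 \<circ> ?y = cycle_of_list (n # [1..<n])" unfolding upt1 by simp
  also have "\<dots> = cycle_of_list (?as @ ?bs)" unfolding upt by simp
  also have "\<dots> = transpose n a \<circ> cycle_of_list ?as \<circ> cycle_of_list ?bs"
    using cycle_of_list_append[OF d] a hd by simp
  finally have "transpose n a \<circ> (transpose n 1 \<circ> ?y) = cycle_of_list ?as \<circ> cycle_of_list ?bs"
    by (simp add: fun_eq_iff)
  moreover have "?x = transpose n a \<circ> transpose n 1"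
  proof -
    have "distinct [n, 1, a]" "distinct [a, 1, n]" using a n by auto
    then show ?thesis by (simp add: fun_eq_iff transpose_def)
  qed
  ultimately have prod: "?x \<circ> ?y = cycle_of_list ?as \<circ> cycle_of_list ?bs" by (simp only: o_assoc)
  have x: "?x \<in> carrier (alt_group n)" using n a by (intro cycle3_in_alt_group) auto
  have y: "?y \<in> carrier (alt_group n)" using n by (intro cycle_in_alt_group) auto
  have gen: "gen_row (alt_group n) (?x, ?y)"
  proof (rule alt_gen_rowI[OF x y])
    fix K assume "alt_subgroup n K" and K: "?x \<in> K" "?y \<in> K"
    then interpret K: alt_subgroup n K by simp
    have yn: "(?y ^^ m) n = n" for m
      by (induction m) (simp_all add: id_outside_supp del: cycle_of_list.simps)
    have l1: "linked K n 1" unfolding linked_def using K(1) n a by (intro disjI2 exI[of _ a]) simp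
    have "linked K n (Suc i)" if "Suc i < n" for i
    proof -
      have "(?y ^^ i) ([1..<n] ! 0) = [1..<n] ! ((0 + i) mod length [1..<n])"
        using two_cycles_funpow(1)[of "[1..<n]" "[]" 0 i] n(2) by simp
      then have "(?y ^^ i) 1 = Suc i" using that by simp
      then show ?thesis using K.linked_funpow[OF l1 K(2), of i] yn by simp
    qed
    then have "linked K n i" if "i \<in> {1..n}" for i
      using that by (cases i; cases "i = n") (auto simp: linked_def)
    then show "\<exists>a. \<forall>i\<in>{1..n}. linked K a i" by blast
  qed
  have 1: "?x ^^ m = id \<longleftrightarrow> 3 dvd m" for m
      using cycle_funpow_id[of "[n, 1, a]" m] n a by (simp add: numeral_3_eq_3 del: cycle_of_list.simps)
  have 2: "?y ^^ m = id \<longleftrightarrow> n - 1 dvd m" for m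
      using cycle_funpow_id[of "[1..<n]" m] n(2) by (simp del: cycle_of_list.simps)
  have "length ?as = a" "length ?bs = n - a" using a by auto
  then have 3: "(?x \<circ> ?y) ^^ m = id \<longleftrightarrow> lcm a (n - a) dvd m" for m
      using two_cycles_funpow_id[OF d, of m] a unfolding prod by (simp del: cycle_of_list.simps)
  note alt_entry_ord[OF x y 1 2 3]
  then show ?thesis using gen by blast
qed

section \<open>The triples containing two products of two equal cycles\<close>

lemma order_four_apply1: assumes "distinct [a0, b0, a1, b1, a2, a3]" shows "(transpose a0 b0 \<circ> transpose a2 a1 \<circ> (transpose a1 b1 \<circ> transpose a3 a2)) x =
  (if x = a0 then b0 else if x = b0 then a0 else if x = a1 then b1 else if x = b1 then a2 else if x = a2 then a3 else if x = a3 then a1 else x)"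
proof -
  have "distinct (rev [a0, b0, a1, b1, a2, a3])" using assms by auto
  then show ?thesis using assms by (simp add: transpose_def)
qed
lemma order_four_apply2: assumes "distinct [a0, b0, a1, b1, a2, c]" shows "(transpose a0 b0 \<circ> transpose c a1 \<circ> (transpose a1 b1 \<circ> transpose c a2)) x =
  (if x = a0 then b0 else if x = b0 then a0 else if x = a1 then b1 else if x = b1 then c else if x = a2 then a1 else if x = c then a2 else x)"
proof -
  have "distinct (rev [a0, b0, a1, b1, a2, c])" using assms by auto
  then show ?thesis using assms by (simp add: transpose_def)
qed
lemma order_four_square1:
  assumes "distinct [a0, b0, a1, b1, a2, a3]"
  shows "(transpose a0 b0 \<circ> transpose a2 a1 \<circ> (transpose a1 b1 \<circ> transpose a3 a2)) ^^ 2 = transpose a3 b1 \<circ> transpose a1 a2"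
proof
  fix x
  have d: "distinct (rev [a0, b0, a1, b1, a2, a3])" using assms by auto
  show "((transpose a0 b0 \<circ> transpose a2 a1 \<circ> (transpose a1 b1 \<circ> transpose a3 a2)) ^^ 2) x = (transpose a3 b1 \<circ> transpose a1 a2) x"
    unfolding numeral_2_eq_2 funpow.simps o_apply[of "_ \<circ> _" "_ \<circ> _"] comp_id order_four_apply1[OF assms]
    using assms d by (simp add: transpose_def)
qed

lemma order_four_square2:
  assumes "distinct [a0, b0, a1, b1, a2, c]"
  shows "(transpose a0 b0 \<circ> transpose c a1 \<circ> (transpose a1 b1 \<circ> transpose c a2)) ^^ 2 = transpose c a1 \<circ> transpose a2 b1"
proof
  fix x
  have d: "distinct (rev [a0, b0, a1, b1, a2, c])" using assms by auto
  show "((transpose a0 b0 \<circ> transpose c a1 \<circ> (transpose a1 b1 \<circ> transpose c a2)) ^^ 2) x = (transpose c a1 \<circ> transpose a2 b1) x"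
    unfolding numeral_2_eq_2 funpow.simps o_apply[of "_ \<circ> _" "_ \<circ> _"] comp_id order_four_apply2[OF assms]
    using assms d by (simp add: transpose_def)
qed

lemma double_transposition_facts:
  assumes "distinct [a, b, c, d]"
  shows "(transpose a b \<circ> transpose c d) ^^ 2 = id" "transpose a b \<circ> transpose c d \<noteq> id"
    and "(transpose a b \<circ> transpose c d) a = b" "(transpose a b \<circ> transpose c d) c = d"
    and "x \<notin> {a, b, c, d} \<Longrightarrow> (transpose a b \<circ> transpose c d) x = x"
proof -
  show "(transpose a b \<circ> transpose c d) ^^ 2 = id" and ab: "(transpose a b \<circ> transpose c d) a = b"
    and "(transpose a b \<circ> transpose c d) c = d"
    and "x \<notin> {a, b, c, d} \<Longrightarrow> (transpose a b \<circ> transpose c d) x = x"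
    using assms by (auto simp: fun_eq_iff transpose_def numeral_2_eq_2)
  show "transpose a b \<circ> transpose c d \<noteq> id"
  proof
    assume "transpose a b \<circ> transpose c d = id"
    then have "a = b" using ab by simp
    then show False using assms by simp
  qed
qed

lemma order_four:
  fixes u :: "'a \<Rightarrow> 'a"
  assumes u4: "(u ^^ 2) ^^ 2 = id" and u2: "u ^^ 2 \<noteq> id"
  shows "u ^^ m = id \<longleftrightarrow> 4 dvd m"
proof -
  have u4': "u ^^ 4 = id" using u4 by (simp add: funpow_mult)
  have four: "u ^^ (4 * q) = id" for q
    by (simp add: u4' flip: funpow_mult)
  have "u ^^ m = u ^^ (m mod 4 + 4 * (m div 4))" by simp
  also have "\<dots> = u ^^ (m mod 4)" by (simp only: funpow_add four comp_id)
  finally have red: "u ^^ m = u ^^ (m mod 4)" .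
  have n1: "u ^^ 1 \<noteq> id"
  proof
    assume "u ^^ 1 = id"
    then have "u = id" by simp
    then show False using u2 by simp
  qed
  have "u ^^ 3 \<noteq> id"
  proof
    assume "u ^^ 3 = id"
    moreover have "u ^^ 4 = u \<circ> u ^^ 3" by (simp add: eval_nat_numeral)
    ultimately show False using u4' n1 by simp
  qed
  moreover have "m mod 4 \<in> {0, 1, 2, 3}" by auto
  ultimately show ?thesis using red u2 n1 by (auto simp: mod_eq_0_iff_dvd[symmetric])
qed

lemma funpow_conj_involution:
  assumes "s \<circ> s = id"
  shows "(s \<circ> y \<circ> s) ^^ m = s \<circ> y ^^ m \<circ> s"
proof (induction m)
  case 0
  show ?case using assms by simp
next
  case (Suc m)
  have "(s \<circ> y \<circ> s) ^^ Suc m = s \<circ> y \<circ> (s \<circ> s) \<circ> y ^^ m \<circ> s"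
    unfolding funpow.simps Suc by (simp only: o_assoc)
  also have "\<dots> = s \<circ> (y \<circ> y ^^ m) \<circ> s" unfolding assms by (simp only: o_assoc comp_id)
  finally show ?case unfolding funpow.simps .
qed

text \<open>
  For \<open>n = 2 h\<close> or \<open>n = 2 h + 1\<close> the points are two cycles \<open>A 0, ..., A (h - 1)\<close> and \<open>B 0, ..., B (h - 1)\<close>,
  indexed modulo \<open>h\<close>, with one more point in odd degree.
\<close>

locale double_cycle =
  fixes h n :: nat
  assumes h: "h \<ge> 5" and n: "n = 2 * h \<or> n = 2 * h + 1"
begin

definition A :: "nat \<Rightarrow> nat" where "A i = Suc (i mod h)"
definition B :: "nat \<Rightarrow> nat" where "B i = Suc (h + i mod h)"

definition y :: "nat \<Rightarrow> nat" where
  "y = cycle_of_list [1..<Suc h] \<circ> cycle_of_list [Suc h..<Suc (2 * h)]"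

lemma lists: "distinct ([1..<Suc h] @ [Suc h..<Suc (2 * h)])" "length [1..<Suc h] = h"
  "length [Suc h..<Suc (2 * h)] = h"
  by (auto simp del: upt_Suc)

lemma A_nth: "A i = [1..<Suc h] ! (i mod h)" and B_nth: "B i = [Suc h..<Suc (2 * h)] ! (i mod h)"
  using h by (simp_all add: A_def B_def del: upt_Suc)

lemma A_eq_iff: "A i = A j \<longleftrightarrow> i mod h = j mod h" and B_eq_iff: "B i = B j \<longleftrightarrow> i mod h = j mod h"
  and A_neq_B: "A i \<noteq> B j" "B j \<noteq> A i"
proof -
  have "i mod h < h" using h by simp
  then show "A i \<noteq> B j" "B j \<noteq> A i" by (auto simp: A_def B_def)
qed (auto simp: A_def B_def)

lemma AB_range: "A i \<in> {1..n}" "B i \<in> {1..n}" "A i < Suc (2 * h)" "B i < Suc (2 * h)"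
proof -
  have "i mod h < h" using h by simp
  then show "A i \<in> {1..n}" "B i \<in> {1..n}" "A i < Suc (2 * h)" "B i < Suc (2 * h)"
    using n by (auto simp: A_def B_def)
qed

lemma y_A: "(y ^^ m) (A i) = A (i + m)" and y_B: "(y ^^ m) (B i) = B (i + m)"
proof -
  have "i mod h < h" using h by simp
  then show "(y ^^ m) (A i) = A (i + m)" "(y ^^ m) (B i) = B (i + m)"
    unfolding A_nth B_nth y_def
    using two_cycles_funpow(1,2)[OF lists(1), of "i mod h" m] by (simp_all add: lists mod_add_left_eq)
qed

lemma y_out: "x \<notin> {1..2 * h} \<Longrightarrow> (y ^^ m) x = x"
  unfolding y_def using two_cycles_funpow(3)[OF lists(1), of x m] by (auto simp del: upt_Suc)

lemma y_id: "y ^^ m = id \<longleftrightarrow> h dvd m"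
  unfolding y_def using two_cycles_funpow_id[OF lists(1), of m] h by (simp add: lists del: upt_Suc)

lemma y_carrier: "y \<in> carrier (alt_group n)"
proof -
  have p: "permutation (cycle_of_list [1..<Suc h])" "permutation (cycle_of_list [Suc h..<Suc (2 * h)])"
    by (rule permutation_of_cycle)+
  have "cycle_of_list [1..<Suc h] permutes {1..n}" "cycle_of_list [Suc h..<Suc (2 * h)] permutes {1..n}"
    using n by (auto intro!: permutes_subset[OF cycle_permutes] simp del: upt_Suc)
  then have "y permutes {1..n}" unfolding y_def by (intro permutes_compose)
  moreover have "evenperm y"
    unfolding y_def using evenperm_comp[OF p] h
    by (simp add: evenperm_cycle o_def lists del: upt_Suc)
  ultimately show ?thesis by (simp add: alt_group_carrier)
qed

lemma range_cases:
  assumes "x \<in> {1..n}"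
  shows "(\<exists>i. x = A i) \<or> (\<exists>i. x = B i) \<or> (x = 2 * h + 1 \<and> n = 2 * h + 1)"
proof -
  consider "x \<le> h" | "h < x" "x \<le> 2 * h" | "x = 2 * h + 1" using assms n by force
  then show ?thesis
  proof cases
    case 1
    then have "x = A (x - 1)" using assms h by (simp add: A_def)
    then show ?thesis by blast
  next
    case 2
    then have "x = B (x - h - 1)" using assms h by (simp add: B_def)
    then show ?thesis by blast
  next
    case 3
    then show ?thesis using assms n by auto
  qed
qed

lemma A_funpow_fix: "(y ^^ m) (A i) = A i \<longleftrightarrow> h dvd m" and B_funpow_fix: "(y ^^ m) (B i) = B i \<longleftrightarrow> h dvd m"
proof -
  have "(i + m) mod h = i mod h \<longleftrightarrow> h dvd (i + m) - i" by (rule mod_eq_dvd_iff_nat) simp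
  then show "(y ^^ m) (A i) = A i \<longleftrightarrow> h dvd m" "(y ^^ m) (B i) = B i \<longleftrightarrow> h dvd m"
    by (simp_all add: y_A y_B A_eq_iff B_eq_iff)
qed

lemma y_fixed_points:
  assumes "card {i \<in> {1..n}. (y ^^ m) i = i} \<ge> 3"
  shows "y ^^ m = id"
proof (rule ccontr)
  assume "y ^^ m \<noteq> id"
  then have "\<not> h dvd m" by (simp add: y_id)
  then have "{i \<in> {1..n}. (y ^^ m) i = i} \<subseteq> {2 * h + 1}"
    using range_cases A_funpow_fix B_funpow_fix by blast
  then have "card {i \<in> {1..n}. (y ^^ m) i = i} \<le> card {2 * h + 1}" by (intro card_mono) auto
  then show False using assms by simp
qed

lemma conj_y_fixed_points:
  assumes s: "s permutes {1..n}" "s \<circ> s = id"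
    and card: "card {i \<in> {1..n}. ((s \<circ> y \<circ> s) ^^ m) i = i} \<ge> 3"
  shows "(s \<circ> y \<circ> s) ^^ m = id"
proof -
  have ss: "s (s x) = x" for x using s(2) by (simp add: fun_eq_iff)
  have "{i \<in> {1..n}. (y ^^ m) i = i} = s ` {i \<in> {1..n}. ((s \<circ> y \<circ> s) ^^ m) i = i}"
  proof (intro equalityI subsetI)
    fix x assume x: "x \<in> {i \<in> {1..n}. (y ^^ m) i = i}"
    then have "s x \<in> {i \<in> {1..n}. ((s \<circ> y \<circ> s) ^^ m) i = i}"
      unfolding funpow_conj_involution[OF s(2)] using permutes_in_image[OF s(1), of x] by (auto simp: ss)
    then show "x \<in> s ` {i \<in> {1..n}. ((s \<circ> y \<circ> s) ^^ m) i = i}" 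
      by (rule image_eqI[rotated]) (simp add: ss)
  next
    fix x assume "x \<in> s ` {i \<in> {1..n}. ((s \<circ> y \<circ> s) ^^ m) i = i}"
    then obtain z where z: "z \<in> {1..n}" "s ((y ^^ m) (s z)) = z" "x = s z"
      unfolding funpow_conj_involution[OF s(2)] by auto
    have "(y ^^ m) x = x" using arg_cong[OF z(2), of s] unfolding z(3) ss .
    then show "x \<in> {i \<in> {1..n}. (y ^^ m) i = i}" using z permutes_in_image[OF s(1), of z] by auto
  qed
  then have "card {i \<in> {1..n}. (y ^^ m) i = i} = card {i \<in> {1..n}. ((s \<circ> y \<circ> s) ^^ m) i = i}"
    using card_image[of s] inj_on_subset[OF permutes_inj[OF s(1)]] by auto
  then have "y ^^ m = id" using card y_fixed_points by simp
  then show ?thesis unfolding funpow_conj_involution[OF s(2)] using s(2) by simp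
qed

text \<open>
  With an involution \<open>s\<close>, both \<open>y\<close> and its conjugate \<open>s y s = u y\<close> are products of two
  \<open>h\<close>-cycles, where \<open>u\<close> is the commutator of \<open>s\<close> and \<open>y\<close>.
\<close>

definition c :: nat where "c = (if n = 2 * h then A 2 else 2 * h + 1)"
definition c' :: nat where "c' = (if n = 2 * h then A 3 else 2 * h + 1)"

definition s :: "nat \<Rightarrow> nat" where "s = transpose (A 0) (B 0) \<circ> transpose c (A 1)"

definition u :: "nat \<Rightarrow> nat" where
  "u = transpose (A 0) (B 0) \<circ> transpose c (A 1) \<circ> (transpose (A 1) (B 1) \<circ> transpose c' (A 2))"

lemma small_mods: "0 mod h = 0" "1 mod h = 1" "2 mod h = 2" "3 mod h = 3" "4 mod h = 4" "Suc 0 mod h = Suc 0"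
  "5 mod h = (if h = 5 then 0 else 5)"
  using h by auto

lemmas AB_simps = A_eq_iff B_eq_iff A_neq_B small_mods

lemma c_facts: "c \<in> {1..n}" "y c = c'" "distinct [A 0, B 0, c, A 1]"
proof -
  show "c \<in> {1..n}" using n AB_range(1)[of 2] by (auto simp: c_def)
  show "y c = c'" using y_A[of 1 2] y_out[of "2 * h + 1" 1] by (simp add: c_def c'_def numeral_3_eq_3 numeral_2_eq_2)
  show "distinct [A 0, B 0, c, A 1]"
    unfolding c_def using AB_range(3,4)[of 0] AB_range(3)[of 1] h by (auto simp: AB_simps)
qed

lemma s_facts: "s permutes {1..n}" "s \<circ> s = id" "s \<in> carrier (alt_group n)"
proof -
  show s2: "s \<circ> s = id" using double_transposition_facts(1)[OF c_facts(3)] by (simp add: s_def numeral_2_eq_2)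
  show p: "s permutes {1..n}"
    unfolding s_def using AB_range c_facts(1) by (intro permutes_compose permutes_swap_id)
  have "evenperm s"
    unfolding s_def using c_facts(3) by (simp add: evenperm_comp permutation_swap_id evenperm_swap)
  then show "s \<in> carrier (alt_group n)" using p by (simp add: alt_group_carrier)
qed

lemma u_eq: "u = s \<circ> (y \<circ> s \<circ> inv' y)"
proof -
  have "bij y" using alt_group_bij[OF y_carrier] .
  then have "y \<circ> s \<circ> inv' y = transpose (y (A 0)) (y (B 0)) \<circ> transpose (y c) (y (A 1))"
    unfolding s_def by (rule conj_double_transposition)
  moreover have "y (A 0) = A 1" "y (B 0) = B 1" "y (A 1) = A 2"
    using y_A[of 1 0] y_B[of 1 0] y_A[of 1 1] by (simp_all add: numeral_2_eq_2)
  ultimately show ?thesis by (simp add: u_def s_def c_facts(2) o_assoc)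
qed

lemma u_y: "u \<circ> y = s \<circ> y \<circ> s"
proof -
  have "inv' y \<circ> y = id" using alt_group_bij[OF y_carrier] by (simp add: bij_is_inj)
  then have "u \<circ> y = s \<circ> y \<circ> s \<circ> id" unfolding u_eq by (metis o_assoc)
  then show ?thesis by simp
qed

lemma u_carrier: "u \<in> carrier (alt_group n)"
proof -
  interpret group "alt_group n" by (rule alt_group_is_group)
  have "s \<otimes>\<^bsub>alt_group n\<^esub> (y \<otimes>\<^bsub>alt_group n\<^esub> s \<otimes>\<^bsub>alt_group n\<^esub> inv\<^bsub>alt_group n\<^esub> y) \<in> carrier (alt_group n)"
    using s_facts(3) y_carrier by (intro m_closed inv_closed)
  then show ?thesis unfolding u_eq by (simp add: alt_group_inv_equality[OF y_carrier])
qed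

lemma distinct_even: "distinct [A 0, B 0, A 1, B 1, A 2, A 3]"
  using h by (auto simp: AB_simps)

lemma distinct_odd: "n \<noteq> 2 * h \<Longrightarrow> distinct [A 0, B 0, A 1, B 1, A 2, c]"
  unfolding c_def
  using AB_range(3)[of 0] AB_range(4)[of 0] AB_range(3)[of 1] AB_range(4)[of 1] AB_range(3)[of 2] h
  by (auto simp: AB_simps)

lemma u_square:
  "u ^^ 2 = (if n = 2 * h then transpose (A 3) (B 1) \<circ> transpose (A 1) (A 2)
             else transpose c (A 1) \<circ> transpose (A 2) (B 1))"
proof (cases "n = 2 * h")
  case True
  then have e: "u = transpose (A 0) (B 0) \<circ> transpose (A 2) (A 1) \<circ> (transpose (A 1) (B 1) \<circ> transpose (A 3) (A 2))"
    unfolding u_def c_def c'_def by simp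
  show ?thesis unfolding e order_four_square1[OF distinct_even] by (rule if_P[OF True, symmetric])
next
  case False
  have e: "u = transpose (A 0) (B 0) \<circ> transpose c (A 1) \<circ> (transpose (A 1) (B 1) \<circ> transpose c (A 2))"
    unfolding u_def c_def c'_def using False by simp
  show ?thesis unfolding e order_four_square2[OF distinct_odd[OF False]]
    by (rule if_not_P[OF False, symmetric])
qed

lemma u_id: "u ^^ m = id \<longleftrightarrow> 4 dvd m"
proof (rule order_four)
  have "distinct [A 3, B 1, A 1, A 2]" "n \<noteq> 2 * h \<Longrightarrow> distinct [c, A 1, A 2, B 1]"
    using distinct_even distinct_odd by auto
  note d = double_transposition_facts(1,2)[OF this(1)] double_transposition_facts(1,2)[OF this(2)]
  show "(u ^^ 2) ^^ 2 = id" unfolding u_square using d(1,3) by simp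
  show "u ^^ 2 \<noteq> id" unfolding u_square using d(2,4) by simp
qed

lemma periodic: "A (i + h * k) = A i" "B (i + h * k) = B i"
  by (simp_all add: A_def B_def)

text \<open>
  The square of \<open>u\<close> is a double transposition.  It and its conjugate by \<open>y\<^sup>2\<close> produce a three-cycle, and the
  powers of \<open>y\<close> spread the resulting links over both cycles.
\<close>

lemma gen_row_u_y: "gen_row (alt_group n) (u, y)"
proof (rule alt_gen_rowI[OF u_carrier y_carrier])
  fix K assume "alt_subgroup n K" and K: "u \<in> K" "y \<in> K"
  then interpret K: alt_subgroup n K by simp
  have u2: "u ^^ 2 \<in> K" and y2: "y ^^ 2 \<in> K" using K K.funpow_closed by blast+
  define w where "w = y ^^ 2 \<circ> u ^^ 2 \<circ> inv' (y ^^ 2)"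
  have w: "w \<in> K" unfolding w_def by (intro K.comp_closed K.inv_closed u2 y2)
  have bij: "bij (y ^^ 2)" by (rule K.bijK[OF y2])
  have y2s: "(y ^^ 2) (A 1) = A 3" "(y ^^ 2) (A 2) = A 4" "(y ^^ 2) (A 3) = A 5" "(y ^^ 2) (B 1) = B 3"
    unfolding y_A y_B by (intro arg_cong[of _ _ A] arg_cong[of _ _ B]; simp)+
  have shift: "\<exists>m. \<forall>i. A (j + (i + m)) = A (l + i) \<and> B (j + (i + m)) = B (l + i)" for j l
  proof (intro exI allI conjI)
    fix i
    have e: "j + (i + (l + h * j - j)) = (l + i) + h * j"
      using h by (cases h) (auto simp: algebra_simps)
    show "A (j + (i + (l + h * j - j))) = A (l + i)" "B (j + (i + (l + h * j - j))) = B (l + i)"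
      unfolding e by (rule periodic)+
  qed
  have AA: "linked K (A (l + i)) (A (l + i'))" if l: "linked K (A (j + i)) (A (j + i'))" for i i' j l
  proof -
    obtain m where m: "\<forall>i. A (j + (i + m)) = A (l + i) \<and> B (j + (i + m)) = B (l + i)" using shift by blast
    show ?thesis using K.linked_funpow[OF l K(2), of m] m by (simp add: y_A add.assoc)
  qed
  have AB: "linked K (A (l + i)) (B (l + i'))" if l: "linked K (A (j + i)) (B (j + i'))" for i i' j l
  proof -
    obtain m where m: "\<forall>i. A (j + (i + m)) = A (l + i) \<and> B (j + (i + m)) = B (l + i)" using shift by blast
    show ?thesis using K.linked_funpow[OF l K(2), of m] m by (simp add: y_A y_B add.assoc)
  qed
  show "\<exists>a. \<forall>i\<in>{1..n}. linked K a i"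
  proof (cases "n = 2 * h")
    case True
    have v: "transpose (A 3) (B 1) \<circ> transpose (A 1) (A 2) \<in> K" using u2 unfolding u_square using True by simp
    have weq: "w = transpose (A 5) (B 3) \<circ> transpose (A 3) (A 4)"
      unfolding w_def u_square if_P[OF True] conj_double_transposition[OF bij] y2s by (rule refl)
    have dw: "distinct [A 5, B 3, A 3, A 4]" using h by (auto simp: AB_simps)
    note wf = double_transposition_facts[OF dw, folded weq]
    have "A 1 \<notin> {A 5, B 3, A 3, A 4}" "A 2 \<notin> {A 5, B 3, A 3, A 4}" "B 1 \<notin> {A 5, B 3, A 3, A 4}"
      using h by (auto simp: AB_simps)
    note fx = this[THEN wf(5)]
    have "distinct [A 3, B 1, A 4, A 1, A 2]" by (auto simp: AB_simps)
    from K.linked_by_double_transpositions[OF v w wf(4) fx(3,1,2) this]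
    have l: "linked K (A 3) (B 1)" "linked K (A 3) (A 4)" .
    have step: "linked K (A i) (A (Suc i))" for i
      using AA[of 3 0 1 i] l(2) by simp
    have all: "linked K (A 0) (A i)" for i
      by (induction i) (use K.linked_trans step in \<open>auto simp: linked_def\<close>)
    have "linked K (A (i + 2)) (B i)" for i
      using AB[of 1 2 0 i] l(1) by (simp add: numeral_3_eq_3 numeral_2_eq_2)
    then have allB: "linked K (A 0) (B i)" for i by (rule K.linked_trans[OF all])
    have "linked K (A 0) x" if "x \<in> {1..n}" for x
      using range_cases[OF that] all allB True by (elim disjE exE conjE) simp_all
    then show ?thesis by blast
  next
    case False
    then have n': "n = 2 * h + 1" using n by simp
    have c: "c = 2 * h + 1" unfolding c_def using False by simp
    have yc: "(y ^^ m) c = c" for m by (rule y_out) (simp add: c)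
    have cAB: "c \<noteq> A i" "c \<noteq> B i" "A i \<noteq> c" "B i \<noteq> c" for i using AB_range(3,4)[of i] c by auto
    have v: "transpose c (A 1) \<circ> transpose (A 2) (B 1) \<in> K" using u2 unfolding u_square using False by simp
    have weq: "w = transpose c (A 3) \<circ> transpose (A 4) (B 3)"
      unfolding w_def u_square if_not_P[OF False] conj_double_transposition[OF bij] y2s yc by (rule refl)
    have dw: "distinct [c, A 3, A 4, B 3]" by (auto simp: AB_simps cAB)
    note wf = double_transposition_facts[OF dw, folded weq]
    have "A 1 \<notin> {c, A 3, A 4, B 3}" "A 2 \<notin> {c, A 3, A 4, B 3}" "B 1 \<notin> {c, A 3, A 4, B 3}"
      by (auto simp: AB_simps cAB)
    note fx = this[THEN wf(5)]
    have "distinct [c, A 1, A 3, A 2, B 1]" by (auto simp: AB_simps cAB)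
    from K.linked_by_double_transpositions(1)[OF v w wf(3) fx this]
    have l: "linked K c (A 1)" .
    have all: "linked K c (A i)" for i
    proof -
      obtain m where m: "\<forall>i'. A (1 + (i' + m)) = A (i + i') \<and> B (1 + (i' + m)) = B (i + i')" using shift by blast
      then have "A (1 + m) = A i" by (metis add_0 add_0_right)
      then show ?thesis using K.linked_funpow[OF l K(2), of m] by (simp add: y_A yc)
    qed
    have ueq: "u = transpose (A 0) (B 0) \<circ> transpose c (A 1) \<circ> (transpose (A 1) (B 1) \<circ> transpose c (A 2))"
      unfolding u_def c_def c'_def using False by simp
    have "u (A 1) = B 1" "u c = A 2"
      unfolding ueq order_four_apply2[OF distinct_odd[OF False]] using distinct_odd[OF False] by auto
    then have "linked K (A 2) (B 1)" using K.linked_image[OF l K(1)] by simp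
    then have "linked K (A (i + 1)) (B i)" for i
      using AB[of 1 1 0 i] by (simp add: numeral_2_eq_2)
    then have allB: "linked K c (B i)" for i by (rule K.linked_trans[OF all])
    have "linked K c c" by (simp add: linked_def)
    then have "linked K c x" if "x \<in> {1..n}" for x
      using range_cases[OF that] all allB c by (elim disjE exE conjE) simp_all
    then show ?thesis by blast
  qed
qed

theorem double_cycle_row:
  "entry_ord (alt_group n) 0 (u, y) = 4" "entry_ord (alt_group n) 1 (u, y) = h"
  "entry_ord (alt_group n) 2 (u, y) = h"
  "v \<in> {1, 2} \<Longrightarrow> card {i \<in> {1..n}. (entry (alt_group n) v (u, y) ^^ m) i = i} \<ge> 3 \<Longrightarrow>
    entry (alt_group n) v (u, y) ^^ m = id"
proof -
  interpret group "alt_group n" by (rule alt_group_is_group)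
  have uy: "(u \<circ> y) ^^ m = id \<longleftrightarrow> h dvd m" for m
  proof -
    have "(u \<circ> y) ^^ m = s \<circ> y ^^ m \<circ> s" unfolding u_y by (rule funpow_conj_involution[OF s_facts(2)])
    moreover have "s \<circ> y ^^ m \<circ> s = id \<longleftrightarrow> y ^^ m = id"
      using s_facts(2) by (metis comp_id id_comp o_assoc)
    ultimately show ?thesis using y_id by simp
  qed
  show "entry_ord (alt_group n) 0 (u, y) = 4" "entry_ord (alt_group n) 1 (u, y) = h"
    "entry_ord (alt_group n) 2 (u, y) = h"
    using alt_entry_ord[OF u_carrier y_carrier u_id y_id uy] by blast+
  assume v: "v \<in> {1, 2}" and card: "card {i \<in> {1..n}. (entry (alt_group n) v (u, y) ^^ m) i = i} \<ge> 3"
  show "entry (alt_group n) v (u, y) ^^ m = id"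
  proof (cases "v = 1")
    case True
    then show ?thesis using card y_fixed_points[of m] by (simp add: entry_simps)
  next
    case False
    have uyc: "u \<circ> y \<in> carrier (alt_group n)" using m_closed[OF u_carrier y_carrier] by simp
    have bij: "bij (u \<circ> y)" by (rule alt_group_bij[OF uyc])
    have e: "entry (alt_group n) v (u, y) ^^ m = inv' ((u \<circ> y) ^^ m)"
      using False v alt_group_inv_equality[OF uyc] inv_fn[OF bij, of m] by (simp add: entry_simps)
    have bm: "bij ((u \<circ> y) ^^ m)" by (rule bij_fn[OF bij])
    have "inv' ((u \<circ> y) ^^ m) i = i \<longleftrightarrow> ((u \<circ> y) ^^ m) i = i" for i
      using bm by (metis bij_inv_eq_iff)
    then have "(u \<circ> y) ^^ m = id"
      using card conj_y_fixed_points[OF s_facts(1,2), of m] unfolding e u_y by simp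
    then show ?thesis unfolding e by simp
  qed
qed

end

section \<open>Beauville structures for degree at least ten\<close>

lemma three_cycle_fixes_many:
  fixes n :: nat
  assumes "n \<ge> 6" "distinct [a, b, c]"
  shows "card {i \<in> {1..n}. (cycle_of_list [a, b, c] ^^ m) i = i} \<ge> 3"
proof -
  have "(cycle_of_list [a, b, c] ^^ m) i = i" if "i \<notin> {a, b, c}" for i
    using that by (induction m) (simp_all add: id_outside_supp del: cycle_of_list.simps)
  then have "{1..n} - {a, b, c} \<subseteq> {i \<in> {1..n}. (cycle_of_list [a, b, c] ^^ m) i = i}" by blast
  moreover have "finite {i \<in> {1..n}. (cycle_of_list [a, b, c] ^^ m) i = i}"
    by (rule finite_subset[of _ "{1..n}"]) auto
  ultimately have "card ({1..n} - {a, b, c}) \<le> card {i \<in> {1..n}. (cycle_of_list [a, b, c] ^^ m) i = i}"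
    by (rule card_mono[rotated])
  moreover have "card {1..n} - card {a, b, c} \<le> card ({1..n} - {a, b, c})" by (rule diff_card_le_card_Diff) simp
  moreover have "card {a, b, c} \<le> 3" using card_length[of "[a, b, c]"] by simp
  ultimately show ?thesis using assms(1) by simp
qed

text \<open>
  In even degree the two cycles of the product have lengths \<open>h + d\<close> and \<open>h - d\<close>, where \<open>d\<close> is 1 or 2 such that
  both are odd; they are then coprime to each other and to \<open>2 h\<close>.
\<close>

lemma three_cycle_row_exists:
  assumes h: "h \<ge> 5" and n: "n = 2 * h \<or> n = 2 * h + 1"
  obtains x y a b c r s where "gen_row (alt_group n) (x, y)" "x = cycle_of_list [a, b, c]" "distinct [a, b, c]"
    "entry_ord (alt_group n) 0 (x, y) = 3" "entry_ord (alt_group n) 1 (x, y) = r"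
    "entry_ord (alt_group n) 2 (x, y) = s" "coprime r (2 * h)" "coprime s (2 * h)" "distinct [3, r, s]"
    "r \<ge> 5" "s \<ge> 5"
proof (cases "n = 2 * h")
  case False
  then have n': "n = 2 * h + 1" using n by simp
  have co: "coprime (2 * h - 1) (2 * h)" "coprime (2 * h + 1) (2 * h)"
    using h coprime_diff_one_left_nat[of "2 * h"] coprime_Suc_left_nat[of "2 * h"] by simp_all
  have "odd n" "n \<ge> 7" using n' h by auto
  from three_cycle_row_odd[OF this] obtain x y where xy:
    "gen_row (alt_group n) (x, y)" "x = cycle_of_list [1, 2, 3]"
    "entry_ord (alt_group n) 0 (x, y) = 3" "entry_ord (alt_group n) 1 (x, y) = n - 2"
    "entry_ord (alt_group n) 2 (x, y) = n" by blast
  have r: "coprime (n - 2) (2 * h)" "coprime n (2 * h)" "distinct [3, n - 2, n]" "n - 2 \<ge> 5" "n \<ge> 5"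
    "distinct [1, 2, 3 :: nat]"
  proof -
    have "n - 2 = 2 * h - 1" using n' by simp
    then show "coprime (n - 2) (2 * h)" "coprime n (2 * h)" using co n' by (simp_all only:)
    show "n - 2 \<ge> 5" "n \<ge> 5" using n' h by linarith+
    then have "3 \<noteq> n - 2" "3 \<noteq> n" "n - 2 \<noteq> n" by linarith+
    then show "distinct [3, n - 2, n]" by simp
  qed simp
  show thesis by (rule that[OF xy(1,2) r(6) xy(3-5) r(1-5)])
next
  case True
  define d where "d = (if even h then 1 else 2 :: nat)"
  define a where "a = h + d"
  have d: "d = 1 \<or> d = 2" "odd (h + d)" "odd (h - d)" using h by (auto simp: d_def)
  have a: "2 \<le> a" "a < n" "n - a = h - d" using True h d(1) by (auto simp: a_def)
  have c2: "coprime x 2" if "odd x" for x :: nat using that by simp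
  have cd: "coprime x d" if "odd x" for x :: nat using d(1) that by auto
  have dd: "coprime (h + d) h" "coprime (h - d) h"
  proof -
    have g1: "coprime d h"
    proof (cases "d = 1")
      case False
      then have "d = 2" "odd h" using d by auto
      then show ?thesis by simp
    qed simp
    then show "coprime (h + d) h" by (simp add: coprime_iff_gcd_eq_1 gcd.commute)
    have "coprime (h - d) (h - d + d)"
      using cd[OF d(3)] by (simp add: coprime_iff_gcd_eq_1)
    moreover have "h - d + d = h" using h d(1) by auto
    ultimately show "coprime (h - d) h" by (simp only:)
  qed
  have "coprime (h - d) (2 * d)" using c2[OF d(3)] cd[OF d(3)] by simp
  then have "coprime (h - d) ((h - d) + 2 * d)" by (simp only: coprime_iff_gcd_eq_1 gcd_add2)
  moreover have "(h - d) + 2 * d = h + d" using h d(1) by auto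
  ultimately have cab: "coprime (h + d) (h - d)" by (simp only: coprime_commute)
  have l: "lcm a (n - a) = (h + d) * (h - d)"
    using lcm_coprime[OF cab] by (simp add: a(3)) (simp add: a_def)
  have r: "coprime (2 * h - 1) (2 * h)" using h coprime_diff_one_left_nat[of "2 * h"] by auto
  have s: "coprime ((h + d) * (h - d)) (2 * h)" using dd c2 d(2,3) by simp
  have big: "(h + d) * (h - d) > 2 * h"
  proof -
    have "(h + d) * 3 \<le> (h + d) * (h - d)" using h d(1) by (intro mult_left_mono) auto
    moreover have "2 * h < (h + d) * 3" using h by simp
    ultimately show ?thesis by (rule less_le_trans[rotated])
  qed
  have "even n" "n \<ge> 4" using True h by auto
  from three_cycle_row_even[OF this a(1,2)] obtain x y where xy:
    "gen_row (alt_group n) (x, y)" "x = cycle_of_list [n, 1, a]"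
    "entry_ord (alt_group n) 0 (x, y) = 3" "entry_ord (alt_group n) 1 (x, y) = n - 1"
    "entry_ord (alt_group n) 2 (x, y) = lcm a (n - a)" by blast
  have r: "coprime (n - 1) (2 * h)" "distinct [3, n - 1, (h + d) * (h - d)]" "n - 1 \<ge> 5"
    "(h + d) * (h - d) \<ge> 5" "distinct [n, 1, a]"
  proof -
    show "coprime (n - 1) (2 * h)" unfolding True by (rule r)
    show "n - 1 \<ge> 5" "(h + d) * (h - d) \<ge> 5" using big True h by linarith+
    then have "3 \<noteq> n - 1" "3 \<noteq> (h + d) * (h - d)" "n - 1 \<noteq> (h + d) * (h - d)"
      using big True by linarith+
    then show "distinct [3, n - 1, (h + d) * (h - d)]" by simp
    show "distinct [n, 1, a]" using a(1,2) by auto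
  qed
  show thesis by (rule that[OF xy(1,2) r(5) xy(3-5)[unfolded l] r(1) s r(2-4)])
qed

lemma less_3_cases: "u < 3 \<Longrightarrow> u = 0 \<or> u = 1 \<or> u = (2 :: nat)"
  by linarith

lemma card_less_3:
  "card {u. u < 3 \<and> P u} = (if P 0 then 1 else 0) + (if P 1 then 1 else 0) + (if P (2 :: nat) then 1 else (0 :: nat))"
proof -
  have "{u. u < 3 \<and> P u} = (if P 0 then {0} else {}) \<union> (if P 1 then {1} else {}) \<union> (if P 2 then {2} else {})"
    by (auto dest: less_3_cases)
  then show ?thesis by simp
qed

lemma alt_group_hyps:
  assumes "n \<ge> 5"
  shows "simple_group (alt_group n)" "finite (carrier (alt_group n))" "\<not> comm_group (alt_group n)"
  using simple_alt_group[OF assms] finite_alt_group nonabelian_alt_group[OF assms] by blast+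

lemma hyperbolic_rowI:
  assumes "entry_ord H 0 r = a" "entry_ord H 1 r = b" "entry_ord H 2 r = c" "1 / real a + 1 / real b + 1 / real c < 1"
  shows "hyperbolic_row H r"
  using assms by (simp add: hyperbolic_row_def)

lemma sum_of_inverses_less_1:
  assumes "3 \<le> a" "5 \<le> b" "5 \<le> c"
  shows "1 / real a + 1 / real b + 1 / real c < 1"
proof -
  have "1 / real a \<le> 1 / 3" "1 / real b \<le> 1 / 5" "1 / real c \<le> 1 / 5"
    using assms by (simp_all add: field_simps)
  then show ?thesis by linarith
qed

text \<open>
  The types are \<open>(3, r, s)\<close> with \<open>r\<close>, \<open>s\<close> coprime to \<open>2 h\<close>, and \<open>(4, h, h)\<close>.  Only 3 and \<open>h\<close> can have a common
  factor: there, powers of a three-cycle fix at least three points and nontrivial powers of a product of two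
  \<open>h\<close>-cycles at most one.  The only prime that can divide both
  types is 3; it divides one entry of the first and two of the second.
\<close>

theorem beauville_alt_power_degree_ge_10:
  assumes n: "n \<ge> 10" and k: "1 \<le> k" "k \<le> d2 (alt_group n)"
  shows "beauville_group (direct_power (alt_group n) k)"
proof -
  define h where "h = n div 2"
  have h: "h \<ge> 5" "n = 2 * h \<or> n = 2 * h + 1" using n by (auto simp: h_def)
  interpret D: double_cycle h n by unfold_locales (rule h)+
  note H = alt_group_hyps[of n]
  let ?H = "alt_group n"
  interpret simple_group ?H using H(1) n by simp
  obtain x y a b c r s where g: "gen_row ?H (x, y)" and x: "x = cycle_of_list [a, b, c]" "distinct [a, b, c]"
    and o: "entry_ord ?H 0 (x, y) = 3" "entry_ord ?H 1 (x, y) = r" "entry_ord ?H 2 (x, y) = s"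
    and co: "coprime r (2 * h)" "coprime s (2 * h)" and dist: "distinct [3, r, s]" and big: "r \<ge> 5" "s \<ge> 5"
    by (rule three_cycle_row_exists[OF h])
  note o' = D.double_cycle_row(1-3) and g' = D.gen_row_u_y
  let ?r = "(x, y)" and ?r' = "(D.u, D.y)"
  have hyp: "hyperbolic_row ?H ?r"
    by (rule hyperbolic_rowI[OF o sum_of_inverses_less_1]) (use big in simp_all)
  have hyp': "hyperbolic_row ?H ?r'"
    by (rule hyperbolic_rowI[OF o' sum_of_inverses_less_1]) (use h(1) in simp_all)
  have "3 \<in> ord_set ?H ?r" "3 \<notin> ord_set ?H ?r'" using h(1) unfolding ord_set_def o o' by auto
  then have os: "ord_set ?H ?r \<noteq> ord_set ?H ?r'" by blast
  have ne: "\<not> (entry_ord ?H 0 ?r' = entry_ord ?H 1 ?r' \<and> entry_ord ?H 1 ?r' = entry_ord ?H 2 ?r')"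
    using o' h(1) by simp
  have co2: "coprime r 2" "coprime r h" "coprime s 2" "coprime s h" using co by simp_all
  then have co4: "coprime r 4" "coprime s 4" using coprime_power_right_iff[of r 2 2] coprime_power_right_iff[of s 2 2] by simp_all
  have c34: "coprime (3 :: nat) 4" using coprime_Suc_right_nat[of 3] by simp
  show ?thesis
  proof (cases "k \<le> 6")
    case True
    have disj: "conj_disjoint ?H (entry ?H u ?r) (entry ?H v ?r')" if uv: "u < 3" "v < 3" for u v
    proof (cases "u = 0 \<and> v \<noteq> 0")
      case True
      show ?thesis
      proof (rule conj_disjoint_fixed_points[of _ _ _ 3])
        show "entry ?H u ?r \<in> carrier ?H" "entry ?H v ?r' \<in> carrier ?H" using entry_closed[OF g] entry_closed[OF g'] .
        show "card {i \<in> {1..n}. (entry ?H u ?r ^^ m) i = i} \<ge> 3" for m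
          using three_cycle_fixes_many[OF _ x(2), of n m] n True by (simp add: entry_simps x(1))
        show "entry ?H v ?r' ^^ m = id" if "card {i \<in> {1..n}. (entry ?H v ?r' ^^ m) i = i} \<ge> 3" for m
          by (rule D.double_cycle_row(4)[OF _ that]) (use True uv less_3_cases[of v] in blast)
      qed
    next
      case False
      have "coprime (entry_ord ?H u ?r) (entry_ord ?H v ?r')"
        using False less_3_cases[OF uv(1)] less_3_cases[OF uv(2)] o o' co2 co4 c34 by auto
      then show ?thesis
        using conj_disjoint_coprime[OF entry_closed[OF g] entry_closed[OF g']] by (simp add: entry_ord_def)
    qed
    show ?thesis
      by (rule beauville_small_power[OF H g g' hyp hyp' _ ne os disj k(1) True]) (use n o dist in simp_all)
  next
    case False
    show ?thesis
    proof (rule beauville_large_power[OF H g g' hyp _ ne os])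
      show "distinct [entry_ord ?H 0 ?r, entry_ord ?H 1 ?r, entry_ord ?H 2 ?r]" using o dist by simp
      fix p e :: nat
      assume p: "Factorial_Ring.prime p" and e: "e > 0"
        and card: "card {u. u < 3 \<and> multiplicity p (entry_ord ?H u ?r) = e}
          = card {u. u < 3 \<and> multiplicity p (entry_ord ?H u ?r') = e}"
      have z: "multiplicity p q = 0" if "\<not> p dvd q" for q using that by (rule not_dvd_imp_multiplicity_0)
      have pn: "\<not> p dvd q" if "p dvd t" "coprime q t" for q t
        using that p by (meson coprime_common_divisor_nat not_prime_1 prime_nat_iff dvd_trans coprime_common_divisor not_prime_unit)
      show "card {u. u < (3::nat) \<and> multiplicity p (entry_ord ?H u ?r) = e} = 0"
      proof (cases "p = 2")
        case True
        have "\<not> p dvd 3" "\<not> p dvd r" "\<not> p dvd s" using True co2 by simp_all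
        note zero = this[THEN z]
        show ?thesis using e unfolding card_less_3 o zero by simp
      next
        case False
        then have "\<not> p dvd 2" using p primes_dvd_imp_eq[of p 2] by auto
        then have "\<not> p dvd 2 * 2" using prime_dvd_mult_iff[OF p] by blast
        then have m4: "multiplicity p 4 = 0" by (intro z) simp
        show ?thesis
        proof (cases "p dvd h")
          case True
          note zero = z[OF pn[OF True co2(2)]] z[OF pn[OF True co2(4)]] m4
          show ?thesis using card e unfolding card_less_3 o o' zero by (simp split: if_splits)
        next
          case False
          then have zero: "multiplicity p h = 0" by (rule z)
          show ?thesis using card e unfolding card_less_3 o' zero m4 by simp
        qed
      qed
    qed (use False k(2) n in simp_all)
  qed
qed

section \<open>Permutations given by the list of their values\<close>

text \<open>
  For computations a permutation of \<open>{1..n}\<close> is given by the list of its values.  Even permutations are entered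
  as products of three-cycles, which makes membership in the alternating group evident.
\<close>

definition lperm :: "nat list \<Rightarrow> nat \<Rightarrow> nat" where
  "lperm xs i = (if 1 \<le> i \<and> i \<le> length xs then xs ! (i - 1) else i)"

definition lcomp :: "nat list \<Rightarrow> nat list \<Rightarrow> nat list" where
  "lcomp xs ys = map (\<lambda>i. xs ! (i - 1)) ys"

definition lcycle :: "nat \<Rightarrow> nat \<times> nat \<times> nat \<Rightarrow> nat list" where
  "lcycle n t = (case t of (a, b, c) \<Rightarrow>
     map (\<lambda>i. if i = a then b else if i = b then c else if i = c then a else i) [1..<Suc n])"

definition lprod :: "nat \<Rightarrow> (nat \<times> nat \<times> nat) list \<Rightarrow> nat list" where
  "lprod n ts = foldr (\<lambda>t xs. lcomp (lcycle n t) xs) ts [1..<Suc n]"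

definition ltriple :: "nat \<Rightarrow> nat \<times> nat \<times> nat \<Rightarrow> bool" where
  "ltriple n t = (case t of (a, b, c) \<Rightarrow> a \<noteq> b \<and> a \<noteq> c \<and> b \<noteq> c \<and> list_all (\<lambda>i. 1 \<le> i \<and> i \<le> n) [a, b, c])"

definition lword :: "nat \<Rightarrow> nat list \<Rightarrow> nat list \<Rightarrow> bool list \<Rightarrow> nat list" where
  "lword n xs ys w = foldr (\<lambda>l zs. lcomp (if l then xs else ys) zs) w [1..<Suc n]"

text \<open>
  The set \<open>lists_of n\<close> is what a list of values has to satisfy for the coding to be faithful.
\<close>

definition lists_of :: "nat \<Rightarrow> nat list set" where
  "lists_of n = {xs. length xs = n \<and> set xs \<subseteq> {1..n}}"

lemma upt_lists_of: "[1..<Suc n] \<in> lists_of n"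
  by (auto simp: lists_of_def simp del: upt_Suc)

lemma lcomp_lists_of:
  assumes "xs \<in> lists_of n" "ys \<in> lists_of n"
  shows "lcomp xs ys \<in> lists_of n"
proof -
  have "xs ! (i - 1) \<in> {1..n}" if "i \<in> set ys" for i
  proof -
    have "i \<in> {1..n}" "length xs = n" using assms that by (auto simp: lists_of_def)
    then have "i - 1 < length xs" by auto
    then show ?thesis using assms(1) nth_mem by (fastforce simp: lists_of_def)
  qed
  then show ?thesis using assms by (auto simp: lists_of_def lcomp_def)
qed

lemma lcycle_lists_of: "ltriple n t \<Longrightarrow> lcycle n t \<in> lists_of n"
  by (auto simp: lists_of_def lcycle_def ltriple_def split: prod.splits simp del: upt_Suc)

lemma lprod_lists_of: "\<forall>t\<in>set ts. ltriple n t \<Longrightarrow> lprod n ts \<in> lists_of n"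
proof (induction ts)
  case Nil
  show ?case unfolding lprod_def list.simps foldr.simps id_apply by (rule upt_lists_of)
next
  case (Cons t ts)
  have "lprod n (t # ts) = lcomp (lcycle n t) (lprod n ts)" by (simp add: lprod_def del: upt_Suc)
  then show ?case using Cons by (simp add: lcomp_lists_of lcycle_lists_of)
qed

lemma lword_lists_of: "xs \<in> lists_of n \<Longrightarrow> ys \<in> lists_of n \<Longrightarrow> lword n xs ys w \<in> lists_of n"
proof (induction w)
  case Nil
  show ?case unfolding lword_def list.simps foldr.simps id_apply by (rule upt_lists_of)
next
  case (Cons l w)
  have "lword n xs ys (l # w) = lcomp (if l then xs else ys) (lword n xs ys w)" by (simp add: lword_def del: upt_Suc)
  then show ?case using Cons by (simp add: lcomp_lists_of)
qed

lemma lperm_upt: "lperm [1..<Suc n] = id"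
  by (auto simp: lperm_def fun_eq_iff nth_upt simp del: upt_Suc)

lemma lperm_lcomp:
  assumes "xs \<in> lists_of n" "ys \<in> lists_of n"
  shows "lperm (lcomp xs ys) = lperm xs \<circ> lperm ys"
proof
  fix i
  show "lperm (lcomp xs ys) i = (lperm xs \<circ> lperm ys) i"
  proof (cases "1 \<le> i \<and> i \<le> n")
    case True
    then have i: "i - 1 < length ys" using assms by (auto simp: lists_of_def)
    then have "ys ! (i - 1) \<in> {1..n}" using assms(2) nth_mem by (fastforce simp: lists_of_def)
    then show ?thesis using True i assms by (simp add: lperm_def lcomp_def lists_of_def)
  next
    case False
    then show ?thesis using assms by (auto simp: lperm_def lcomp_def lists_of_def)
  qed
qed

lemma lperm_inj:
  assumes "xs \<in> lists_of n" "ys \<in> lists_of n" "lperm xs = lperm ys"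
  shows "xs = ys"
proof (rule nth_equalityI)
  show "length xs = length ys" using assms by (simp add: lists_of_def)
  fix i assume "i < length xs"
  then show "xs ! i = ys ! i"
    using fun_cong[OF assms(3), of "Suc i"] assms(1,2) by (simp add: lperm_def lists_of_def)
qed

lemma lperm_lcycle:
  assumes "ltriple n (a, b, c)"
  shows "lperm (lcycle n (a, b, c)) = cycle_of_list [a, b, c]"
proof
  fix i
  have d: "distinct [a, b, c]" and r: "a \<in> {1..n}" "b \<in> {1..n}" "c \<in> {1..n}" using assms by (auto simp: ltriple_def)
  show "lperm (lcycle n (a, b, c)) i = cycle_of_list [a, b, c] i"
  proof (cases "1 \<le> i \<and> i \<le> n")
    case True
    then have i: "i - 1 < length [1..<Suc n]" "[1..<Suc n] ! (i - 1) = i" by (auto simp: nth_upt simp del: upt_Suc)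
    have "lperm (lcycle n (a, b, c)) i = (lcycle n (a, b, c)) ! (i - 1)"
      using True by (simp add: lperm_def lcycle_def del: upt_Suc)
    then show ?thesis
      unfolding cycle3_apply[OF d] lcycle_def prod.case nth_map[OF i(1)] i(2) .
  next
    case False
    then have "i \<noteq> a" "i \<noteq> b" "i \<noteq> c" using r by auto
    then show ?thesis
      unfolding cycle3_apply[OF d] using False lcycle_lists_of[OF assms] by (auto simp: lperm_def lists_of_def)
  qed
qed

lemma lperm_lprod: "\<forall>t\<in>set ts. ltriple n t \<Longrightarrow> lperm (lprod n ts) \<in> carrier (alt_group n)"
proof (induction ts)
  case Nil
  show ?case unfolding lprod_def list.simps foldr.simps id_apply lperm_upt alt_group_carrier
    unfolding id_def[symmetric] by (intro conjI permutes_id) (simp only: evenperm_id)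
next
  case (Cons t ts)
  interpret group "alt_group n" by (rule alt_group_is_group)
  obtain a b c where t: "t = (a, b, c)" by (cases t)
  have lt: "ltriple n (a, b, c)" using Cons.prems t by simp
  have "lprod n (t # ts) = lcomp (lcycle n t) (lprod n ts)" by (simp add: lprod_def del: upt_Suc)
  then have eq: "lperm (lprod n (t # ts)) = cycle_of_list [a, b, c] \<circ> lperm (lprod n ts)"
    using lperm_lcomp[OF lcycle_lists_of[OF lt] lprod_lists_of[of ts n]] Cons.prems
    by (simp only: t lperm_lcycle[OF lt] list.set insert_iff) blast
  have "cycle_of_list [a, b, c] \<in> carrier (alt_group n)"
    by (rule cycle3_in_alt_group) (use lt in \<open>auto simp: ltriple_def\<close>)
  moreover have "lperm (lprod n ts) \<in> carrier (alt_group n)" using Cons by simp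
  ultimately have "cycle_of_list [a, b, c] \<otimes>\<^bsub>alt_group n\<^esub> lperm (lprod n ts) \<in> carrier (alt_group n)"
    by (rule m_closed)
  then show ?case unfolding eq alt_group_mult_apply .
qed

lemma lperm_id_iff: "xs \<in> lists_of n \<Longrightarrow> lperm xs = id \<longleftrightarrow> xs = [1..<Suc n]"
  using lperm_inj[OF _ upt_lists_of[of n], of xs] lperm_upt[of n] by metis

lemma lword_closed:
  assumes "alt_subgroup n K" "xs \<in> lists_of n" "ys \<in> lists_of n" "lperm xs \<in> K" "lperm ys \<in> K"
  shows "lperm (lword n xs ys w) \<in> K"
proof -
  interpret alt_subgroup n K by fact
  show ?thesis
  proof (induction w)
    case Nil
    show ?case unfolding lword_def list.simps foldr.simps id_apply lperm_upt
      using funpow_closed[OF assms(4), of 0] by (simp add: id_def)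
  next
    case (Cons l w)
    have "lword n xs ys (l # w) = lcomp (if l then xs else ys) (lword n xs ys w)" by (simp add: lword_def del: upt_Suc)
    moreover have "lperm (lcomp (if l then xs else ys) (lword n xs ys w)) = lperm (if l then xs else ys) \<circ> lperm (lword n xs ys w)"
      by (rule lperm_lcomp[OF _ lword_lists_of[OF assms(2,3)]]) (simp add: assms(2,3))
    moreover have "lperm (if l then xs else ys) \<in> K" using assms(4,5) by simp
    ultimately show ?case using comp_closed[OF _ Cons] by (simp only:)
  qed
qed

lemma lperm_funpow:
  assumes "xs \<in> lists_of n"
  shows "lperm (lword n xs ys (replicate m True)) = lperm xs ^^ m"
proof -
  have "lword n xs ys (replicate m True) \<in> lists_of n \<and> lperm (lword n xs ys (replicate m True)) = lperm xs ^^ m"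
  proof (induction m)
    case 0
    show ?case unfolding lword_def replicate.simps list.simps foldr.simps id_apply lperm_upt funpow.simps
      by (rule conjI[OF upt_lists_of refl])
  next
    case (Suc m)
    have "lword n xs ys (replicate (Suc m) True) = lcomp xs (lword n xs ys (replicate m True))"
      by (simp add: lword_def del: upt_Suc)
    then show ?case using Suc assms by (simp add: lperm_lcomp lcomp_lists_of)
  qed
  then show ?thesis ..
qed

definition lord :: "nat \<Rightarrow> nat list \<Rightarrow> nat \<Rightarrow> bool" where
  "lord n xs d = (0 < d \<and> lword n xs xs (replicate d True) = [1..<Suc n] \<and>
     list_all (\<lambda>m. lword n xs xs (replicate m True) \<noteq> [1..<Suc n]) [1..<d])"

lemma lord_correct:
  assumes xs: "xs \<in> lists_of n" and d: "lord n xs d"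
  shows "lperm xs ^^ m = id \<longleftrightarrow> d dvd m"
proof -
  let ?p = "lperm xs"
  have id: "?p ^^ m = id \<longleftrightarrow> lword n xs xs (replicate m True) = [1..<Suc n]" for m
    using lperm_id_iff[OF lword_lists_of[OF xs xs]] lperm_funpow[OF xs, of xs] by metis
  have d': "0 < d" "?p ^^ d = id" "\<And>m. 0 < m \<Longrightarrow> m < d \<Longrightarrow> ?p ^^ m \<noteq> id"
    using d unfolding id lord_def list_all_iff by auto
  have pd: "?p ^^ (d * q) = id" for q
  proof (induction q)
    case (Suc q)
    have "?p ^^ (d * Suc q) = ?p ^^ d \<circ> ?p ^^ (d * q)" by (simp only: mult_Suc_right funpow_add)
    then show ?case by (simp only: Suc d'(2) id_comp)
  qed simp
  have "?p ^^ m = ?p ^^ (m mod d)"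
    using mult_div_mod_eq[of d m] funpow_add[of "d * (m div d)" "m mod d" ?p] by (simp add: pd)
  then show ?thesis
    using d'(1) d'(3)[of "m mod d"] by (auto simp: dvd_eq_mod_eq_0 intro: ccontr)
qed

section \<open>Certificates for generating pairs\<close>

fun lorbit :: "nat \<Rightarrow> nat list \<Rightarrow> nat list \<Rightarrow> nat list \<Rightarrow> nat list" where
  "lorbit 0 xs ys S = S"
| "lorbit (Suc m) xs ys S = lorbit m xs ys (remdups (S @ map (lperm xs) S @ map (lperm ys) S))"

text \<open>
  A certificate consists of two products of three-cycles, a word in the two permutations that is a three-cycle, a
  point of this cycle, and the orders of the triple.
\<close>

type_synonym certificate =
  "(nat \<times> nat \<times> nat) list \<times> (nat \<times> nat \<times> nat) list \<times> bool list \<times> nat \<times> nat \<times> nat \<times> nat"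

definition cert_row :: "nat \<Rightarrow> certificate \<Rightarrow> (nat \<Rightarrow> nat) \<times> (nat \<Rightarrow> nat)" where
  "cert_row n C = (case C of (ts, us, _) \<Rightarrow> (lperm (lprod n ts), lperm (lprod n us)))"

definition cert_ords :: "certificate \<Rightarrow> nat \<times> nat \<times> nat" where
  "cert_ords C = (case C of (_, _, _, _, ds) \<Rightarrow> ds)"

definition valid_cert :: "nat \<Rightarrow> certificate \<Rightarrow> bool" where
  "valid_cert n C = (case C of (ts, us, w, a, p, q, r) \<Rightarrow>
     list_all (ltriple n) ts \<and> list_all (ltriple n) us \<and>
     (let xs = lprod n ts; ys = lprod n us; zs = lword n xs ys w; b = lperm zs a; c = lperm zs b in
        ltriple n (a, b, c) \<and> zs = lcycle n (a, b, c) \<and>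
        List.member [a, b, c] (lperm xs a) \<and> List.member [a, b, c] (lperm ys a) \<and>
        list_all (List.member (lorbit n xs ys [a])) [1..<Suc n] \<and>
        lord n xs p \<and> lord n ys q \<and> lord n (lcomp xs ys) r))"

lemma lorbit_closed:
  assumes "\<And>j. P j \<Longrightarrow> P (lperm xs j)" "\<And>j. P j \<Longrightarrow> P (lperm ys j)" "\<forall>j\<in>set S. P j"
  shows "\<forall>j\<in>set (lorbit m xs ys S). P j"
  using assms(3)
proof (induction m arbitrary: S)
  case (Suc m)
  have "\<forall>j\<in>set (remdups (S @ map (lperm xs) S @ map (lperm ys) S)). P j" using Suc.prems assms(1,2) by auto
  then show ?case unfolding lorbit.simps by (rule Suc.IH)
qed simp

text \<open>
  The word of the certificate is a three-cycle moving \<open>a\<close>, and both generators map \<open>a\<close> into its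
  support.  So the class of \<open>a\<close> under \<^const>\<open>linked\<close> is stable under both generators, and by
  transitivity it contains every point.
\<close>

lemma valid_cert:
  assumes "valid_cert n C"
  shows "gen_row (alt_group n) (cert_row n C)"
    and "cert_ords C = (p, q, r) \<Longrightarrow> entry_ord (alt_group n) 0 (cert_row n C) = p
      \<and> entry_ord (alt_group n) 1 (cert_row n C) = q \<and> entry_ord (alt_group n) 2 (cert_row n C) = r"
proof -
  obtain ts us w a e0 e1 e2 where C: "C = (ts, us, w, a, e0, e1, e2)" by (cases C)
  define xs ys zs b c where xs: "xs = lprod n ts" and ys: "ys = lprod n us" and zs: "zs = lword n xs ys w"
    and b: "b = lperm zs a" and c: "c = lperm zs b"
  have v: "\<forall>t\<in>set ts. ltriple n t" "\<forall>t\<in>set us. ltriple n t" "ltriple n (a, b, c)" "zs = lcycle n (a, b, c)"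
    "lperm xs a \<in> {a, b, c}" "lperm ys a \<in> {a, b, c}" "\<forall>i\<in>{1..n}. i \<in> set (lorbit n xs ys [a])"
    "lord n xs e0" "lord n ys e1" "lord n (lcomp xs ys) e2"
    using assms unfolding valid_cert_def C prod.case Let_def xs[symmetric] ys[symmetric] zs[symmetric] b[symmetric] c[symmetric]
    by (auto simp: list_all_iff simp del: upt_Suc)
  have l: "xs \<in> lists_of n" "ys \<in> lists_of n" unfolding xs ys using v(1,2) by (simp_all add: lprod_lists_of)
  have x: "lperm xs \<in> carrier (alt_group n)" "lperm ys \<in> carrier (alt_group n)"
    unfolding xs ys using v(1,2) by (simp_all add: lperm_lprod)
  have row: "cert_row n C = (lperm xs, lperm ys)" by (simp add: cert_row_def C xs ys)
  show "gen_row (alt_group n) (cert_row n C)"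
    unfolding row
  proof (rule alt_gen_rowI[OF x])
    fix K assume K: "alt_subgroup n K" "lperm xs \<in> K" "lperm ys \<in> K"
    interpret alt_subgroup n K by (rule K(1))
    have "lperm zs \<in> K" unfolding zs by (rule lword_closed[OF K(1) l K(2,3)])
    then have c3: "cycle_of_list [a, b, c] \<in> K" unfolding v(4) lperm_lcycle[OF v(3)] .
    have d: "distinct [a, b, c]" "distinct [a, c, b]" using v(3) by (auto simp: ltriple_def)
    have "linked K a j" if "j \<in> {a, b, c}" for j
    proof -
      have "linked K a a" by (simp add: linked_def)
      moreover have "linked K a b" unfolding linked_def using d c3 by blast
      moreover have "linked K a c" unfolding linked_def using d swap3[OF d(1) c3] by blast
      ultimately show ?thesis using that by blast
    qed
    then have la: "linked K a (lperm xs a)" "linked K a (lperm ys a)" using v(5,6) by blast+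
    have "\<forall>j\<in>set (lorbit n xs ys [a]). linked K a j"
    proof (rule lorbit_closed)
      show "linked K a (lperm xs j)" if "linked K a j" for j
        by (rule linked_trans[OF la(1) linked_image[OF that K(2)]])
      show "linked K a (lperm ys j)" if "linked K a j" for j
        by (rule linked_trans[OF la(2) linked_image[OF that K(3)]])
    qed (simp add: linked_def)
    then show "\<exists>a. \<forall>i\<in>{1..n}. linked K a i" using v(7) by blast
  qed
  show "entry_ord (alt_group n) 0 (cert_row n C) = p
      \<and> entry_ord (alt_group n) 1 (cert_row n C) = q \<and> entry_ord (alt_group n) 2 (cert_row n C) = r"
    if "cert_ords C = (p, q, r)"
  proof -
    have "e0 = p" "e1 = q" "e2 = r" using that by (simp_all add: cert_ords_def C)
    then show ?thesis
      unfolding row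
      using alt_entry_ord[OF x lord_correct[OF l(1) v(8)] lord_correct[OF l(2) v(9)]
          lord_correct[OF lcomp_lists_of[OF l] v(10), unfolded lperm_lcomp[OF l]]] by simp
  qed
qed

section \<open>Beauville structures for degrees seven, eight and nine\<close>

text \<open>
  Hyperbolicity of the type, with denominators cleared.
\<close>

definition ords_sum_less_1 :: "nat \<times> nat \<times> nat \<Rightarrow> bool" where
  "ords_sum_less_1 o3 = (case o3 of (p, q, r) \<Rightarrow> 0 < p \<and> 0 < q \<and> 0 < r \<and> q * r + p * r + p * q < p * q * r)"

lemma cert_hyperbolic:
  assumes "valid_cert n C" "ords_sum_less_1 (cert_ords C)"
  shows "hyperbolic_row (alt_group n) (cert_row n C)"
proof -
  obtain p q r where o: "cert_ords C = (p, q, r)" by (cases "cert_ords C")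
  have l: "0 < p" "0 < q" "0 < r" "q * r + p * r + p * q < p * q * r"
    using assms(2) unfolding o ords_sum_less_1_def by auto
  then have "real (q * r + p * r + p * q) < real (p * q * r)" by (simp only: of_nat_less_iff)
  then have "1 / real p + 1 / real q + 1 / real r < 1" using l(1-3) by (simp add: field_simps)
  then show ?thesis using valid_cert(2)[OF assms(1) o] by (intro hyperbolic_rowI) auto
qed

text \<open>
  When the two types have coprime entries the conjugacy condition costs nothing, and no prime can
  divide entries of both of them.
\<close>

lemma beauville_coprime_certs:
  assumes n: "n \<ge> 5" and v: "valid_cert n C" "valid_cert n C'"
    and o: "cert_ords C = (p, q, r)" "cert_ords C' = (p', q', r')"
    and hyp: "ords_sum_less_1 (p, q, r)" "ords_sum_less_1 (p', q', r')"
    and dist: "distinct [p, q, r]" and ne: "p' \<noteq> q'" and p1: "p \<noteq> 1"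
    and co: "coprime (p * q * r) (p' * q' * r')" and k: "1 \<le> k" "k \<le> d2 (alt_group n)"
  shows "beauville_group (direct_power (alt_group n) k)"
proof -
  let ?H = "alt_group n" and ?r = "cert_row n C" and ?r' = "cert_row n C'"
  note H = alt_group_hyps[OF n]
  interpret simple_group ?H using H(1) .
  note g = valid_cert(1)[OF v(1)] valid_cert(1)[OF v(2)]
  have e: "entry_ord ?H 0 ?r = p" "entry_ord ?H 1 ?r = q" "entry_ord ?H 2 ?r = r"
    "entry_ord ?H 0 ?r' = p'" "entry_ord ?H 1 ?r' = q'" "entry_ord ?H 2 ?r' = r'"
    using valid_cert(2)[OF v(1) o(1)] valid_cert(2)[OF v(2) o(2)] by blast+
  have hr: "hyperbolic_row ?H ?r" "hyperbolic_row ?H ?r'"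
    using cert_hyperbolic[OF v(1)] cert_hyperbolic[OF v(2)] hyp unfolding o by blast+
  have nd: "\<not> (entry_ord ?H 0 ?r = entry_ord ?H 1 ?r \<and> entry_ord ?H 1 ?r = entry_ord ?H 2 ?r)"
    using dist unfolding e by simp
  have ne': "\<not> (entry_ord ?H 0 ?r' = entry_ord ?H 1 ?r' \<and> entry_ord ?H 1 ?r' = entry_ord ?H 2 ?r')"
    using ne unfolding e by simp
  have cop: "coprime (entry_ord ?H u ?r) (entry_ord ?H w ?r')" if "u < 3" "w < 3" for u w
  proof -
    have "entry_ord ?H u ?r dvd p * q * r" using less_3_cases[OF that(1)] by (elim disjE) (simp_all only: e, simp_all)
    moreover have "entry_ord ?H w ?r' dvd p' * q' * r'" using less_3_cases[OF that(2)] by (elim disjE) (simp_all only: e, simp_all)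
    ultimately show ?thesis using co coprime_divisors by blast
  qed
  have os: "ord_set ?H ?r \<noteq> ord_set ?H ?r'"
  proof
    assume eq: "ord_set ?H ?r = ord_set ?H ?r'"
    have "p \<in> {p', q', r'}" using eq unfolding ord_set_def e by blast
    then show False using cop[of 0 0] cop[of 0 1] cop[of 0 2] p1 unfolding e by auto
  qed
  show ?thesis
  proof (cases "k \<le> 6")
    case True
    show ?thesis
    proof (rule beauville_small_power[OF H g hr nd ne' os _ k(1) True])
      fix u w :: nat assume "u < 3" "w < 3"
      then show "conj_disjoint ?H (entry ?H u ?r) (entry ?H w ?r')"
        using conj_disjoint_coprime[OF entry_closed[OF g(1)] entry_closed[OF g(2)]] cop by (simp add: entry_ord_def)
    qed
  next
    case False
    show ?thesis
    proof (rule beauville_large_power[OF H g hr(1) _ ne' os])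
      show "distinct [entry_ord ?H 0 ?r, entry_ord ?H 1 ?r, entry_ord ?H 2 ?r]" unfolding e by (rule dist)
      fix s t :: nat
      assume s: "Factorial_Ring.prime s" and t: "t > 0"
        and card: "card {u. u < 3 \<and> multiplicity s (entry_ord ?H u ?r) = t}
          = card {u. u < 3 \<and> multiplicity s (entry_ord ?H u ?r') = t}"
      show "card {u. u < (3::nat) \<and> multiplicity s (entry_ord ?H u ?r) = t} = 0"
      proof (rule ccontr)
        assume nz: "card {u. u < (3::nat) \<and> multiplicity s (entry_ord ?H u ?r) = t} \<noteq> 0"
        then have "{u. u < (3::nat) \<and> multiplicity s (entry_ord ?H u ?r) = t} \<noteq> {}" by (metis card.empty)
        then obtain u where u: "u < 3" "multiplicity s (entry_ord ?H u ?r) = t" by auto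
        have "{u. u < (3::nat) \<and> multiplicity s (entry_ord ?H u ?r') = t} \<noteq> {}" using nz card by (metis card.empty)
        then obtain w where w: "w < 3" "multiplicity s (entry_ord ?H w ?r') = t" by auto
        have "s dvd entry_ord ?H u ?r" "s dvd entry_ord ?H w ?r'"
          using u(2) w(2) t not_dvd_imp_multiplicity_0 by fastforce+
        then have "is_unit s" using cop[OF u(1) w(1)] coprime_common_divisor by blast
        then show False using s by (meson not_prime_unit)
      qed
    qed (use False k(2) in simp_all)
  qed
qed

theorem beauville_alt_power_degree_7_to_9:
  assumes n: "n \<in> {7, 8, 9}" and k: "1 \<le> k" "k \<le> d2 (alt_group n)"
  shows "beauville_group (direct_power (alt_group n) k)"
proof -
  define C C' :: certificate where
    "C = (if n = 7 then ([(1, 2, 3), (2, 3, 7), (4, 7, 5), (5, 6, 7)], [(1, 5, 7), (3, 4, 6)], [True, True], 3, (6, 3, 4))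
      else if n = 8 then ([(1, 3, 2), (2, 5, 7), (3, 7, 4), (4, 8, 7)], [(1, 5, 4), (6, 7, 8)], [True, True], 2, (6, 3, 4))
      else ([(1, 4, 8), (2, 6, 5), (5, 7, 8), (6, 8, 9)], [(1, 4, 2), (3, 7, 5), (6, 8, 9)],
        [True, True, False, True, False, True, True, False, True, False], 8, (6, 3, 4)))"
    and "C' = (if n = 7 then ([(1, 2, 7), (4, 7, 5)], [(1, 6, 3), (2, 4, 7), (3, 5, 7)], [True, True, False], 6, (5, 7, 7))
      else if n = 8 then ([(3, 7, 6), (4, 8, 6)], [(1, 2, 8), (3, 6, 8), (5, 7, 8)],
        [True, True, True, False, True, True, True, False], 1, (5, 7, 7))
      else ([(1, 2, 4), (3, 4, 5)], [(3, 5, 4), (4, 8, 6), (6, 9, 7)],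
        [True, False, True, False, False, True, True, True, False, True, False, False, True, True,
         True, False, True, False, False, True, True, True, False, True, False, False, True, True], 7, (5, 7, 7)))"
  have 7: "valid_cert 7 ([(1, 2, 3), (2, 3, 7), (4, 7, 5), (5, 6, 7)], [(1, 5, 7), (3, 4, 6)], [True, True], 3, (6, 3, 4))"
      "valid_cert 7 ([(1, 2, 7), (4, 7, 5)], [(1, 6, 3), (2, 4, 7), (3, 5, 7)], [True, True, False], 6, (5, 7, 7))"
    by code_simp+
  have 8: "valid_cert 8 ([(1, 3, 2), (2, 5, 7), (3, 7, 4), (4, 8, 7)], [(1, 5, 4), (6, 7, 8)], [True, True], 2, (6, 3, 4))"
      "valid_cert 8 ([(3, 7, 6), (4, 8, 6)], [(1, 2, 8), (3, 6, 8), (5, 7, 8)],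
        [True, True, True, False, True, True, True, False], 1, (5, 7, 7))"
    by code_simp+
  have 9: "valid_cert 9 ([(1, 4, 8), (2, 6, 5), (5, 7, 8), (6, 8, 9)], [(1, 4, 2), (3, 7, 5), (6, 8, 9)],
        [True, True, False, True, False, True, True, False, True, False], 8, (6, 3, 4))"
      "valid_cert 9 ([(1, 2, 4), (3, 4, 5)], [(3, 5, 4), (4, 8, 6), (6, 9, 7)],
        [True, False, True, False, False, True, True, True, False, True, False, False, True, True,
         True, False, True, False, False, True, True, True, False, True, False, False, True, True], 7, (5, 7, 7))"
    by code_simp+
  have "valid_cert n C" "valid_cert n C'"
    using n 7 8 9 unfolding C_def C'_def by auto
  moreover have "cert_ords C = (6, 3, 4)" "cert_ords C' = (5, 7, 7)"
    unfolding C_def C'_def by (simp_all add: cert_ords_def)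
  moreover have "ords_sum_less_1 (6, 3, 4)" "ords_sum_less_1 (5, 7, 7)" by code_simp+
  moreover have "coprime (6 * 3 * 4) (5 * 7 * 7 :: nat)" by (simp add: coprime_iff_gcd_eq_1 gcd_nat.simps)
  ultimately show ?thesis
    using n k by (intro beauville_coprime_certs[of n C C' 6 3 4 5 7 7 k]) auto
qed

section \<open>Arranging certified rows\<close>

text \<open>
  The multiplicity of a prime 2, 3 or 5 in a number from 2 to 5; these are the primes and orders that occur in
  degrees five and six.
\<close>

definition lval :: "nat \<Rightarrow> nat \<Rightarrow> nat" where
  "lval p x = (if x = p then 1 else if p = 2 \<and> x = 4 then 2 else 0)"

fun lmax :: "nat list \<Rightarrow> nat" where
  "lmax [] = 0"
| "lmax (x # xs) = max x (lmax xs)"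

definition top_bits :: "nat \<Rightarrow> nat list \<Rightarrow> bool list" where
  "top_bits p xs = (let M = lmax (map (lval p) xs) in map (\<lambda>x. 0 < M \<and> lval p x = M) xs)"

definition lseparated :: "nat list \<Rightarrow> nat list \<Rightarrow> bool" where
  "lseparated xs ys = (list_all (List.member [2, 3, 4, 5]) xs \<and> list_all (List.member [2, 3, 4, 5]) ys \<and>
     list_all (\<lambda>p. top_bits p xs = top_bits p ys \<longrightarrow> \<not> List.member (top_bits p xs) True) [2, 3, 5])"

lemma lmax_bounds:
  fixes xs :: "nat list"
  shows "x \<in> set xs \<Longrightarrow> x \<le> lmax xs" and "lmax xs = 0 \<or> lmax xs \<in> set xs"
  by (induction xs) (auto simp: max_def)

lemma small_primes:
  "Factorial_Ring.prime (2 :: nat)" "Factorial_Ring.prime (3 :: nat)" "Factorial_Ring.prime (5 :: nat)"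
proof -
  have "n = 1 \<or> n = 3" if "n dvd 3" for n :: nat
  proof -
    have "n \<le> 3" using that by (rule dvd_imp_le) simp
    then have "n \<in> {0, 1, 2, 3}" by auto
    then show ?thesis using that by auto
  qed
  then show "Factorial_Ring.prime (3 :: nat)" by (auto simp: prime_nat_iff)
  have "n = 1 \<or> n = 5" if "n dvd 5" for n :: nat
  proof -
    have "n \<le> 5" using that by (rule dvd_imp_le) simp
    then have "n \<in> {0, 1, 2, 3, 4, 5}" by auto
    then show ?thesis using that by auto
  qed
  then show "Factorial_Ring.prime (5 :: nat)" by (auto simp: prime_nat_iff)
qed (rule two_is_prime_nat)

lemma multiplicity_lval:
  assumes p: "p \<in> {2, 3, 5}" and x: "x \<in> {2, 3, 4, 5}"
  shows "multiplicity p x = lval p x"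
proof -
  have pr: "Factorial_Ring.prime p" using p small_primes by blast
  show ?thesis
  proof (cases "x = 4")
    case True
    have "multiplicity p (2 ^ 2) = 2 * multiplicity p 2"
      by (rule prime_elem_multiplicity_power_distrib) (use pr in auto)
    moreover have "multiplicity p 2 = (if p = 2 then 1 else 0)"
      using prime_multiplicity_other[OF pr small_primes(1)] multiplicity_prime[OF prime_imp_prime_elem[OF pr]] by auto
    ultimately show ?thesis using True p by (auto simp: lval_def)
  next
    case False
    then have "Factorial_Ring.prime x" using x small_primes by blast
    then show ?thesis
      using prime_multiplicity_other[OF pr, of x] multiplicity_prime[OF prime_imp_prime_elem[OF pr]] False p x
      by (cases "x = p") (auto simp: lval_def)
  qed
qed

lemma prime_dvd_small:
  assumes p: "Factorial_Ring.prime p" and x: "x \<in> {2, 3, 4, 5 :: nat}" "p dvd x"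
  shows "p \<in> {2, 3, 5}"
proof -
  have "p dvd 2 \<or> p dvd 3 \<or> p dvd 5"
  proof (cases "x = 4")
    case True
    then have "p dvd 2 * 2" using x(2) by simp
    then show ?thesis using prime_dvd_mult_iff[OF p] by blast
  qed (use x in auto)
  then show ?thesis using primes_dvd_imp_eq[OF p] small_primes by blast
qed

lemma p_full_top_bits:
  assumes p: "p \<in> {2, 3, 5}" and xs: "set xs \<subseteq> {2, 3, 4, 5}"
  shows "p_full p {..<length xs} ((!) xs) = {i. i < length xs \<and> top_bits p xs ! i}"
proof -
  define M where "M = lmax (map (lval p) xs)"
  have v: "multiplicity p (xs ! i) = lval p (xs ! i)" if "i < length xs" for i
    by (rule multiplicity_lval[OF p subsetD[OF xs nth_mem[OF that]]])
  have dv: "p dvd xs ! i \<longleftrightarrow> 0 < lval p (xs ! i)" if "i < length xs" for i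
  proof -
    have "xs ! i \<in> {2, 3, 4, 5}" by (rule subsetD[OF xs nth_mem[OF that]])
    then have "xs ! i \<noteq> 0" "\<not> is_unit p" using p by auto
    then show ?thesis unfolding v[OF that, symmetric] by (simp add: multiplicity_gt_zero_iff)
  qed
  have le: "lval p (xs ! i) \<le> M" if "i < length xs" for i
    unfolding M_def by (rule lmax_bounds(1)) (use that in auto)
  have at: "M = 0 \<or> (\<exists>j<length xs. lval p (xs ! j) = M)"
    using lmax_bounds(2)[of "map (lval p) xs"] unfolding M_def[symmetric] by (auto simp: in_set_conv_nth)
  have bits: "top_bits p xs ! i \<longleftrightarrow> 0 < M \<and> lval p (xs ! i) = M" if "i < length xs" for i
    using that by (simp add: top_bits_def M_def Let_def)
  have "i \<in> p_full p {..<length xs} ((!) xs) \<longleftrightarrow> i < length xs \<and> top_bits p xs ! i" for i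
  proof (cases "i < length xs")
    case True
    have "i \<in> p_full p {..<length xs} ((!) xs)
      \<longleftrightarrow> 0 < lval p (xs ! i) \<and> (\<forall>j<length xs. lval p (xs ! j) \<le> lval p (xs ! i))"
      using True v dv unfolding p_full_def by auto
    also have "\<dots> \<longleftrightarrow> 0 < M \<and> lval p (xs ! i) = M"
    proof (intro iffI conjI)
      assume h: "0 < lval p (xs ! i) \<and> (\<forall>j<length xs. lval p (xs ! j) \<le> lval p (xs ! i))"
      then show "0 < M" using le[OF True] by simp
      then show "lval p (xs ! i) = M" using at h le[OF True] by (metis le_antisym less_irrefl)
    qed (use le in auto)
    finally show ?thesis using True bits by simp
  qed (simp add: p_full_def)
  then show ?thesis by blast
qed

lemma lseparated:
  assumes "lseparated xs ys" "length xs = k" "length ys = k"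
  shows "p_separated {..<k} ((!) xs) ((!) ys)"
  unfolding p_separated_def
proof (intro allI impI)
  fix p :: nat
  assume p: "Factorial_Ring.prime p" and eq: "p_full p {..<k} ((!) xs) = p_full p {..<k} ((!) ys)"
  have s: "set xs \<subseteq> {2, 3, 4, 5}" "set ys \<subseteq> {2, 3, 4, 5}"
    using assms(1) by (auto simp: lseparated_def list_all_iff)
  show "p_full p {..<k} ((!) xs) = {}"
  proof (cases "p \<in> {2, 3, 5}")
    case True
    have bits: "{i. i < k \<and> top_bits p xs ! i} = {i. i < k \<and> top_bits p ys ! i}"
      using eq p_full_top_bits[OF True s(1)] p_full_top_bits[OF True s(2)] assms(2,3) by simp
    have len: "length (top_bits p xs) = k" "length (top_bits p ys) = k"
      using assms(2,3) by (simp_all add: top_bits_def Let_def)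
    have "top_bits p xs = top_bits p ys"
      by (rule nth_equalityI) (use bits len in auto)
    then have "\<not> List.member (top_bits p xs) True"
      using assms(1) True by (auto simp: lseparated_def)
    then have "\<not> top_bits p xs ! i" if "i < k" for i
      using that len(1) nth_mem[of i "top_bits p xs"] by (auto simp: in_set_conv_nth)
    then show ?thesis using p_full_top_bits[OF True s(1)] assms(2) by auto
  next
    case False
    have "\<not> p dvd xs ! i" if "i < k" for i
    proof
      assume "p dvd xs ! i"
      moreover have "xs ! i \<in> {2, 3, 4, 5}" by (rule subsetD[OF s(1) nth_mem]) (use that assms(2) in simp)
      ultimately show False using prime_dvd_small[OF p] False by blast
    qed
    then show ?thesis unfolding p_full_def by auto
  qed
qed

definition ord_col :: "nat \<Rightarrow> nat \<times> nat \<times> nat \<Rightarrow> nat" where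
  "ord_col u t = (case t of (p, q, r) \<Rightarrow> if u = 0 then p else if u = 1 then q else r)"

text \<open>
  The three columns of one list are compared with those of the other at the prime \<open>p\<close>.
\<close>

definition separated_at :: "nat list list \<Rightarrow> nat list list \<Rightarrow> nat \<Rightarrow> bool" where
  "separated_at cs cs' p = (let ts' = map (top_bits p) cs' in
     list_all (\<lambda>t. List.member t True \<longrightarrow> \<not> List.member ts' t) (map (top_bits p) cs))"

definition separated_tables :: "(nat \<times> nat \<times> nat) list \<Rightarrow> (nat \<times> nat \<times> nat) list \<Rightarrow> bool" where
  "separated_tables os os' =
     (let cs = map (\<lambda>u. map (ord_col u) os) [0, 1, 2]; cs' = map (\<lambda>u. map (ord_col u) os') [0, 1, 2] in
      list_all (list_all (List.member [2, 3, 4, 5])) cs \<and> list_all (list_all (List.member [2, 3, 4, 5])) cs' \<and>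
      list_all (separated_at cs cs') [2, 3, 5])"

lemma separated_tables_columns:
  assumes "separated_tables os os'" "u < 3" "v < 3"
  shows "lseparated (map (ord_col u) os) (map (ord_col v) os')"
proof -
  have uv: "u \<in> {0, 1, 2}" "v \<in> {0, 1, 2}" using assms(2,3) by auto
  have s: "\<forall>u\<in>{0, 1, 2}. list_all (List.member [2, 3, 4, 5]) (map (ord_col u) os)"
    "\<forall>v\<in>{0, 1, 2}. list_all (List.member [2, 3, 4, 5]) (map (ord_col v) os')"
    "\<forall>p\<in>{2, 3, 5}. \<forall>u\<in>{0, 1, 2}. List.member (top_bits p (map (ord_col u) os)) True \<longrightarrow>
      (\<forall>v\<in>{0, 1, 2}. top_bits p (map (ord_col u) os) \<noteq> top_bits p (map (ord_col v) os'))"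
    using assms(1) by (simp_all add: separated_tables_def separated_at_def Let_def)
  have "\<not> List.member (top_bits p (map (ord_col u) os)) True"
    if "p \<in> {2, 3, 5}" "top_bits p (map (ord_col u) os) = top_bits p (map (ord_col v) os')" for p
    using s(3) that uv by blast
  then have "list_all (\<lambda>p. top_bits p (map (ord_col u) os) = top_bits p (map (ord_col v) os') \<longrightarrow>
      \<not> List.member (top_bits p (map (ord_col u) os)) True) [2, 3, 5]"
    unfolding list_all_iff list.set by blast
  then show ?thesis
    using bspec[OF s(1) uv(1)] bspec[OF s(2) uv(2)] unfolding lseparated_def by blast
qed

lemma entry_ord_cert:
  assumes "valid_cert n C" "u < 3"
  shows "entry_ord (alt_group n) u (cert_row n C) = ord_col u (cert_ords C)"
proof -
  obtain p q r where o: "cert_ords C = (p, q, r)" by (cases "cert_ords C")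
  show ?thesis
    using valid_cert(2)[OF assms(1) o] less_3_cases[OF assms(2)] unfolding o ord_col_def by auto
qed

text \<open>
  Which of the given words in the two generators, without inverses, are relators.  These truth values depend only on
  the kernel, so they distinguish kernels.
\<close>

definition word_vector :: "nat \<Rightarrow> bool list list \<Rightarrow> certificate \<Rightarrow> bool list" where
  "word_vector n ws C = (case C of (ts, us, _) \<Rightarrow>
     let xs = lprod n ts; ys = lprod n us in map (\<lambda>w. lword n xs ys w = [1..<Suc n]) ws)"

lemma eval_positive_word:
  assumes "xs \<in> lists_of n" "ys \<in> lists_of n"
  shows "eval_word (alt_group n) (lperm xs) (lperm ys) (map (\<lambda>b. (b, True)) w) = lperm (lword n xs ys w)"
proof (induction w)
  case Nil
  show ?case unfolding list.map eval_word_Nil lword_def list.simps foldr.simps id_apply lperm_upt alt_group_one ..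
next
  case (Cons l w)
  have "lword n xs ys (l # w) = lcomp (if l then xs else ys) (lword n xs ys w)" by (simp add: lword_def del: upt_Suc)
  moreover have "lperm (lcomp (if l then xs else ys) (lword n xs ys w)) = lperm (if l then xs else ys) \<circ> lperm (lword n xs ys w)"
    by (rule lperm_lcomp[OF _ lword_lists_of[OF assms]]) (simp add: assms)
  moreover have "eval_letter (alt_group n) (lperm xs) (lperm ys) (l, True) = lperm (if l then xs else ys)"
    by (simp add: eval_letter_def)
  ultimately show ?case
    unfolding list.map eval_word_Cons Cons alt_group_mult_apply by (simp only:)
qed

lemma positive_word_reduced: "reduced (map (\<lambda>b. (b, True)) w)"
  unfolding reduced_def
  by (induction w rule: induct_list012) (auto simp: inv_letter_def)

lemma word_vector_relators:
  assumes v: "valid_cert n C" "valid_cert n C'"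
    and eq: "row_relators (alt_group n) (cert_row n C) = row_relators (alt_group n) (cert_row n C')"
  shows "word_vector n ws C = word_vector n ws C'"
proof -
  have *: "word_vector n ws C = map (\<lambda>w. map (\<lambda>b. (b, True)) w \<in> row_relators (alt_group n) (cert_row n C)) ws"
    if "valid_cert n C" for C
  proof -
    obtain ts us w0 rest where C: "C = (ts, us, w0, rest)" by (cases C)
    have "list_all (ltriple n) ts \<and> list_all (ltriple n) us"
      using that unfolding C valid_cert_def by (auto split: prod.splits)
    then have l: "lprod n ts \<in> lists_of n" "lprod n us \<in> lists_of n"
      by (simp_all add: lprod_lists_of list_all_iff)
    have "(lword n (lprod n ts) (lprod n us) w = [1..<Suc n])
        = (map (\<lambda>b. (b, True)) w \<in> row_relators (alt_group n) (cert_row n C))" for w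
      using lperm_id_iff[OF lword_lists_of[OF l, of w]] positive_word_reduced[of w] eval_positive_word[OF l, of w]
      by (simp add: relators_def carrier_F2 cert_row_def C alt_group_one del: upt_Suc)
    then show ?thesis unfolding word_vector_def C prod.case Let_def by (simp only:)
  qed
  show ?thesis unfolding *[OF v(1)] *[OF v(2)] eq ..
qed

lemma distinct_word_vectors:
  assumes "\<forall>C\<in>set L. valid_cert n C" "distinct (map (word_vector n ws) L)"
  shows "distinct (map (row_relators (alt_group n)) (map (cert_row n) L))"
proof -
  have "inj_on (row_relators (alt_group n) \<circ> cert_row n) (set L)"
  proof (rule inj_onI)
    fix C C' assume c: "C \<in> set L" "C' \<in> set L"
      "(row_relators (alt_group n) \<circ> cert_row n) C = (row_relators (alt_group n) \<circ> cert_row n) C'"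
    then have "word_vector n ws C = word_vector n ws C'"
      using word_vector_relators[of n C C' ws] assms(1) by simp
    then show "C = C'" using assms(2) c(1,2) by (auto simp: distinct_map dest: inj_onD)
  qed
  then show ?thesis using assms(2) by (simp add: distinct_map comp_def)
qed

definition separated_prefix :: "(nat \<times> nat \<times> nat) list \<Rightarrow> (nat \<times> nat \<times> nat) list \<Rightarrow> nat \<Rightarrow> bool" where
  "separated_prefix os os' k = separated_tables (take k os) (take k os')"

text \<open>
  All prefixes of two orderings of rows are treated at once; the first row of each is hyperbolic, so every prefix
  contains a hyperbolic row.
\<close>

lemma beauville_certified_rows:
  assumes n: "n \<ge> 5" and v: "\<forall>C\<in>set L \<union> set L'. valid_cert n C"
    and w: "distinct (map (word_vector n ws) L)" "distinct (map (word_vector n ws) L')"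
    and len: "length L = K" "length L' = K"
    and hyp: "ords_sum_less_1 (cert_ords (hd L))" "ords_sum_less_1 (cert_ords (hd L'))"
    and k: "1 \<le> k" "k \<le> K"
    and sep: "separated_prefix (map cert_ords L) (map cert_ords L') k"
  shows "beauville_group (direct_power (alt_group n) k)"
proof -
  have rl: "row_list (alt_group n) (map (cert_row n) (take k M))"
    if m: "\<forall>C\<in>set M. valid_cert n C" "distinct (map (word_vector n ws) M)" "length M = K"
      "ords_sum_less_1 (cert_ords (hd M))" for M
  proof -
    have sub: "\<forall>C\<in>set (take k M). valid_cert n C" using m(1) set_take_subset by fast
    have "distinct (map (word_vector n ws) (take k M))" using m(2) unfolding take_map[symmetric] by (rule distinct_take)
    then have 1: "distinct (map (row_relators (alt_group n)) (map (cert_row n) (take k M)))"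
      by (rule distinct_word_vectors[OF sub])
    have ne: "M \<noteq> []" using m(3) k by auto
    have "hd M \<in> set (take k M)" using ne k by (cases M; cases k) auto
    moreover have "hyperbolic_row (alt_group n) (cert_row n (hd M))"
      by (rule cert_hyperbolic[OF _ m(4)]) (use m(1) ne in auto)
    moreover have "\<forall>r\<in>set (map (cert_row n) (take k M)). gen_row (alt_group n) r" using sub valid_cert(1) by auto
    ultimately show ?thesis using 1 unfolding row_list_def by auto
  qed
  show ?thesis
  proof (rule beauville_separated[OF alt_group_hyps[OF n]])
    show "row_list (alt_group n) (map (cert_row n) (take k L))" "row_list (alt_group n) (map (cert_row n) (take k L'))"
      using rl[of L] rl[of L'] v w len hyp by auto
    show "length (map (cert_row n) (take k L)) = k" "length (map (cert_row n) (take k L')) = k" using len k by simp_all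
    fix u u' :: nat assume u: "u < 3" "u' < 3"
    have col: "entry_ord (alt_group n) u (map (cert_row n) (take k M) ! i) = map (ord_col u) (take k (map cert_ords M)) ! i"
      if "\<forall>C\<in>set M. valid_cert n C" "length M = K" "u < 3" "i < k" for M i u
      using that k entry_ord_cert[of n "M ! i" u] by (simp add: take_map)
    let ?x = "map (ord_col u) (take k (map cert_ords L))" and ?y = "map (ord_col u') (take k (map cert_ords L'))"
    have "lseparated ?x ?y"
      by (rule separated_tables_columns[OF sep[unfolded separated_prefix_def] u])
    then have "p_separated {..<k} ((!) ?x) ((!) ?y)" by (rule lseparated) (use len k in simp_all)
    moreover have "p_full p {..<k} (\<lambda>i. entry_ord (alt_group n) u (map (cert_row n) (take k L) ! i)) = p_full p {..<k} ((!) ?x)"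
        "p_full p {..<k} (\<lambda>i. entry_ord (alt_group n) u' (map (cert_row n) (take k L') ! i)) = p_full p {..<k} ((!) ?y)" for p
      using col[of L u] col[of L' u'] v len u unfolding p_full_def by (simp_all cong: conj_cong)
    ultimately show "p_separated {..<k} (\<lambda>i. entry_ord (alt_group n) u (map (cert_row n) (take k L) ! i))
        (\<lambda>i. entry_ord (alt_group n) u' (map (cert_row n) (take k L') ! i))"
      unfolding p_separated_def by simp
  qed
qed

section \<open>Degree six\<close>

definition certs6 :: "certificate list" where
  "certs6 = [
    ([(1, 3, 4)], [(1, 4, 5), (2, 5, 6)], [True], 1, (3, 5, 5)),
    ([(1, 3, 4), (2, 5, 4), (4, 6, 5)], [(1, 5, 2), (2, 4, 6), (3, 5, 6)], [True, True, False, False, True, False], 1, (4, 4, 4)),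
    ([(2, 3, 5), (4, 5, 6)], [(1, 4, 2), (2, 3, 4)], [True, True, False, True, True, True, False, True, False], 2, (5, 2, 5)),
    ([(1, 2, 3), (3, 5, 4), (4, 6, 5)], [(1, 5, 4)], [False], 5, (4, 3, 5)),
    ([(1, 5, 3)], [(1, 3, 6), (2, 6, 4), (4, 5, 6)], [True], 1, (3, 4, 5)),
    ([(1, 4, 3), (3, 6, 5)], [(2, 3, 4)], [False], 2, (5, 3, 5))]"

lemma certs6_valid: "list_all (valid_cert 6) certs6"
  by code_simp

text \<open>
  Up to five coordinates are handled by prefixes of two explicit lists.  Beyond that the types \<open>(3, 4, 5)\<close> and
  \<open>(5, 2, 5)\<close> are unbalanced: the maximal 2-part 4 and the 3-part occur only in the first, and the factor 5 once in
  the first and twice in the second.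
\<close>

theorem beauville_alt_power_degree_6:
  assumes k: "1 \<le> k" "k \<le> d2 (alt_group 6)"
  shows "beauville_group (direct_power (alt_group 6) k)"
proof (cases "k \<le> 5")
  case True
  let ?L = "map ((!) certs6) [0, 1, 2, 3, 4]" and ?L' = "map ((!) certs6) [1, 5, 2, 3, 0]"
  let ?ws = "[[True, True, True], [True, True, True, True], [False, False, False, False]]"
  have "length certs6 = 6" by code_simp
  then have v: "\<forall>C\<in>set ?L \<union> set ?L'. valid_cert 6 C" using certs6_valid by (auto simp: list_all_length)
  have w: "distinct (map (word_vector 6 ?ws) ?L)" "distinct (map (word_vector 6 ?ws) ?L')"
    "ords_sum_less_1 (cert_ords (hd ?L))" "ords_sum_less_1 (cert_ords (hd ?L'))"
    by code_simp+
  have "list_all (separated_prefix (map cert_ords ?L) (map cert_ords ?L')) [1..<6]"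
    by code_simp
  then have "separated_prefix (map cert_ords ?L) (map cert_ords ?L') k"
    by (rule bspec[OF iffD1[OF list_all_iff]]) (use k(1) True in simp)
  then show ?thesis
    by (intro beauville_certified_rows[OF _ v w(1,2) _ _ w(3,4) k(1) True]) simp_all
next
  case False
  let ?H = "alt_group 6" and ?r = "cert_row 6 (certs6 ! 4)" and ?r' = "cert_row 6 (certs6 ! 2)"
  have "length certs6 = 6" by code_simp
  then have v: "valid_cert 6 (certs6 ! 4)" "valid_cert 6 (certs6 ! 2)"
    using certs6_valid by (auto simp: list_all_length)
  have o: "cert_ords (certs6 ! 4) = (3, 4, 5)" "cert_ords (certs6 ! 2) = (5, 2, 5)" by code_simp+
  have e: "entry_ord ?H 0 ?r = 3" "entry_ord ?H 1 ?r = 4" "entry_ord ?H 2 ?r = 5"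
    "entry_ord ?H 0 ?r' = 5" "entry_ord ?H 1 ?r' = 2" "entry_ord ?H 2 ?r' = 5"
    using valid_cert(2)[OF v(1) o(1)] valid_cert(2)[OF v(2) o(2)] by blast+
  have h: "hyperbolic_row ?H ?r"
    by (rule cert_hyperbolic[OF v(1)]) (unfold o, code_simp)
  have "3 \<in> ord_set ?H ?r" "3 \<notin> ord_set ?H ?r'" unfolding ord_set_def e by simp_all
  then have os: "ord_set ?H ?r \<noteq> ord_set ?H ?r'" by blast
  show ?thesis
  proof (rule beauville_large_power[OF alt_group_hyps[of 6] valid_cert(1)[OF v(1)] valid_cert(1)[OF v(2)] h _ _ os])
    fix p t :: nat
    assume p: "Factorial_Ring.prime p" and t: "t > 0"
      and le: "\<And>u. u < 3 \<Longrightarrow> multiplicity p (entry_ord ?H u ?r) \<le> t \<and> multiplicity p (entry_ord ?H u ?r') \<le> t"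
      and card: "card {u. u < 3 \<and> multiplicity p (entry_ord ?H u ?r) = t}
        = card {u. u < 3 \<and> multiplicity p (entry_ord ?H u ?r') = t}"
    show "card {u. u < (3::nat) \<and> multiplicity p (entry_ord ?H u ?r) = t} = 0"
    proof (cases "p \<in> {2, 3, 5}")
      case True
      note m = multiplicity_lval[OF True, of 2, simplified] multiplicity_lval[OF True, of 3, simplified]
        multiplicity_lval[OF True, of 4, simplified] multiplicity_lval[OF True, of 5, simplified]
      have le1: "multiplicity p 4 \<le> t" using le[of 1] unfolding e by simp
      from True consider "p = 2" | "p = 3" | "p = 5" by blast
      then show ?thesis
      proof cases
        case 1 then show ?thesis using card le1 t unfolding card_less_3 e m lval_def by (simp split: if_splits)
      next
        case 2 then show ?thesis using card le1 t unfolding card_less_3 e m lval_def by (simp split: if_splits)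
      next
        case 3 then show ?thesis using card le1 t unfolding card_less_3 e m lval_def by (simp split: if_splits)
      qed
    next
      case False
      have "multiplicity p x = 0" if "x \<in> {2, 3, 4, 5}" for x
        by (rule not_dvd_imp_multiplicity_0) (use prime_dvd_small[OF p that] False in blast)
      then have "multiplicity p 3 = 0" "multiplicity p 4 = 0" "multiplicity p 5 = 0" by blast+
      note m = this
      show ?thesis unfolding card_less_3 e m using t by simp
    qed
  qed (use False k(2) in \<open>simp_all add: e e[unfolded One_nat_def]\<close>)
qed

section \<open>Degree five\<close>

text \<open>
  One generating pair for each of the 19 kernels; the first entry is always one of three standard elements of orders
  three, two and five.
\<close>

definition certs5 :: "certificate list" where
  "certs5 = [
    ([(1, 2, 3)], [(3, 4, 5)], [True], 1, (3, 3, 5)),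
    ([(1, 2, 3)], [(2, 4, 3), (3, 5, 4)], [True], 1, (3, 2, 5)),
    ([(1, 2, 3)], [(1, 2, 3), (3, 4, 5)], [True], 1, (3, 5, 5)),
    ([(1, 2, 3)], [(1, 2, 4), (3, 5, 4)], [True], 1, (3, 5, 5)),
    ([(1, 2, 3)], [(1, 3, 4), (2, 4, 5)], [True], 1, (3, 5, 3)),
    ([(1, 2, 3)], [(1, 3, 5), (2, 4, 5)], [True], 1, (3, 5, 2)),
    ([(1, 2, 3), (2, 3, 4)], [(2, 3, 5)], [False], 5, (2, 3, 5)),
    ([(1, 2, 3), (2, 3, 4)], [(1, 2, 3), (3, 4, 5)], [False, True], 5, (2, 5, 3)),
    ([(1, 2, 3), (2, 3, 4)], [(1, 3, 2), (2, 4, 5)], [False, True, False], 5, (2, 5, 5)),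
    ([(1, 2, 3), (3, 4, 5)], [(3, 4, 5)], [False], 3, (5, 3, 5)),
    ([(1, 2, 3), (3, 4, 5)], [(3, 5, 4)], [False], 3, (5, 3, 3)),
    ([(1, 2, 3), (3, 4, 5)], [(2, 3, 4), (3, 4, 5)], [True, False], 1, (5, 2, 3)),
    ([(1, 2, 3), (3, 4, 5)], [(2, 3, 5)], [False], 2, (5, 3, 5)),
    ([(1, 2, 3), (3, 4, 5)], [(2, 4, 3), (3, 5, 4)], [True, True, False], 1, (5, 2, 5)),
    ([(1, 2, 3), (3, 4, 5)], [(2, 5, 3)], [False], 2, (5, 3, 2)),
    ([(1, 2, 3), (3, 4, 5)], [(1, 2, 3), (3, 5, 4)], [True, True, True, False], 1, (5, 5, 2)),
    ([(1, 2, 3), (3, 4, 5)], [(1, 2, 4), (3, 4, 5)], [True, True, False], 1, (5, 5, 5)),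
    ([(1, 2, 3), (3, 4, 5)], [(1, 2, 5), (3, 5, 4)], [True, False], 1, (5, 5, 3)),
    ([(1, 2, 3), (3, 4, 5)], [(1, 3, 5), (2, 5, 4)], [True, True, True, False], 4, (5, 5, 3))]"

text \<open>
  Words that tell the 19 kernels apart.
\<close>

definition words5 :: "bool list list" where
  "words5 = [
    [True, True, True, True, True],
    [False, False, False, False, False],
    [True, False, True, False, True, False, True, False, True, False],
    [True, True, False, True, True, False, True, True, False],
    [True, False, False, True, False, False, True, False, False],
    [True, True, False, False, True, True, False, False],
    [True, False, True, False]]"

lemma certs5_valid: "list_all (valid_cert 5) certs5"
  by code_simp

lemma certs5_distinct: "distinct (map (word_vector 5 words5) certs5)"
  by code_simp

lemma length_certs5: "length certs5 = 19"
  by code_simp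

lemma certs5_ords: "map cert_ords certs5 =
    [(3, 3, 5), (3, 2, 5), (3, 5, 5), (3, 5, 5), (3, 5, 3), (3, 5, 2), (2, 3, 5), (2, 5, 3), (2, 5,
    5), (5, 3, 5), (5, 3, 3), (5, 2, 3), (5, 3, 5), (5, 2, 5), (5, 3, 2), (5, 5, 2), (5, 5, 5), (5,
    5, 3), (5, 5, 3)]"
  by code_simp

lemma distinct_selection:
  assumes "distinct (map f xs)" "distinct js" "\<forall>j\<in>set js. j < length xs"
  shows "distinct (map f (map ((!) xs) js))"
proof -
  have "inj_on (\<lambda>j. f (xs ! j)) (set js)"
  proof (rule inj_onI)
    fix i j assume "i \<in> set js" "j \<in> set js" "f (xs ! i) = f (xs ! j)"
    then show "i = j" using assms(1,3) nth_eq_iff_index_eq[OF assms(1), of i j] by simp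
  qed
  then show ?thesis using assms(2) by (simp add: distinct_map comp_def)
qed

text \<open>
  Two orderings of the 19 order triples for which all prefixes of at least two rows are separated.
\<close>

lemma separated_orderings:
  "list_all (separated_prefix
    [(5, 3, 5), (5, 3, 5), (2, 5, 3), (3, 5, 3), (5, 2, 5), (2, 3, 5), (2, 5, 5), (3, 3, 5), (3, 5,
    5), (5, 2, 3), (3, 5, 2), (5, 3, 2), (5, 5, 3), (5, 3, 3), (5, 5, 2), (5, 5, 3), (3, 2, 5), (3,
    5, 5), (5, 5, 5)]
    [(3, 3, 5), (5, 5, 3), (5, 3, 5), (3, 5, 2), (5, 5, 2), (2, 5, 5), (2, 5, 3), (3, 5, 3), (5, 3,
    2), (5, 3, 5), (5, 3, 3), (5, 5, 5), (5, 5, 3), (2, 3, 5), (5, 2, 5), (5, 2, 3), (3, 5, 5), (3,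
    2, 5), (3, 5, 5)]) [2..<20]"
  by code_simp

theorem beauville_alt_power_degree_5:
  assumes k: "2 \<le> k" "k \<le> 19"
  shows "beauville_group (direct_power (alt_group 5) k)"
proof -
  define js js' :: "nat list" where "js = [9, 12, 7, 4, 13, 6, 8, 0, 2, 11, 5, 14, 17, 10, 15, 18, 1, 3, 16]"
    and "js' = [0, 18, 12, 5, 15, 8, 7, 4, 14, 9, 10, 16, 17, 6, 13, 11, 3, 1, 2]"
  define L L' where "L = map ((!) certs5) js" and "L' = map ((!) certs5) js'"
  have js: "distinct js" "\<forall>j\<in>set js. j < length certs5" "distinct js'" "\<forall>j\<in>set js'. j < length certs5"
    unfolding js_def js'_def length_certs5 by simp_all
  have v: "\<forall>C\<in>set L \<union> set L'. valid_cert 5 C"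
    using certs5_valid js(2,4) by (auto simp: list_all_length L_def L'_def)
  have w: "distinct (map (word_vector 5 words5) L)" "distinct (map (word_vector 5 words5) L')"
    unfolding L_def L'_def using distinct_selection[OF certs5_distinct] js by blast+
  have sel: "map cert_ords (map ((!) certs5) is) = map ((!) (map cert_ords certs5)) is"
    if "\<forall>j\<in>set is. j < length certs5" for "is"
    using that by simp
  have o: "map cert_ords L = [(5, 3, 5), (5, 3, 5), (2, 5, 3), (3, 5, 3), (5, 2, 5), (2, 3, 5), (2, 5, 5), (3, 3, 5), (3, 5,
    5), (5, 2, 3), (3, 5, 2), (5, 3, 2), (5, 5, 3), (5, 3, 3), (5, 5, 2), (5, 5, 3), (3, 2, 5), (3,
    5, 5), (5, 5, 5)]"
    "map cert_ords L' = [(3, 3, 5), (5, 5, 3), (5, 3, 5), (3, 5, 2), (5, 5, 2), (2, 5, 5), (2, 5, 3), (3, 5, 3), (5, 3,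
    2), (5, 3, 5), (5, 3, 3), (5, 5, 5), (5, 5, 3), (2, 3, 5), (5, 2, 5), (5, 2, 3), (3, 5, 5), (3,
    2, 5), (3, 5, 5)]"
    unfolding L_def L'_def sel[OF js(2)] sel[OF js(4)] unfolding certs5_ords js_def js'_def by simp_all
  have ne: "L \<noteq> []" "L' \<noteq> []" unfolding L_def L'_def js_def js'_def by simp_all
  have h: "ords_sum_less_1 (cert_ords (hd L))" "ords_sum_less_1 (cert_ords (hd L'))"
    unfolding hd_map[OF ne(1), symmetric] hd_map[OF ne(2), symmetric] o by (simp_all add: ords_sum_less_1_def)
  have "separated_prefix (map cert_ords L) (map cert_ords L') k"
    unfolding o by (rule bspec[OF separated_orderings[unfolded list_all_iff]]) (unfold set_upt atLeastLessThan_iff, use k in auto)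
  then show ?thesis
    using k by (intro beauville_certified_rows[OF _ v w _ _ h, of 19]) (simp_all add: L_def L'_def js_def js'_def)
qed

section \<open>The generating pairs of the alternating group of degree five\<close>

text \<open>
  Factorizations into three-cycles of the 60 elements.
\<close>

definition triples5 :: "(nat \<times> nat \<times> nat) list list" where
  "triples5 = [[], [(3, 4, 5)], [(3, 5, 4)], [(2, 3, 4), (3, 4, 5)], [(2, 3, 4)], [(2, 3, 5)], [(2, 4, 3)], [(2,
    4, 5)], [(2, 4, 3), (3, 5, 4)], [(2, 5, 3)], [(2, 5, 4)], [(2, 5, 3), (3, 4, 5)], [(1, 2, 4), (2, 4,
    5)], [(1, 2, 3), (2, 3, 4)], [(1, 2, 3), (2, 3, 5)], [(1, 2, 3)], [(1, 2, 3), (3, 4, 5)], [(1, 2,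
    3), (3, 5, 4)], [(1, 2, 4), (3, 4, 5)], [(1, 2, 4)], [(1, 2, 4), (3, 5, 4)], [(1, 2, 5), (3, 5, 4)],
    [(1, 2, 5)], [(1, 2, 5), (3, 4, 5)], [(1, 3, 2)], [(1, 3, 4), (2, 4, 5)], [(1, 3, 5), (2, 5, 4)],
    [(1, 3, 4), (3, 4, 5)], [(1, 3, 4)], [(1, 3, 5)], [(1, 3, 2), (2, 4, 3)], [(1, 3, 2), (2, 4, 5)],
    [(1, 3, 5), (2, 4, 5)], [(1, 3, 2), (2, 5, 3)], [(1, 3, 2), (2, 5, 4)], [(1, 3, 4), (2, 5, 4)], [(1,
    4, 5), (2, 5, 3)], [(1, 4, 2)], [(1, 4, 3), (2, 3, 5)], [(1, 4, 3)], [(1, 4, 5)], [(1, 4, 3), (3, 5,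
    4)], [(1, 4, 5), (2, 3, 5)], [(1, 4, 2), (2, 3, 4)], [(1, 4, 2), (2, 3, 5)], [(1, 4, 2), (2, 5, 3)],
    [(1, 4, 3), (2, 5, 3)], [(1, 4, 2), (2, 5, 4)], [(1, 5, 4), (2, 4, 3)], [(1, 5, 2)], [(1, 5, 3), (2,
    3, 4)], [(1, 5, 3)], [(1, 5, 4)], [(1, 5, 3), (3, 4, 5)], [(1, 5, 4), (2, 3, 4)], [(1, 5, 2), (2, 3,
    5)], [(1, 5, 2), (2, 3, 4)], [(1, 5, 2), (2, 4, 3)], [(1, 5, 3), (2, 4, 3)], [(1, 5, 2), (2, 4, 5)]]"

definition elems5 :: "nat list list" where
  "elems5 = map (lprod 5) triples5"

text \<open>
  Representatives of the conjugacy classes under the symmetric group, and permutations conjugating each element to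
  one of them.
\<close>

definition classes5 :: "nat list list" where
  "classes5 = [[2, 3, 1, 4, 5], [2, 1, 4, 3, 5], [2, 3, 4, 5, 1], [1, 2, 3, 4, 5]]"

definition conjugators5 :: "nat list list" where
  "conjugators5 = [[1, 2, 3, 4, 5], [1, 2, 4, 5, 3], [1, 2, 5, 3, 4], [1, 3, 2, 4, 5], [1, 3, 4, 2, 5], [1, 3, 4, 5,
    2], [1, 4, 2, 5, 3], [1, 4, 5, 2, 3], [1, 4, 5, 3, 2], [1, 5, 2, 3, 4], [1, 5, 3, 2, 4], [1, 5, 3,
    4, 2], [5, 1, 2, 4, 3], [5, 1, 3, 2, 4], [5, 1, 4, 3, 2], [4, 1, 3, 5, 2], [5, 2, 4, 3, 1], [5, 3,
    1, 2, 4], [5, 4, 1, 3, 2], [5, 4, 3, 1, 2], [1, 3, 2, 5, 4], [1, 4, 3, 2, 5], [1, 4, 3, 5, 2], [1,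
    5, 4, 3, 2]]"

text \<open>
  The centralizer of each nontrivial representative in the symmetric group, as a list of permutations with their
  inverses.  The identity gets the empty list, as it belongs to no generating pair.
\<close>

definition centralizers5 :: "(nat list \<times> (nat list \<times> nat list) list) list" where
  "centralizers5 = [([2, 3, 1, 4, 5], [([1, 2, 3, 4, 5], [1, 2, 3, 4, 5]), ([1, 2, 3, 5, 4], [1, 2, 3, 5, 4]), ([2, 3,
    1, 4, 5], [3, 1, 2, 4, 5]), ([2, 3, 1, 5, 4], [3, 1, 2, 5, 4]), ([3, 1, 2, 4, 5], [2, 3, 1, 4, 5]),
    ([3, 1, 2, 5, 4], [2, 3, 1, 5, 4])]), ([2, 1, 4, 3, 5], [([1, 2, 3, 4, 5], [1, 2, 3, 4, 5]), ([1, 2,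
    4, 3, 5], [1, 2, 4, 3, 5]), ([2, 1, 3, 4, 5], [2, 1, 3, 4, 5]), ([2, 1, 4, 3, 5], [2, 1, 4, 3, 5]),
    ([3, 4, 1, 2, 5], [3, 4, 1, 2, 5]), ([3, 4, 2, 1, 5], [4, 3, 1, 2, 5]), ([4, 3, 1, 2, 5], [3, 4, 2,
    1, 5]), ([4, 3, 2, 1, 5], [4, 3, 2, 1, 5])]), ([2, 3, 4, 5, 1], [([1, 2, 3, 4, 5], [1, 2, 3, 4, 5]),
    ([2, 3, 4, 5, 1], [5, 1, 2, 3, 4]), ([3, 4, 5, 1, 2], [4, 5, 1, 2, 3]), ([4, 5, 1, 2, 3], [3, 4, 5,
    1, 2]), ([5, 1, 2, 3, 4], [2, 3, 4, 5, 1])]), ([1, 2, 3, 4, 5], [])]"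

text \<open>
  Every proper subgroup is contained in the stabilizer of one of these sets of ordered pairs of points: the pairs
  with a fixed first point, the pairs inside a set of two points, and the edges of a pentagon in both directions.  Their
  stabilizers in the alternating group are tetrahedral groups, groups of order six and dihedral groups of order ten.
\<close>

definition blocks5 :: "(nat \<times> nat) list list" where
  "blocks5 = [[(1, 2), (1, 3), (1, 4), (1, 5)], [(2, 1), (2, 3), (2, 4), (2, 5)], [(3, 1), (3, 2), (3, 4), (3,
    5)], [(4, 1), (4, 2), (4, 3), (4, 5)], [(5, 1), (5, 2), (5, 3), (5, 4)], [(1, 2), (2, 1)], [(1, 3),
    (3, 1)], [(1, 4), (4, 1)], [(1, 5), (5, 1)], [(2, 3), (3, 2)], [(2, 4), (4, 2)], [(2, 5), (5, 2)],
    [(3, 4), (4, 3)], [(3, 5), (5, 3)], [(4, 5), (5, 4)], [(1, 2), (2, 3), (3, 4), (4, 5), (5, 1), (2,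
    1), (3, 2), (4, 3), (5, 4), (1, 5)], [(1, 2), (2, 3), (3, 5), (4, 1), (5, 4), (2, 1), (3, 2), (5,
    3), (1, 4), (4, 5)], [(1, 2), (2, 4), (3, 1), (4, 5), (5, 3), (2, 1), (4, 2), (1, 3), (5, 4), (3,
    5)], [(1, 2), (2, 4), (3, 5), (4, 3), (5, 1), (2, 1), (4, 2), (5, 3), (3, 4), (1, 5)], [(1, 2), (2,
    5), (3, 1), (4, 3), (5, 4), (2, 1), (5, 2), (1, 3), (3, 4), (4, 5)], [(1, 2), (2, 5), (3, 4), (4,
    1), (5, 3), (2, 1), (5, 2), (4, 3), (1, 4), (3, 5)]]"

definition linv_pair :: "nat \<Rightarrow> nat list \<times> nat list \<Rightarrow> bool" where
  "linv_pair n ss = (case ss of (s, s') \<Rightarrow> length s = n \<and> length s' = n \<and>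
     list_all (\<lambda>i. 1 \<le> i \<and> i \<le> n) s \<and> list_all (\<lambda>i. 1 \<le> i \<and> i \<le> n) s' \<and>
     lcomp s s' = [1..<Suc n] \<and> lcomp s' s = [1..<Suc n])"

definition lperm_pair :: "nat list \<Rightarrow> nat \<times> nat \<Rightarrow> nat \<times> nat" where
  "lperm_pair xs ij = (case ij of (i, j) \<Rightarrow> (lperm xs i, lperm xs j))"

definition stabilizes :: "(nat \<times> nat) list \<Rightarrow> nat list \<Rightarrow> bool" where
  "stabilizes T xs = list_all (List.member T) (map (lperm_pair xs) T)"

definition both_stabilize :: "nat list \<Rightarrow> nat list \<Rightarrow> (nat \<times> nat) list \<Rightarrow> bool" where
  "both_stabilize xs ys T = (stabilizes T xs \<and> stabilizes T ys)"

definition moved_by_some :: "nat list list \<Rightarrow> (nat \<times> nat) list \<Rightarrow> bool" where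
  "moved_by_some xss T = (\<not> list_all (stabilizes T) xss)"

definition lconj :: "nat list \<Rightarrow> nat list \<times> nat list \<Rightarrow> nat list" where
  "lconj ys ss = (case ss of (s, s') \<Rightarrow> lcomp s (lcomp ys s'))"

definition orbit_of :: "nat list \<times> (nat list \<times> nat list) list \<Rightarrow> certificate \<Rightarrow> nat list list" where
  "orbit_of rS C = (case rS of (r, S) \<Rightarrow> case C of (ts, us, _) \<Rightarrow>
     if lprod 5 ts = r then map (lconj (lprod 5 us)) S else [])"

text \<open>
  Given the first entry \<open>r\<close>, a second entry either completes it to a conjugate of one of the 19 pairs or preserves a
  common set of pairs of points with it.
\<close>

definition covered :: "nat list \<Rightarrow> nat list list \<Rightarrow> nat list \<Rightarrow> bool" where
  "covered r good ys = (List.member good ys \<or> list_ex (both_stabilize r ys) blocks5)"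

definition centralizes :: "nat list \<Rightarrow> nat list \<times> nat list \<Rightarrow> bool" where
  "centralizes r ss = (linv_pair 5 ss \<and> lcomp (fst ss) r = lcomp r (fst ss))"

definition class_covered :: "nat list \<times> (nat list \<times> nat list) list \<Rightarrow> bool" where
  "class_covered rS = (list_all (centralizes (fst rS)) (snd rS) \<and>
     list_all (covered (fst rS) (concat (map (orbit_of rS) certs5))) elems5)"

definition conjugates_to :: "nat list \<Rightarrow> nat list \<Rightarrow> nat list \<Rightarrow> bool" where
  "conjugates_to xs s r = (lcomp s xs = lcomp r s)"

definition conjugate_to_class :: "nat list \<Rightarrow> bool" where
  "conjugate_to_class xs = list_ex (\<lambda>s. list_ex (conjugates_to xs s) classes5) conjugators5"

lemma elems5_checks:
  "length elems5 = 60" "distinct elems5"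
  by code_simp+

lemma blocks5_proper: "list_all (moved_by_some elems5) blocks5"
  by code_simp

lemma conjugators5_check: "list_all (\<lambda>s. distinct s \<and> length s = 5 \<and> list_all (\<lambda>i. 1 \<le> i \<and> i \<le> 5) s) conjugators5"
  by code_simp

lemma elems5_classes: "list_all conjugate_to_class elems5"
  by code_simp

lemma classes_covered: "list_all class_covered centralizers5"
  by code_simp

lemma classes5_centralizers5: "classes5 = map fst centralizers5"
  by code_simp

lemma triples5_valid: "list_all (list_all (ltriple 5)) triples5"
  by code_simp

lemma lperm_outside: "xs \<in> lists_of n \<Longrightarrow> i \<notin> {1..n} \<Longrightarrow> lperm xs i = i"
  by (auto simp: lperm_def lists_of_def)

lemma lperm_permutes:
  assumes "distinct s" "s \<in> lists_of n"
  shows "lperm s permutes {1..n}"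
proof (rule bij_imp_permutes)
  have l: "length s = n" "set s \<subseteq> {1..n}" using assms(2) by (simp_all add: lists_of_def)
  have a: "lperm s i = s ! (i - 1)" "i - 1 < length s" if "i \<in> {1..n}" for i
    using that l by (auto simp: lperm_def)
  have inj: "inj_on (lperm s) {1..n}"
  proof (rule inj_onI)
    fix i j assume ij: "i \<in> {1..n}" "j \<in> {1..n}" "lperm s i = lperm s j"
    then have "s ! (i - 1) = s ! (j - 1)" using a(1) by simp
    then have "i - 1 = j - 1" using nth_eq_iff_index_eq[OF assms(1) a(2)[OF ij(1)] a(2)[OF ij(2)]] by simp
    then show "i = j" using ij(1,2) by auto
  qed
  have "lperm s ` {1..n} \<subseteq> {1..n}"
  proof (rule image_subsetI)
    fix i assume i: "i \<in> {1..n}"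
    show "lperm s i \<in> {1..n}" unfolding a(1)[OF i] by (rule subsetD[OF l(2) nth_mem[OF a(2)[OF i]]])
  qed
  then show "bij_betw (lperm s) {1..n} {1..n}"
    unfolding bij_betw_def using inj endo_inj_surj[OF _ _ inj] by simp
qed (rule lperm_outside[OF assms(2)])

lemma eval_word_under_hom:
  assumes "group_hom G H h" and x: "x \<in> carrier G" "y \<in> carrier G"
  shows "eval_word H (h x) (h y) w = h (eval_word G x y w)"
proof (induction w)
  case Nil
  interpret group_hom G H h by fact
  show ?case by simp
next
  case (Cons l w)
  interpret group_hom G H h by fact
  have "eval_letter H (h x) (h y) l = h (eval_letter G x y l)"
    using x by (simp add: eval_letter_def Let_def)
  then show ?case using Cons x by (simp add: G.eval_letter_closed G.eval_word_closed)
qed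

lemma relators_under_inj_hom:
  assumes h: "group_hom G H h" "inj_on h (carrier G)" and x: "x \<in> carrier G" "y \<in> carrier G"
  shows "relators H (h x) (h y) = relators G x y"
proof -
  interpret group_hom G H h by fact
  have "h (eval_word G x y w) = \<one>\<^bsub>H\<^esub> \<longleftrightarrow> eval_word G x y w = \<one>\<^bsub>G\<^esub>" for w
    using inj_onD[OF h(2), of "eval_word G x y w" "\<one>\<^bsub>G\<^esub>"] G.eval_word_closed[OF x] by auto
  then show ?thesis unfolding relators_def eval_word_under_hom[OF h(1) x] by simp
qed

context
  fixes n :: nat and g :: "nat \<Rightarrow> nat"
  assumes g: "g permutes {1..n}"
begin

definition conj_by :: "(nat \<Rightarrow> nat) \<Rightarrow> nat \<Rightarrow> nat" where
  "conj_by p = g \<circ> p \<circ> inv' g"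

lemma conj_by_closed:
  assumes "p \<in> carrier (alt_group n)"
  shows "conj_by p \<in> carrier (alt_group n)"
proof -
  have p: "p permutes {1..n}" "evenperm p" using assms by (simp_all add: alt_group_carrier)
  have perm: "permutation g" "permutation p" "permutation (inv' g)" "permutation (g \<circ> p)"
    using g p(1) permutes_inv[OF g] permutes_compose[OF p(1) g] by (auto simp: permutation_permutes)
  have "evenperm (g \<circ> p \<circ> inv' g)"
    using evenperm_comp[OF perm(4,3)] evenperm_comp[OF perm(1,2)] evenperm_inv[OF perm(1)] p(2) by simp
  moreover have "g \<circ> p \<circ> inv' g permutes {1..n}"
    by (rule permutes_compose[OF permutes_inv[OF g] permutes_compose[OF p(1) g]])
  ultimately show ?thesis unfolding alt_group_carrier conj_by_def by blast
qed

lemma conj_by_mult: "conj_by (p \<circ> q) = conj_by p \<circ> conj_by q"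
proof -
  have "inv' g (g i) = i" for i by (rule permutes_inverses(2)[OF g])
  then show ?thesis by (simp add: conj_by_def fun_eq_iff)
qed

lemma conj_by_hom: "group_hom (alt_group n) (alt_group n) conj_by"
  by (intro group_hom.intro group_hom_axioms.intro alt_group_is_group homI)
    (simp_all only: conj_by_closed alt_group_mult_apply conj_by_mult)

lemma conj_by_inj: "inj_on conj_by (carrier (alt_group n))"
proof (rule inj_onI)
  fix p q assume "conj_by p = conj_by q"
  then have "inv' g (conj_by p (g i)) = inv' g (conj_by q (g i))" for i by simp
  then show "p = q" by (simp add: conj_by_def permutes_inverses[OF g] fun_eq_iff)
qed

text \<open>
  Conjugation by a permutation of either sign is an automorphism of the alternating group, so it preserves kernels.
\<close>

lemma relators_conj_by:
  assumes "x \<in> carrier (alt_group n)" "y \<in> carrier (alt_group n)"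
  shows "relators (alt_group n) (conj_by x) (conj_by y) = relators (alt_group n) x y"
  by (rule relators_under_inj_hom[OF conj_by_hom conj_by_inj assms])

lemma gen_pair_conj_by:
  assumes "gen_pair (alt_group n) x y"
  shows "gen_pair (alt_group n) (conj_by x) (conj_by y)"
proof -
  interpret group_hom "alt_group n" "alt_group n" conj_by by (rule conj_by_hom)
  have x: "x \<in> carrier (alt_group n)" "y \<in> carrier (alt_group n)" using assms by (auto simp: gen_pair_def)
  have "generate (alt_group n) {conj_by x, conj_by y} = eval_word (alt_group n) (conj_by x) (conj_by y) ` carrier F2"
    by (rule G.image_eval_word[symmetric]) (rule conj_by_closed; rule x)+
  also have "\<dots> = conj_by ` (eval_word (alt_group n) x y ` carrier F2)"
    unfolding eval_word_under_hom[OF conj_by_hom x] image_image ..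
  also have "\<dots> = conj_by ` carrier (alt_group n)" unfolding G.gen_pair_image[OF assms] ..
  also have "\<dots> = carrier (alt_group n)"
    by (rule endo_inj_surj[OF finite_alt_group _ conj_by_inj]) (auto intro: conj_by_closed)
  finally show ?thesis using x by (simp add: gen_pair_def conj_by_closed)
qed

lemma conj_by_eqI: "g \<circ> p = q \<circ> g \<Longrightarrow> conj_by p = q"
  using permutes_inv_o(1)[OF g] by (simp add: conj_by_def comp_assoc)

end

definition map_pair :: "(nat \<Rightarrow> nat) \<Rightarrow> nat \<times> nat \<Rightarrow> nat \<times> nat" where
  "map_pair p = (\<lambda>(i, j). (p i, p j))"

lemma map_pair_comp: "map_pair (p \<circ> q) ` T = map_pair p ` map_pair q ` T"
proof -
  have "map_pair (p \<circ> q) = map_pair p \<circ> map_pair q" by (simp add: map_pair_def fun_eq_iff)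
  then show ?thesis by (simp only: image_comp)
qed

lemma map_pair_id: "map_pair id ` T = T"
  by (simp add: map_pair_def case_prod_eta)

lemma stabilizer_subgroup:
  "subgroup {p \<in> carrier (alt_group n). map_pair p ` T = T} (alt_group n)"
proof -
  interpret group "alt_group n" by (rule alt_group_is_group)
  show ?thesis
  proof (rule subgroupI)
    have "id \<in> {p \<in> carrier (alt_group n). map_pair p ` T = T}"
      using one_closed map_pair_id[of T] unfolding alt_group_one by blast
    then show "{p \<in> carrier (alt_group n). map_pair p ` T = T} \<noteq> {}" by blast
    fix p assume p: "p \<in> {p \<in> carrier (alt_group n). map_pair p ` T = T}"
    have "inv' p \<circ> p = id" using p alt_group_bij[of p n] by (auto intro: inv_o_cancel bij_is_inj)
    then have "map_pair (inv' p) ` map_pair p ` T = T"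
      unfolding map_pair_comp[symmetric] by (simp only: map_pair_id)
    then have "map_pair (inv' p) ` T = T" using p by simp
    then show "inv\<^bsub>alt_group n\<^esub> p \<in> {p \<in> carrier (alt_group n). map_pair p ` T = T}"
      using p alt_group_inv_equality[of p n] inv_closed[of p] by simp
    fix q assume q: "q \<in> {p \<in> carrier (alt_group n). map_pair p ` T = T}"
    have "map_pair (p \<circ> q) ` T = T" using p q unfolding map_pair_comp by simp
    then show "p \<otimes>\<^bsub>alt_group n\<^esub> q \<in> {p \<in> carrier (alt_group n). map_pair p ` T = T}"
      using p q m_closed[of p q] unfolding alt_group_mult_apply by blast
  qed blast
qed

lemma stabilizes_iff:
  assumes "lperm xs \<in> carrier (alt_group n)"
  shows "stabilizes T xs \<longleftrightarrow> map_pair (lperm xs) ` set T = set T"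
proof -
  have "inj (lperm xs)" using alt_group_bij[OF assms] by (rule bij_is_inj)
  then have inj: "inj_on (map_pair (lperm xs)) (set T)" by (auto simp: inj_on_def map_pair_def dest: injD)
  have "stabilizes T xs \<longleftrightarrow> map_pair (lperm xs) ` set T \<subseteq> set T"
    by (auto simp: stabilizes_def list_all_iff lperm_pair_def map_pair_def)
  then show ?thesis using endo_inj_surj[OF _ _ inj] by auto
qed

lemma elems5_in: "xs \<in> set elems5 \<Longrightarrow> xs \<in> lists_of 5 \<and> lperm xs \<in> carrier (alt_group 5)"
  using triples5_valid by (auto simp: elems5_def list_all_iff intro!: lprod_lists_of lperm_lprod)

lemma alt_group_5_elements:
  assumes "p \<in> carrier (alt_group 5)"
  obtains xs where "xs \<in> set elems5" "p = lperm xs"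
proof -
  have "inj_on lperm (set elems5)"
  proof (rule inj_onI)
    fix xs ys assume "xs \<in> set elems5" "ys \<in> set elems5" "lperm xs = lperm ys"
    then show "xs = ys" using lperm_inj[of xs 5 ys] elems5_in by simp
  qed
  then have "card (lperm ` set elems5) = 60"
    using distinct_card[OF elems5_checks(2)] elems5_checks(1) by (simp add: card_image)
  moreover have "2 * card (carrier (alt_group 5)) = fact 5" by (rule alt_group_card_carrier) simp
  moreover have "(fact 5 :: nat) = 120" by (simp add: fact_numeral)
  moreover have "lperm ` set elems5 \<subseteq> carrier (alt_group 5)" using elems5_in by blast
  ultimately have "lperm ` set elems5 = carrier (alt_group 5)"
    by (intro card_subset_eq[OF finite_alt_group]) simp_all
  then show thesis using assms that by blast
qed

text \<open>
  Some element does not preserve \<open>T\<close>, so the stabilizer is a proper subgroup.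
\<close>

lemma not_gen_pair_if_both_stabilize:
  assumes T: "T \<in> set blocks5" "both_stabilize xs ys T"
  shows "\<not> gen_pair (alt_group 5) (lperm xs) (lperm ys)"
proof
  assume g: "gen_pair (alt_group 5) (lperm xs) (lperm ys)"
  interpret group "alt_group 5" by (rule alt_group_is_group)
  let ?K = "{p \<in> carrier (alt_group 5). map_pair p ` set T = set T}"
  have c: "lperm xs \<in> carrier (alt_group 5)" "lperm ys \<in> carrier (alt_group 5)" using g by (auto simp: gen_pair_def)
  have "?K = carrier (alt_group 5)"
    by (rule gen_pair_subgroupD[OF g stabilizer_subgroup])
      (use c T(2) stabilizes_iff in \<open>auto simp: both_stabilize_def\<close>)
  moreover obtain zs where "zs \<in> set elems5" "\<not> stabilizes T zs"
    using blocks5_proper T(1) by (auto simp: list_all_iff moved_by_some_def)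
  ultimately show False using elems5_in stabilizes_iff by blast
qed

lemma valid_cert_lists:
  assumes "valid_cert n (ts, us, rest)"
  shows "lprod n ts \<in> lists_of n" "lprod n us \<in> lists_of n"
    "lperm (lprod n ts) \<in> carrier (alt_group n)" "lperm (lprod n us) \<in> carrier (alt_group n)"
proof -
  have "list_all (ltriple n) ts \<and> list_all (ltriple n) us"
    using assms unfolding valid_cert_def by (auto split: prod.splits)
  then show "lprod n ts \<in> lists_of n" "lprod n us \<in> lists_of n"
    "lperm (lprod n ts) \<in> carrier (alt_group n)" "lperm (lprod n us) \<in> carrier (alt_group n)"
    by (simp_all add: lprod_lists_of lperm_lprod list_all_iff)
qed

lemma linv_pair:
  assumes "linv_pair n (s, s')"
  shows "s \<in> lists_of n" "s' \<in> lists_of n" "lperm s permutes {1..n}" "inv' (lperm s) = lperm s'"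
proof -
  show l: "s \<in> lists_of n" "s' \<in> lists_of n" using assms by (auto simp: linv_pair_def lists_of_def list_all_iff)
  have i: "lperm s \<circ> lperm s' = id" "lperm s' \<circ> lperm s = id"
  proof -
    have e: "lcomp s s' = [1..<Suc n]" "lcomp s' s = [1..<Suc n]"
      using assms by (simp_all only: linv_pair_def prod.case)
    show "lperm s \<circ> lperm s' = id" "lperm s' \<circ> lperm s = id"
      unfolding lperm_lcomp[OF l, symmetric] lperm_lcomp[OF l(2,1), symmetric] e by (rule lperm_upt)+
  qed
  show "inv' (lperm s) = lperm s'" by (rule inv_unique_comp[OF i])
  show "lperm s permutes {1..n}"
    unfolding permutes_def using lperm_outside[OF l(1)] o_bij[OF i(2,1)] by (simp add: bij_iff)
qed

text \<open>
  A first conjugation brings \<open>x\<close> to its representative; a second one, in the centralizer of the representative, brings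
  the image of \<open>y\<close> to the second entry of a listed pair.
\<close>

lemma relators_alt_group_5:
  assumes g: "gen_pair (alt_group 5) x y"
  shows "relators (alt_group 5) x y \<in> (\<lambda>C. row_relators (alt_group 5) (cert_row 5 C)) ` set certs5"
proof -
  let ?H = "alt_group 5"
  have x: "x \<in> carrier ?H" "y \<in> carrier ?H" using g by (auto simp: gen_pair_def)
  obtain xs where xs: "xs \<in> set elems5" "x = lperm xs" by (rule alt_group_5_elements[OF x(1)])
  obtain s r where s: "s \<in> set conjugators5" and r: "r \<in> set classes5" and eq: "lcomp s xs = lcomp r s"
    using elems5_classes xs(1) by (auto simp: list_all_iff list_ex_iff conjugate_to_class_def conjugates_to_def)
  have sl: "s \<in> lists_of 5" "distinct s" using conjugators5_check s by (auto simp: list_all_iff lists_of_def)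
  have rl: "r \<in> lists_of 5" using r by (auto simp: classes5_def lists_of_def)
  have p: "lperm s permutes {1..5}" by (rule lperm_permutes[OF sl(2,1)])
  have "lperm s \<circ> x = lperm r \<circ> lperm s"
    unfolding xs(2) lperm_lcomp[OF sl(1) conjunct1[OF elems5_in[OF xs(1)]], symmetric] lperm_lcomp[OF rl sl(1), symmetric] eq ..
  then have cx: "conj_by (lperm s) x = lperm r" by (rule conj_by_eqI[OF p])
  obtain ys where ys: "ys \<in> set elems5" "conj_by (lperm s) y = lperm ys"
    by (rule alt_group_5_elements[OF conj_by_closed[OF p x(2)]])
  have rel: "relators ?H (lperm r) (lperm ys) = relators ?H x y"
    using relators_conj_by[OF p x] unfolding cx ys(2) .
  have gen: "gen_pair ?H (lperm r) (lperm ys)"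
    using gen_pair_conj_by[OF p g] unfolding cx ys(2) .
  obtain S where S: "(r, S) \<in> set centralizers5" using r unfolding classes5_centralizers5 by auto
  have cov: "list_all (centralizes r) S" "covered r (concat (map (orbit_of (r, S)) certs5)) ys"
    using classes_covered S ys(1) by (auto simp: list_all_iff class_covered_def)
  have "\<not> list_ex (both_stabilize r ys) blocks5"
    using not_gen_pair_if_both_stabilize gen by (auto simp: list_ex_iff)
  then have "ys \<in> set (concat (map (orbit_of (r, S)) certs5))" using cov(2) by (simp add: covered_def)
  then obtain C where C: "C \<in> set certs5" "ys \<in> set (orbit_of (r, S) C)" by auto
  obtain ts us rest where Ceq: "C = (ts, us, rest)" by (cases C)
  have "lprod 5 ts = r" "ys \<in> set (map (lconj (lprod 5 us)) S)"
    using C(2) unfolding orbit_of_def Ceq by (auto split: if_splits)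
  then obtain c c' where c: "(c, c') \<in> set S" "ys = lcomp c (lcomp (lprod 5 us) c')" "lprod 5 ts = r"
    by (auto simp: lconj_def)
  have cen: "linv_pair 5 (c, c')" "lcomp c r = lcomp r c"
    using cov(1) c(1) by (auto simp: list_all_iff centralizes_def)
  note lc = linv_pair[OF cen(1)]
  have v: "valid_cert 5 (ts, us, rest)" using certs5_valid C(1) unfolding Ceq by (auto simp: list_all_iff)
  note vl = valid_cert_lists[OF v]
  have "lperm c \<circ> lperm r = lperm r \<circ> lperm c"
    unfolding lperm_lcomp[OF lc(1) rl, symmetric] lperm_lcomp[OF rl lc(1), symmetric] cen(2) ..
  then have 1: "conj_by (lperm c) (lperm r) = lperm r" by (rule conj_by_eqI[OF lc(3)])
  have 2: "conj_by (lperm c) (lperm (lprod 5 us)) = lperm ys"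
    unfolding c(2) lperm_lcomp[OF lc(1) lcomp_lists_of[OF vl(2) lc(2)]] lperm_lcomp[OF vl(2) lc(2)]
      conj_by_def[OF lc(3)] lc(4) comp_assoc ..
  have "relators ?H (lperm r) (lperm ys) = row_relators ?H (cert_row 5 C)"
    using relators_conj_by[OF lc(3) vl(3,4)] unfolding c(3) 1 2 by (simp add: cert_row_def Ceq c(3))
  then show ?thesis using rel C(1) by auto
qed

theorem d2_alt_group_5: "d2 (alt_group 5) = 19"
proof -
  let ?H = "alt_group 5" and ?f = "\<lambda>C. row_relators (alt_group 5) (cert_row 5 C)"
  interpret group ?H by (rule alt_group_is_group)
  have v: "\<forall>C\<in>set certs5. valid_cert 5 C" using certs5_valid by (simp add: list_all_iff)
  have "{relators ?H x y | x y. gen_pair ?H x y} = ?f ` set certs5"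
  proof (intro equalityI subsetI)
    fix N assume "N \<in> {relators ?H x y | x y. gen_pair ?H x y}"
    then obtain x y where "N = relators ?H x y" "gen_pair ?H x y" by blast
    then show "N \<in> ?f ` set certs5" using relators_alt_group_5[of x y] by simp
  next
    fix N assume "N \<in> ?f ` set certs5"
    then obtain C where C: "C \<in> set certs5" "N = ?f C" by blast
    have "valid_cert 5 C" using v C(1) by blast
    then have "gen_pair ?H (fst (cert_row 5 C)) (snd (cert_row 5 C))"
      using valid_cert(1)[of 5 C] by (simp add: gen_row_def)
    then show "N \<in> {relators ?H x y | x y. gen_pair ?H x y}" using C(2) by blast
  qed
  moreover have "card (set (map (row_relators ?H) (map (cert_row 5) certs5))) = length certs5"
    using distinct_card[OF distinct_word_vectors[OF v certs5_distinct]] by simp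
  ultimately show ?thesis
    unfolding d2_eq_card_relators length_certs5 by (simp add: image_image)
qed

section \<open>The alternating group of degree five is not a Beauville group\<close>

lemma beauville_two_generator:
  fixes G (structure)
  assumes "beauville_group G"
  shows "two_generator_group G"
proof -
  interpret group G using assms by (simp add: beauville_group_def)
  obtain a b c where "hyperbolic_generating_triple G a b c" using assms unfolding beauville_group_def by blast
  then have abc: "a \<in> carrier G" "b \<in> carrier G" "c \<in> carrier G" "generate G {a, b, c} = carrier G"
    "a \<otimes> b \<otimes> c = \<one>" by (auto simp: hyperbolic_generating_triple_def)
  have sub: "subgroup (generate G {a, b}) G" by (rule generate_is_subgroup) (use abc in auto)
  have ab: "a \<in> generate G {a, b}" "b \<in> generate G {a, b}" by (auto intro: generate.incl)
  have "c = inv (a \<otimes> b)" using abc by (metis inv_equality inv_inv m_closed inv_closed)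
  then have "c \<in> generate G {a, b}" using subgroup.m_inv_closed[OF sub subgroup.m_closed[OF sub ab]] by simp
  then have "generate G {a, b, c} \<subseteq> generate G {a, b}" by (intro generate_subgroup_incl[OF _ sub]) (use ab in blast)
  then have "generate G {a, b} = carrier G" using abc(4) subgroup.subset[OF sub] by blast
  then show ?thesis using abc(1,2) is_group unfolding two_generator_group_def by blast
qed

text \<open>
  Three elements of orders at most three do not form a hyperbolic triple.  So each of the two triples has an entry with
  a power conjugate to \<open>c\<close>, and these two powers are conjugate to each other.
\<close>

lemma (in group) not_beauville_one_class:
  assumes c: "c \<in> carrier G" "c \<noteq> \<one>"
    and cls: "\<And>u. u \<in> carrier G \<Longrightarrow> u [^] (2 :: nat) = \<one> \<or> u [^] (3 :: nat) = \<one>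
      \<or> (\<exists>g\<in>carrier G. \<exists>m :: nat. g \<otimes> u [^] m \<otimes> inv g = c)"
  shows "\<not> beauville_group G"
proof
  assume B: "beauville_group G"
  have fin: "finite (carrier G)" using B by (simp add: beauville_group_def)
  have big: "\<exists>u\<in>{x, y, z}. \<exists>g\<in>carrier G. \<exists>m :: nat. g \<otimes> u [^] m \<otimes> inv g = c"
    if t: "hyperbolic_generating_triple G x y z" for x y z
  proof (rule ccontr)
    assume no: "\<not> ?thesis"
    have third: "1 / real (ord u) \<ge> 1 / 3" if u: "u \<in> {x, y, z}" for u
    proof -
      have uc: "u \<in> carrier G" using u t by (auto simp: hyperbolic_generating_triple_def)
      have "u [^] (2 :: nat) = \<one> \<or> u [^] (3 :: nat) = \<one>" using cls[OF uc] no u by blast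
      then have "ord u dvd 2 \<or> ord u dvd 3" using pow_eq_id[OF uc] by simp
      then have "ord u \<le> 3" using dvd_imp_le[of "ord u" 2] dvd_imp_le[of "ord u" 3] by auto
      moreover have "ord u \<ge> 1" by (rule ord_ge_1[OF fin uc])
      ultimately show ?thesis by (simp add: field_simps)
    qed
    have "1 / real (ord x) + 1 / real (ord y) + 1 / real (ord z) \<ge> 1"
      using third[of x] third[of y] third[of z] by simp
    then show False using t by (simp add: hyperbolic_generating_triple_def)
  qed
  obtain a b d a' b' d' where h: "hyperbolic_generating_triple G a b d" "hyperbolic_generating_triple G a' b' d'"
    and disj: "\<forall>x\<in>{a, b, d}. \<forall>y\<in>{a', b', d'}. \<forall>(i :: int) (j :: int).
           x [^] i \<noteq> \<one> \<longrightarrow> \<not> conjugate_in G (x [^] i) (y [^] j)"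
    using B unfolding beauville_group_def by blast
  obtain u g m where u: "u \<in> {a, b, d}" "g \<in> carrier G" "g \<otimes> u [^] (m :: nat) \<otimes> inv g = c"
    using big[OF h(1)] by blast
  obtain v g' m' where v: "v \<in> {a', b', d'}" "g' \<in> carrier G" "g' \<otimes> v [^] (m' :: nat) \<otimes> inv g' = c"
    using big[OF h(2)] by blast
  have cl: "u \<in> carrier G" "v \<in> carrier G" using h u(1) v(1) by (auto simp: hyperbolic_generating_triple_def)
  then have p: "u [^] m \<in> carrier G" "v [^] m' \<in> carrier G" by simp_all
  have "u [^] m \<noteq> \<one>" using u(2,3) c(2) by auto
  then have "u [^] (int m) \<noteq> \<one>" by (simp add: int_pow_int)
  moreover have "conjugate_in G (u [^] (int m)) (v [^] (int m'))"
    unfolding conjugate_in_def int_pow_int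
  proof (rule bexI)
    show k: "inv g' \<otimes> g \<in> carrier G" using u(2) v(2) by simp
    have "inv g' \<otimes> g \<otimes> u [^] m \<otimes> inv (inv g' \<otimes> g) = inv g' \<otimes> (g \<otimes> u [^] m \<otimes> inv g) \<otimes> g'"
      using u(2) v(2) p by (simp add: inv_mult_group m_assoc)
    also have "\<dots> = inv g' \<otimes> (g' \<otimes> v [^] m' \<otimes> inv g') \<otimes> g'" unfolding u(3) v(3) ..
    also have "\<dots> = v [^] m'" using v(2) p by (simp add: m_assoc) (simp add: m_assoc[symmetric])
    finally show "inv g' \<otimes> g \<otimes> u [^] m \<otimes> inv (inv g' \<otimes> g) = v [^] m'" .
  qed
  ultimately show False using disj u(1) v(1) by blast
qed

text \<open>
  The elements of order five form two classes, and squaring exchanges them; so an element of order five or its square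
  is conjugate to the cycle \<open>(1 2 3 4 5)\<close>.
\<close>

definition fuses_to_cycle :: "nat list \<Rightarrow> nat list \<Rightarrow> bool" where
  "fuses_to_cycle xs g = (lcomp g xs = lcomp [2, 3, 4, 5, 1] g \<or> lcomp g (lcomp xs xs) = lcomp [2, 3, 4, 5, 1] g)"

definition small_or_fuses :: "nat list \<Rightarrow> bool" where
  "small_or_fuses xs = (lcomp xs xs = [1, 2, 3, 4, 5] \<or> lcomp xs (lcomp xs xs) = [1, 2, 3, 4, 5] \<or>
     list_ex (fuses_to_cycle xs) elems5)"

lemma elems5_small_or_fuse: "list_all small_or_fuses elems5"
  by code_simp

lemma five_cycle_elems5: "[2, 3, 4, 5, 1] \<in> set elems5"
proof -
  have "List.member elems5 [2, 3, 4, 5, 1]" by code_simp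
  then show ?thesis by simp
qed

lemma alt_group_5_one_class:
  assumes p: "p \<in> carrier (alt_group 5)"
  shows "p [^]\<^bsub>alt_group 5\<^esub> (2 :: nat) = \<one>\<^bsub>alt_group 5\<^esub> \<or> p [^]\<^bsub>alt_group 5\<^esub> (3 :: nat) = \<one>\<^bsub>alt_group 5\<^esub> \<or>
    (\<exists>g\<in>carrier (alt_group 5). \<exists>m :: nat. g \<otimes>\<^bsub>alt_group 5\<^esub> p [^]\<^bsub>alt_group 5\<^esub> m \<otimes>\<^bsub>alt_group 5\<^esub> inv\<^bsub>alt_group 5\<^esub> g
      = lperm [2, 3, 4, 5, 1])"
proof -
  interpret group "alt_group 5" by (rule alt_group_is_group)
  obtain xs where xs: "xs \<in> set elems5" "p = lperm xs" by (rule alt_group_5_elements[OF p])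
  have l: "xs \<in> lists_of 5" using elems5_in[OF xs(1)] by blast
  note ll = lcomp_lists_of[OF l l]
  have pw: "p [^]\<^bsub>alt_group 5\<^esub> (2 :: nat) = lperm (lcomp xs xs)" "p [^]\<^bsub>alt_group 5\<^esub> (3 :: nat) = lperm (lcomp xs (lcomp xs xs))"
      "p [^]\<^bsub>alt_group 5\<^esub> (1 :: nat) = lperm xs"
    unfolding alt_group_pow lperm_lcomp[OF l ll] lperm_lcomp[OF l l] xs(2)
    by (simp_all add: numeral_2_eq_2 numeral_3_eq_3)
  have id: "lperm [1, 2, 3, 4, 5] = \<one>\<^bsub>alt_group 5\<^esub>"
  proof -
    have "[1..<Suc 5] = [1, 2, 3, 4, 5]" by code_simp
    then show ?thesis using lperm_upt[of 5] unfolding alt_group_one by (simp only:)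
  qed
  have "small_or_fuses xs" using elems5_small_or_fuse xs(1) by (simp add: list_all_iff)
  then consider "lcomp xs xs = [1, 2, 3, 4, 5]" | "lcomp xs (lcomp xs xs) = [1, 2, 3, 4, 5]"
    | g where "g \<in> set elems5" "fuses_to_cycle xs g"
    unfolding small_or_fuses_def list_ex_iff by blast
  then show ?thesis
  proof cases
    case 1 then show ?thesis using pw(1) id by simp
  next
    case 2 then show ?thesis using pw(2) id by simp
  next
    case 3
    have gl: "g \<in> lists_of 5" "lperm g \<in> carrier (alt_group 5)" using elems5_in[OF 3(1)] by blast+
    have cl: "[2, 3, 4, 5, 1] \<in> lists_of 5" by (simp add: lists_of_def)
    have conj: "lperm g \<otimes>\<^bsub>alt_group 5\<^esub> q \<otimes>\<^bsub>alt_group 5\<^esub> inv\<^bsub>alt_group 5\<^esub> lperm g = lperm [2, 3, 4, 5, 1]"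
      if "lcomp g zs = lcomp [2, 3, 4, 5, 1] g" "zs \<in> lists_of 5" "q = lperm zs" for zs q
    proof -
      have "lperm g \<circ> lperm zs = lperm [2, 3, 4, 5, 1] \<circ> lperm g"
        unfolding lperm_lcomp[OF gl(1) that(2), symmetric] lperm_lcomp[OF cl gl(1), symmetric] that(1) ..
      then have "conj_by (lperm g) q = lperm [2, 3, 4, 5, 1]"
        unfolding that(3) by (rule conj_by_eqI[where n = 5, rotated]) (use gl(2) in \<open>simp add: alt_group_carrier\<close>)
      then show ?thesis
        using conj_by_def[where g = "lperm g" and n = 5] gl(2) unfolding alt_group_inv_equality[OF gl(2)] alt_group_mult_apply
        by (simp add: alt_group_carrier)
    qed
    from 3(2) show ?thesis
      unfolding fuses_to_cycle_def using conj[OF _ l pw(3)] conj[OF _ ll pw(1)] gl(2) by blast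
  qed
qed

section \<open>The first power\<close>

definition diag1 :: "'a \<Rightarrow> nat \<Rightarrow> 'a" where
  "diag1 p = (\<lambda>i\<in>{1..1}. p)"

lemma diag1_iso:
  assumes "group H"
  shows "diag1 \<in> iso H (direct_power H 1)"
  unfolding iso_def
proof (intro CollectI conjI)
  interpret group H by fact
  show "diag1 \<in> hom H (direct_power H 1)"
    by (rule homI) (auto simp: direct_power_def diag1_def)
  show "bij_betw diag1 (carrier H) (carrier (direct_power H 1))"
    by (rule bij_betwI[where g = "\<lambda>f. f 1"]) (auto simp: direct_power_def diag1_def fun_eq_iff PiE_iff extensional_def)
qed

lemma not_beauville_alt_group_5: "\<not> beauville_group (direct_power (alt_group 5) 1)"
proof -
  let ?H = "alt_group 5" and ?G = "direct_power (alt_group 5) 1"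
  interpret H: group ?H by (rule alt_group_is_group)
  have "group ?G" unfolding direct_power_def by (simp add: alt_group_is_group)
  then interpret G: group ?G .
  have bij: "bij_betw diag1 (carrier ?H) (carrier ?G)" and hom: "diag1 \<in> hom ?H ?G"
    using diag1_iso[OF H.is_group] by (auto simp: iso_def)
  interpret h: group_hom ?H ?G diag1 by (intro group_hom.intro group_hom_axioms.intro H.is_group G.is_group hom)
  let ?c = "lperm [2, 3, 4, 5, 1]"
  have c: "?c \<in> carrier ?H" using elems5_in[OF five_cycle_elems5] by blast
  have "?c 1 = 2" by (simp add: lperm_def)
  then have "?c \<noteq> \<one>\<^bsub>?H\<^esub>" by (metis alt_group_one id_apply numeral_eq_one_iff semiring_norm(85))
  then have ne: "diag1 ?c \<noteq> \<one>\<^bsub>?G\<^esub>"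
    using inj_onD[OF bij_betw_imp_inj_on[OF bij], of ?c "\<one>\<^bsub>?H\<^esub>"] c by auto
  show ?thesis
  proof (rule G.not_beauville_one_class[OF h.hom_closed[OF c] ne])
    fix u assume "u \<in> carrier ?G"
    then obtain p where p: "p \<in> carrier ?H" "u = diag1 p" using bij by (auto simp: bij_betw_def)
    have pow: "u [^]\<^bsub>?G\<^esub> (m :: nat) = diag1 (p [^]\<^bsub>?H\<^esub> m)" for m
      unfolding p(2) using h.hom_nat_pow[OF p(1)] by simp
    from alt_group_5_one_class[OF p(1)]
    show "u [^]\<^bsub>?G\<^esub> (2 :: nat) = \<one>\<^bsub>?G\<^esub> \<or> u [^]\<^bsub>?G\<^esub> (3 :: nat) = \<one>\<^bsub>?G\<^esub> \<or>
      (\<exists>g\<in>carrier ?G. \<exists>m :: nat. g \<otimes>\<^bsub>?G\<^esub> u [^]\<^bsub>?G\<^esub> m \<otimes>\<^bsub>?G\<^esub> inv\<^bsub>?G\<^esub> g = diag1 ?c)"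
    proof (elim disjE bexE exE)
      fix g and m :: nat assume g: "g \<in> carrier ?H" "g \<otimes>\<^bsub>?H\<^esub> p [^]\<^bsub>?H\<^esub> m \<otimes>\<^bsub>?H\<^esub> inv\<^bsub>?H\<^esub> g = ?c"
      have "diag1 g \<otimes>\<^bsub>?G\<^esub> u [^]\<^bsub>?G\<^esub> m \<otimes>\<^bsub>?G\<^esub> inv\<^bsub>?G\<^esub> diag1 g = diag1 (g \<otimes>\<^bsub>?H\<^esub> p [^]\<^bsub>?H\<^esub> m \<otimes>\<^bsub>?H\<^esub> inv\<^bsub>?H\<^esub> g)"
        unfolding pow using g(1) p(1) by (simp only: h.hom_mult h.hom_inv H.m_closed H.inv_closed H.nat_pow_closed)
      then show ?thesis using h.hom_closed[OF g(1)] unfolding g(2) by blast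
    qed (simp_all only: pow h.hom_one simp_thms)
  qed
qed

text \<open>
  The order of the alternating group of degree \<open>n\<close> is at least 60, with equality only for \<open>n = 5\<close>.
\<close>

lemma direct_power_iso_alt_5_iff:
  assumes n: "n \<ge> 5" and k: "k \<ge> 1"
  shows "direct_power (alt_group n) k \<cong> alt_group 5 \<longleftrightarrow> n = 5 \<and> k = 1"
proof
  assume "n = 5 \<and> k = 1"
  then show "direct_power (alt_group n) k \<cong> alt_group 5"
    using group.iso_sym[OF alt_group_is_group is_isoI[OF diag1_iso[OF alt_group_is_group]]] by simp
next
  define c where "c = card (carrier (alt_group n))"
  have c2: "2 * c = fact n" unfolding c_def by (rule alt_group_card_carrier) (use n in simp)
  have f5: "(fact 5 :: nat) = 120" "(fact 6 :: nat) = 720" by (simp_all add: fact_numeral)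
  have c5: "2 * card (carrier (alt_group 5)) = fact 5" by (rule alt_group_card_carrier) simp
  assume "direct_power (alt_group n) k \<cong> alt_group 5"
  then have "card (carrier (direct_power (alt_group n) k)) = 60" using iso_same_card c5 f5 by fastforce
  moreover have "card (carrier (direct_power (alt_group n) k)) = c ^ k"
    by (simp add: direct_power_def card_PiE c_def)
  ultimately have ck: "c ^ k = 60" by simp
  have c60: "c \<ge> 60" using fact_mono_nat[OF n] c2 f5(1) by linarith
  have "c ^ 1 \<le> c ^ k" by (rule power_increasing[OF k]) (use c60 in simp)
  then have c: "c = 60" using ck c60 by simp
  have "n = 5"
  proof (rule ccontr)
    assume "n \<noteq> 5"
    then have "fact 6 \<le> (fact n :: nat)" using n by (intro fact_mono_nat) simp
    then show False using c c2 f5(2) by linarith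
  qed
  moreover have "k = 1"
  proof (rule ccontr)
    assume "k \<noteq> 1"
    then have "c ^ 2 \<le> c ^ k" using k by (intro power_increasing) (use c in simp_all)
    then show False using ck c by simp
  qed
  ultimately show "n = 5 \<and> k = 1" by blast
qed

section \<open>The equivalence\<close>

lemma beauville_alt_power:
  assumes n: "n \<ge> 5" and k: "1 \<le> k" "k \<le> d2 (alt_group n)" and no: "\<not> (n = 5 \<and> k = 1)"
  shows "beauville_group (direct_power (alt_group n) k)"
proof -
  consider "n = 5" | "n = 6" | "n \<in> {7, 8, 9}" | "n \<ge> 10" using n by force
  then show ?thesis
  proof cases
    case 1
    then have "2 \<le> k" "k \<le> 19" using no k d2_alt_group_5 by auto
    then show ?thesis using beauville_alt_power_degree_5 1 by simp
  next
    case 2 then show ?thesis using beauville_alt_power_degree_6 k by simp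
  next
    case 3 then show ?thesis using beauville_alt_power_degree_7_to_9 k by blast
  next
    case 4 then show ?thesis using beauville_alt_power_degree_ge_10 k by blast
  qed
qed

theorem theorem1p1:
  fixes n k :: nat
    and H :: "(nat \<Rightarrow> nat) monoid"
    and G :: "(nat \<Rightarrow> nat \<Rightarrow> nat) monoid"
  assumes "n \<ge> 5" and "k \<ge> 1"
    and "H = alt_group n"
    and "G = direct_power H k"
  shows "(beauville_group G \<longleftrightarrow> two_generator_group G \<and> \<not> G \<cong> alt_group 5) \<and>
         (two_generator_group G \<and> \<not> G \<cong> alt_group 5 \<longleftrightarrow>
            n = 5 \<and> 2 \<le> k \<and> k \<le> d2 H \<or> n > 5 \<and> k \<le> d2 H) \<and>
         (n = 5 \<longrightarrow> d2 H = 19)"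
proof -
  have two: "two_generator_group G \<longleftrightarrow> k \<le> d2 H"
    unfolding assms(3,4) by (rule two_generator_direct_power_iff[OF alt_group_hyps[OF assms(1)]])
  have iso: "G \<cong> alt_group 5 \<longleftrightarrow> n = 5 \<and> k = 1"
    unfolding assms(3,4) by (rule direct_power_iso_alt_5_iff[OF assms(1,2)])
  have "beauville_group G \<longleftrightarrow> k \<le> d2 H \<and> \<not> (n = 5 \<and> k = 1)"
  proof
    assume b: "beauville_group G"
    have "\<not> (n = 5 \<and> k = 1)" using b not_beauville_alt_group_5 unfolding assms(3,4) by auto
    then show "k \<le> d2 H \<and> \<not> (n = 5 \<and> k = 1)" using beauville_two_generator[OF b] two by blast
  next
    assume "k \<le> d2 H \<and> \<not> (n = 5 \<and> k = 1)"
    then show "beauville_group G" unfolding assms(3,4) using beauville_alt_power[OF assms(1,2)] by blast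
  qed
  moreover have "(k \<le> d2 H \<and> \<not> (n = 5 \<and> k = 1)) \<longleftrightarrow>
      (n = 5 \<and> 2 \<le> k \<and> k \<le> d2 H \<or> n > 5 \<and> k \<le> d2 H)"
    using assms(1,2) by auto
  moreover have "n = 5 \<longrightarrow> d2 H = 19" unfolding assms(3) using d2_alt_group_5 by simp
  ultimately show ?thesis unfolding two iso by blast
qed

end
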